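(* Let $1<p,q<\infty$ with $\frac1p+\frac1q=1$. Let $E\in L^p(\mathbb R^n\times\mathbb R^m;\mathbb R^{n+m})$ and $B\in L^q(\mathbb R^n\times\mathbb R^m;\mathbb R^{n+m})$ satisfy $\operatorname{div}_{(x,y)}E=0$, $\operatorname{curl}_{(x,y)}B=0$ on $\mathbb R^{n+m}$, and, for every $x\in\mathbb R^n$, $\operatorname{div}_yE(x,\cdot)=0$ and $\operatorname{curl}_yB(x,\cdot)=0$ on $\mathbb R^m$. Then $$\|E\cdot B\|_{H^1(\mathbb R^{n+m})}\lesssim\|E\|_{L^p(\mathbb R^n\times\mathbb R^m;\mathbb R^{n+m})}\|B\|_{L^q(\mathbb R^n\times\mathbb R^m;\mathbb R^{n+m})}$$ and $$\int_{\mathbb R^n}\|E(x,\cdot)\cdot_2B(x,\cdot)\|_{H^1(\mathbb R^m)}\,dx\lesssim\|E\|_{L^p(\mathbb R^n\times\mathbb R^m;\mathbb R^{n+m})}\|B\|_{L^q(\mathbb R^n\times\mathbb R^m;\mathbb R^{n+m})},$$ where $E(x,y)\cdot_2B(x,y)=\sum_{k=1}^mE_{n+k}(x,y)B_{n+k}(x,y)$.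
   Context: $E=(E_1,\dots,E_{n+m})$, $B=(B_1,\dots,B_{n+m})$, variables $(x,y)\in\mathbb R^n\times\mathbb R^m$. $\operatorname{div}_yE(x,\cdot)=0$ means $\sum_{k=1}^m\partial_{y_k}E_{n+k}(x,\cdot)=0$ and $\operatorname{curl}_yB(x,\cdot)=0$ means $\partial_{y_k}B_{n+l}(x,\cdot)=\partial_{y_l}B_{n+k}(x,\cdot)$ for all $k,l$ (in the distributional sense). $H^1(\mathbb R^d)$ denotes the classical real Hardy space. *)

theory Defs
  imports "HOL-Analysis.Analysis"
begin

definition dpart :: "'c::euclidean_space \<Rightarrow> ('c \<Rightarrow> real) \<Rightarrow> 'c \<Rightarrow> real" where
  "dpart i f x = frechet_derivative f (at x) i"

fun C_k :: "nat \<Rightarrow> ('c::euclidean_space \<Rightarrow> real) \<Rightarrow> bool" where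
  "C_k 0 f = continuous_on UNIV f"
| "C_k (Suc k) f = (f differentiable_on UNIV \<and> continuous_on UNIV f \<and>
                    (\<forall>i\<in>Basis. C_k k (dpart i f)))"

definition smooth_fun :: "('c::euclidean_space \<Rightarrow> real) \<Rightarrow> bool" where
  "smooth_fun f \<longleftrightarrow> (\<forall>k. C_k k f)"

definition test_fun :: "('c::euclidean_space \<Rightarrow> real) \<Rightarrow> bool" where
  "test_fun \<phi> \<longleftrightarrow> smooth_fun \<phi> \<and> compact (closure {x. \<phi> x \<noteq> 0})"

definition loc_integrable :: "('c::euclidean_space \<Rightarrow> 'd::euclidean_space) \<Rightarrow> bool" where
  "loc_integrable F \<longleftrightarrow> (\<forall>K. compact K \<longrightarrow> set_integrable lborel K F)"

definition div_free :: "('c::euclidean_space \<Rightarrow> 'c) \<Rightarrow> bool" where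
  "div_free F \<longleftrightarrow> loc_integrable F \<and>
     (\<forall>\<phi>. test_fun \<phi> \<longrightarrow>
        (\<integral>z. (\<Sum>i\<in>Basis. (F z \<bullet> i) * dpart i \<phi> z) \<partial>lborel) = 0)"

definition curl_free :: "('c::euclidean_space \<Rightarrow> 'c) \<Rightarrow> bool" where
  "curl_free F \<longleftrightarrow> loc_integrable F \<and>
     (\<forall>\<phi>. test_fun \<phi> \<longrightarrow> (\<forall>k\<in>Basis. \<forall>l\<in>Basis.
        (\<integral>z. (F z \<bullet> l) * dpart k \<phi> z \<partial>lborel) =
        (\<integral>z. (F z \<bullet> k) * dpart l \<phi> z \<partial>lborel)))"

definition in_Lp :: "real \<Rightarrow> ('c::euclidean_space \<Rightarrow> 'd::euclidean_space) \<Rightarrow> bool" where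
  "in_Lp p F \<longleftrightarrow> F \<in> borel_measurable lborel \<and> integrable lborel (\<lambda>z. norm (F z) powr p)"

definition Lp_norm :: "real \<Rightarrow> ('c::euclidean_space \<Rightarrow> 'd::euclidean_space) \<Rightarrow> real" where
  "Lp_norm p F = (\<integral>z. norm (F z) powr p \<partial>lborel) powr (1 / p)"

text \<open>Real Hardy space H^1 via the Fefferman--Stein smooth maximal function with the
  Gaussian kernel g(z) = exp(-pi |z|^2) (integral 1), g_t(z) = t^(-d) g(z/t).\<close>
definition gauss_kernel :: "real \<Rightarrow> 'c::euclidean_space \<Rightarrow> real" where
  "gauss_kernel t z = (1 / t) ^ DIM('c) * exp (- pi * (norm z / t)\<^sup>2)"

definition hardy_max :: "('c::euclidean_space \<Rightarrow> real) \<Rightarrow> 'c \<Rightarrow> ennreal" where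
  "hardy_max f x = (SUP t\<in>{0<..}. ennreal \<bar>\<integral>y. gauss_kernel t (x - y) * f y \<partial>lborel\<bar>)"

definition hardy_norm :: "('c::euclidean_space \<Rightarrow> real) \<Rightarrow> ennreal" where
  "hardy_norm f = (if integrable lborel f then \<integral>\<^sup>+x. hardy_max f x \<partial>lborel else \<infinity>)"

end

theory Submission
  imports Defs
begin

text \<open>For a single div-curl pair \<open>F \<in> L\<^sup>p\<close>, \<open>G \<in> L\<^sup>q\<close> put
  \<open>I(s) = \<integral>\<integral> \<phi>(y) F(y) \<bullet> G(z) \<rho>\<^sub>s(y - z) dz dy\<close>, where \<open>\<phi>(y)\<close> is the Gaussian of scale \<open>t\<close>
  centred at \<open>x\<close> and \<open>\<rho>\<^sub>s\<close> a compactly supported mollifier of scale \<open>s\<close>. The derivative of \<open>\<rho>\<^sub>s\<close> in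
  \<open>s\<close> is the divergence of \<open>-w \<rho>\<^sub>s(w) / s\<close>; curl-freeness of \<open>G\<close> turns that divergence into a gradient
  in \<open>y\<close>, which the divergence-freeness of \<open>F\<close> moves onto \<open>\<phi>\<close>. Hence
  \<open>|I'(s)| \<le> \<integral>\<integral> |\<nabla>\<phi>(y)| |F(y)| |G(z)| \<rho>\<^sub>s(y - z) dz dy\<close>, with a gain \<open>1 / t\<close> from \<open>\<nabla>\<phi>\<close>. A
  Young-type inequality with exponents \<open>\<alpha> < p\<close>, \<open>\<beta> < q\<close> bounds this by
  \<open>t\<inverse> (t / s)\<^sup>\<kappa> (M|F|\<^sup>\<alpha>)\<^sup>1\<^sup>/\<^sup>\<alpha> (M|G|\<^sup>\<beta>)\<^sup>1\<^sup>/\<^sup>\<beta>\<close> at \<open>x\<close>, where \<open>\<kappa> < 1\<close> and \<open>M\<close> is the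
  Hardy-Littlewood maximal function. This is integrable over \<open>0 < s < t\<close>, the term \<open>I(t)\<close> obeys the
  same bound without any cancellation, and \<open>I(0+)\<close> is a multiple of the Gaussian average of
  \<open>F \<bullet> G\<close>; so the maximal theorem gives the Hardy norm bound. The second inequality applies this on
  every slice. Keeping the bound additive,
  \<open>C (d\<^sup>p \<integral>|F|\<^sup>p + d\<^sup>-\<^sup>q \<integral>|G|\<^sup>q)\<close> for all \<open>d > 0\<close>, lets Tonelli replace Hoelder's inequality; \<open>d\<close> is optimised at
  the very end.\<close>

section \<open>Smooth functions, bumps and mollifiers\<close>

text \<open>A potential for the curl-free field, with a Sobolev-Poincare inequality for it, is
  avoided: letting the mollification scale run from \<open>t\<close> down to 0 uses only the two
  weak identities. The Gaussian itself is not an admissible test function; a compactly supported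
  mollifier in y - z makes the product with it admissible. The exponents pull in opposite
  directions. Let N be the dimension. The maximal theorem with exponents p/\<alpha> and q/\<beta>
  needs \<alpha> < p and \<beta> < q, which forces \<theta> = 1/\<alpha> + 1/\<beta> - 1 > 0; pairs
  at distance below s, seen from scale t, are then controlled only up to the volume ratio (t/s)^N
  raised to the power \<theta>. So \<kappa> = N \<theta>, and the gain 1/t pays for it while
  \<kappa> < 1. Taking \<alpha>, \<beta> close enough to p, q gives \<kappa> \<le> 1/2.
  Measurability of \<open>hardy_max\<close>, or of the Hardy norm of a slice as a function of x, is
  not established: \<open>nn_integral_mono\<close> compares them with measurable majorants.\<close>

lemma dpart_eq: "(f has_derivative D) (at x) \<Longrightarrow> dpart i f x = D i"
  by (simp add: dpart_def frechet_derivative_at[symmetric])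

section \<open>Closure properties of the classes \<open>C_k\<close>\<close>

lemma C_k_SucD: "C_k (Suc k) f \<Longrightarrow> C_k k f"
  by (induction k arbitrary: f) auto

lemma C_k_Suc_has_derivative:
  "C_k (Suc k) f \<Longrightarrow> (f has_derivative frechet_derivative f (at x)) (at x)"
  by (simp add: differentiable_on_def frechet_derivative_works)

lemma C_k_SucI:
  assumes "\<And>x. (f has_derivative D x) (at x)" and "\<And>i. i \<in> Basis \<Longrightarrow> C_k k (\<lambda>x. D x i)"
  shows "C_k (Suc k) f"
proof -
  have "f differentiable_on UNIV"
    using assms(1) by (auto simp: differentiable_on_def differentiable_def)
  moreover have "dpart i f = (\<lambda>x. D x i)" for i
    using dpart_eq[OF assms(1)] by auto
  ultimately show ?thesis
    using assms(2) by (simp add: differentiable_imp_continuous_on)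
qed

lemma C_k_const: "C_k k (\<lambda>x. c)"
  by (induction k arbitrary: c) (auto intro!: C_k_SucI derivative_eq_intros simp del: C_k.simps(2))

lemma C_k_add: "C_k k f \<Longrightarrow> C_k k g \<Longrightarrow> C_k k (\<lambda>x. f x + g x)"
proof (induction k arbitrary: f g)
  case (Suc k)
  show ?case
    by (rule C_k_SucI[OF has_derivative_add
          [OF C_k_Suc_has_derivative[OF Suc.prems(1)] C_k_Suc_has_derivative[OF Suc.prems(2)]]])
      (use Suc in \<open>auto simp: dpart_def[abs_def]\<close>)
qed (auto intro: continuous_intros)

lemma C_k_mult: "C_k k f \<Longrightarrow> C_k k g \<Longrightarrow> C_k k (\<lambda>x. f x * g x)"
proof (induction k arbitrary: f g)
  case (Suc k)
  have *: "C_k k f" "C_k k g"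
    using Suc.prems by (auto dest: C_k_SucD simp del: C_k.simps)
  show ?case
    by (rule C_k_SucI[OF has_derivative_mult
          [OF C_k_Suc_has_derivative[OF Suc.prems(1)] C_k_Suc_has_derivative[OF Suc.prems(2)]]])
      (use Suc * in \<open>auto simp: dpart_def[abs_def] intro!: C_k_add\<close>)
qed (auto intro: continuous_intros)

lemma C_k_sum: "(\<And>i. i \<in> A \<Longrightarrow> C_k k (f i)) \<Longrightarrow> C_k k (\<lambda>x. \<Sum>i\<in>A. f i x)"
  by (induction A rule: infinite_finite_induct) (auto intro: C_k_const C_k_add)

lemma C_k_inner: "C_k k (\<lambda>x. x \<bullet> v)"
proof (cases k)
  case (Suc l)
  have "C_k (Suc l) (\<lambda>x. x \<bullet> v)"
    by (rule C_k_SucI[where D="\<lambda>x h. h \<bullet> v"]) (auto intro!: derivative_eq_intros C_k_const)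
  then show ?thesis using Suc by simp
qed (auto intro: continuous_intros)

lemma C_k_norm_power2: "C_k k (\<lambda>x. (norm (x - c))\<^sup>2)"
proof -
  have "(\<lambda>x. (norm (x - c))\<^sup>2) = (\<lambda>x. \<Sum>i\<in>Basis. (x \<bullet> i + (- (c \<bullet> i))) * (x \<bullet> i + (- (c \<bullet> i))))"
    unfolding power2_norm_eq_inner by (subst euclidean_inner) (simp add: inner_diff_left)
  then show ?thesis
    by (simp only:) (intro C_k_sum C_k_mult C_k_add C_k_inner C_k_const)
qed

text \<open>A family \<open>S\<close> closed under differentiation plays the role of a smooth outer
  function: the chain rule produces f' composed with \<open>g\<close>, and the induction hypothesis
  applies again because f' lies in \<open>S\<close>. It is used with \<open>{exp}\<close> and with
  \<open>range bump_poly\<close>.\<close>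

lemma C_k_compose:
  assumes fam: "\<And>f. f \<in> S \<Longrightarrow> \<exists>f'\<in>S. \<forall>x. (f has_real_derivative f' x) (at x)"
  shows "f \<in> S \<Longrightarrow> C_k k g \<Longrightarrow> C_k k (\<lambda>x. f (g x))"
proof (induction k arbitrary: f)
  case 0
  obtain f' where "\<And>x. (f has_real_derivative f' x) (at x)"
    using fam 0 by blast
  then have "continuous_on UNIV f"
    by (meson DERIV_isCont continuous_at_imp_continuous_on)
  then show ?case
    using 0 by (auto intro: continuous_on_compose2)
next
  case (Suc k)
  obtain f' where f': "f' \<in> S" "\<And>x. (f has_real_derivative f' x) (at x)"
    using fam Suc.prems by blast
  have "((\<lambda>x. f (g x)) has_derivative (\<lambda>h. frechet_derivative g (at x) h * f' (g x))) (at x)" for x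
    using has_derivative_compose[OF C_k_Suc_has_derivative[OF Suc.prems(2)]
        f'(2)[of "g x", unfolded has_field_derivative_def]]
    by (simp add: mult.commute)
  then show ?case
    by (rule C_k_SucI)
      (use Suc f' C_k_SucD[OF Suc.prems(2)] in \<open>auto intro!: C_k_mult simp: dpart_def[abs_def]\<close>)
qed

lemma C_k_exp: "C_k k g \<Longrightarrow> C_k k (\<lambda>x. exp (g x))"
  by (rule C_k_compose[of "{exp}"]) (auto intro!: derivative_eq_intros)

text \<open>The functions \<open>P(1 / x) exp(-1 / x)\<close> for \<open>x > 0\<close>, extended by \<open>0\<close>, form a family closed under
  differentiation, so each of them is smooth.\<close>

definition bump_poly :: "real poly \<Rightarrow> real \<Rightarrow> real" where
  "bump_poly P x = (if x > 0 then poly P (1 / x) * exp (- (1 / x)) else 0)"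

lemma poly_times_exp_minus_tendsto_0: "((\<lambda>x::real. poly P x * exp (- x)) \<longlongrightarrow> 0) at_top"
proof -
  have "((\<lambda>x. \<Sum>i\<le>degree P. coeff P i * (x ^ i / exp x)) \<longlongrightarrow> (\<Sum>i\<le>degree P. coeff P i * 0)) at_top"
    by (intro tendsto_intros tendsto_power_div_exp_0)
  then show ?thesis
    by (simp add: poly_altdef sum_distrib_right exp_minus divide_inverse mult.assoc)
qed

text \<open>With u = 1/x, d/dx is - u^2 d/du, which turns P(u) exp(-u) into u^2 (P - P')(u) exp(-u),
  a function of the same family. At 0 both one-sided difference quotients vanish because exponential
  decay beats every polynomial.\<close>

lemma DERIV_bump_poly:
  "(bump_poly P has_real_derivative bump_poly (monom 1 2 * (P - pderiv P)) x) (at x)"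
proof -
  consider "x > 0" | "x < 0" | "x = 0" by linarith
  then show ?thesis
  proof cases
    case 1
    have "((\<lambda>x. poly P (1 / x) * exp (- (1 / x))) has_real_derivative
        bump_poly (monom 1 2 * (P - pderiv P)) x) (at x)"
      using 1 by (auto intro!: derivative_eq_intros DERIV_chain2[OF poly_DERIV]
          simp: bump_poly_def poly_monom field_simps power2_eq_square)
    then show ?thesis
      by (rule has_field_derivative_transform_within_open[of _ _ _ "{0<..}"])
        (use 1 in \<open>auto simp: bump_poly_def\<close>)
  next
    case 2
    have "((\<lambda>x. 0) has_real_derivative bump_poly (monom 1 2 * (P - pderiv P)) x) (at x)"
      using 2 by (simp add: bump_poly_def)
    then show ?thesis
      by (rule has_field_derivative_transform_within_open[of _ _ _ "{..<0}"])
        (use 2 in \<open>auto simp: bump_poly_def\<close>)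
  next
    case 3
    \<comment> \<open>With u = 1/h the difference quotient at 0 is u P(u) exp(-u), and
      \<open>pCons 0 P\<close> is the polynomial u P(u).\<close>
    have "((\<lambda>h. poly (pCons 0 P) (inverse h) * exp (- inverse h)) \<longlongrightarrow> 0) (at_right 0)"
      using filterlim_compose[OF poly_times_exp_minus_tendsto_0 filterlim_inverse_at_top_right] .
    then have "((\<lambda>h. bump_poly P h / h) \<longlongrightarrow> 0) (at_right 0)"
      by (rule Lim_transform_eventually)
        (auto simp: bump_poly_def eventually_at_filter field_simps)
    moreover have "((\<lambda>h. bump_poly P h / h) \<longlongrightarrow> 0) (at_left 0)"
      by (rule Lim_transform_eventually[OF tendsto_const])
        (auto simp: bump_poly_def eventually_at_filter)
    ultimately have "((\<lambda>h. bump_poly P h / h) \<longlongrightarrow> 0) (at 0)"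
      by (simp add: filterlim_split_at)
    then show ?thesis
      using 3 by (simp add: DERIV_def bump_poly_def)
  qed
qed

lemma C_k_bump_poly: "C_k k g \<Longrightarrow> C_k k (\<lambda>x. bump_poly P (g x))"
  by (rule C_k_compose[of "range bump_poly"]) (use DERIV_bump_poly in auto)

lemma bump_poly_1_bounds: "0 \<le> bump_poly 1 x" "bump_poly 1 x \<le> 1"
  by (auto simp: bump_poly_def)

text \<open>\<open>bump_poly (monom 1 2)\<close> is the derivative of the profile
  \<open>bump_poly 1\<close>. The bound 2 comes from exp u \<ge> 1 + u + u^2/2 at u = 1/x.\<close>

lemma bump_poly_deriv_bounds:
  "0 \<le> bump_poly (monom 1 2) x" "bump_poly (monom 1 2) x \<le> 2"
proof -
  have "u\<^sup>2 * exp (- u) \<le> 2" if "u \<ge> 0" for u :: real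
    using exp_lower_Taylor_quadratic[OF that] that by (simp add: exp_minus field_simps)
  from this[of "1/x"] show "bump_poly (monom 1 2) x \<le> 2"
    by (auto simp: bump_poly_def poly_monom)
qed (auto simp: bump_poly_def poly_monom)

text \<open>Not normalised: the mass \<open>\<integral> mollifier 1\<close> is carried along as a constant.\<close>

definition mollifier :: "real \<Rightarrow> 'c::euclidean_space \<Rightarrow> real" where
  "mollifier s w = (1 / s) ^ DIM('c) * bump_poly 1 (1 - (norm w / s)\<^sup>2)"

text \<open>Derivative at \<open>w\<close>, in direction \<open>k\<close>, of the j-th component of
  the field w \<open>mollifier s w\<close>. Being linear in \<open>k\<close>, the formula serves as
  a Frechet derivative; summed over the diagonal j = k it is the divergence of that field.\<close>

definition mollifier_grad :: "real \<Rightarrow> 'c::euclidean_space \<Rightarrow> 'c \<Rightarrow> 'c \<Rightarrow> real" where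
  "mollifier_grad s j k w = (j \<bullet> k) * mollifier s w
     - (1 / s) ^ DIM('c) * bump_poly (monom 1 2) (1 - (norm w / s)\<^sup>2) * (2 * (w \<bullet> j) * (w \<bullet> k) / s\<^sup>2)"

lemma bump_norm_eq_0: "s > 0 \<Longrightarrow> s \<le> norm w \<Longrightarrow> bump_poly P (1 - (norm w / s)\<^sup>2) = 0"
  using power_mono[of 1 "norm w / s" 2] by (auto simp: bump_poly_def not_less[symmetric])

lemma mollifier_nonneg: "s > 0 \<Longrightarrow> 0 \<le> mollifier s w"
  by (simp add: mollifier_def bump_poly_1_bounds)

lemma mollifier_le:
  fixes w :: "'c::euclidean_space"
  assumes "s > 0"
  shows "mollifier s w \<le> (1 / s) ^ DIM('c) * indicator (ball 0 s) w"
  using assms bump_poly_1_bounds(2)[of "1 - (norm w / s)\<^sup>2"]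
  by (auto simp: mollifier_def bump_norm_eq_0 indicator_def intro!: mult_left_le)

lemma mollifier_eq_0: "s > 0 \<Longrightarrow> s \<le> norm w \<Longrightarrow> mollifier s w = 0"
  by (simp add: mollifier_def bump_norm_eq_0)

text \<open>The 5 is 1 + 2 * 2: the profile is at most 1, its derivative at most 2, and 2 |w_j|
  |w_k| / s^2 is at most 2 on the ball.\<close>

lemma abs_mollifier_grad_le:
  fixes w :: "'c::euclidean_space"
  assumes "s > 0" "j \<in> Basis" "k \<in> Basis"
  shows "\<bar>mollifier_grad s j k w\<bar> \<le> 5 * (1 / s) ^ DIM('c) * indicator (ball 0 s) w"
proof (cases "norm w < s")
  case True
  have "\<bar>j \<bullet> k\<bar> \<le> 1"
    using assms by (simp add: inner_Basis)
  then have 1: "\<bar>(j \<bullet> k) * mollifier s w\<bar> \<le> 1 * (1 / s) ^ DIM('c)"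
    unfolding abs_mult using mollifier_le[OF assms(1), of w] mollifier_nonneg[OF assms(1), of w] True
    by (intro mult_mono) (auto simp: indicator_def)
  have "\<bar>2 * (w \<bullet> j) * (w \<bullet> k) / s\<^sup>2\<bar> = 2 * (\<bar>w \<bullet> j\<bar> / s) * (\<bar>w \<bullet> k\<bar> / s)"
    using assms by (simp add: abs_mult power2_eq_square)
  also have "\<dots> \<le> 2 * 1 * 1"
    using True assms Basis_le_norm[OF assms(2), of w] Basis_le_norm[OF assms(3), of w]
    by (intro mult_mono) auto
  finally have "\<bar>bump_poly (monom 1 2) (1 - (norm w / s)\<^sup>2) * (2 * (w \<bullet> j) * (w \<bullet> k) / s\<^sup>2)\<bar> \<le> 2 * 2"
    unfolding abs_mult[of "bump_poly _ _"] using bump_poly_deriv_bounds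
    by (intro mult_mono) auto
  then have 2: "\<bar>(1 / s) ^ DIM('c) * (bump_poly (monom 1 2) (1 - (norm w / s)\<^sup>2) * (2 * (w \<bullet> j) * (w \<bullet> k) / s\<^sup>2))\<bar>
      \<le> (1 / s) ^ DIM('c) * 4"
    unfolding abs_mult[of "(1 / s) ^ DIM('c)"] using assms by (intro mult_mono) auto
  have "\<bar>mollifier_grad s j k w\<bar> \<le> 5 * (1 / s) ^ DIM('c)"
    using 1 2 unfolding mollifier_grad_def by (simp only: mult.assoc)
  then show ?thesis
    using True by simp
next
  case False
  then show ?thesis
    using assms by (simp add: mollifier_grad_def bump_norm_eq_0 mollifier_eq_0)
qed

lemma has_derivative_coordinate_mollifier:
  fixes w :: "'c::euclidean_space"
  assumes "s > 0"
  shows "((\<lambda>w. (w \<bullet> j) * mollifier s w) has_derivative (\<lambda>h. mollifier_grad s j h w)) (at w)"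
proof -
  have B: "(bump_poly 1 has_real_derivative bump_poly (monom 1 2) x) (at x)" for x
    using DERIV_bump_poly[of 1 x] by simp
  have N: "((\<lambda>w. 1 - (w \<bullet> w) / s\<^sup>2) has_derivative (\<lambda>h. - (2 * (w \<bullet> h) / s\<^sup>2))) (at w)"
    unfolding divide_inverse using assms
    by (auto intro!: derivative_eq_intros simp: inner_commute algebra_simps)
  have "((\<lambda>w. bump_poly 1 (1 - (w \<bullet> w) / s\<^sup>2)) has_derivative
      (\<lambda>h. bump_poly (monom 1 2) (1 - (w \<bullet> w) / s\<^sup>2) * (- (2 * (w \<bullet> h) / s\<^sup>2)))) (at w)"
    using has_derivative_compose[OF N B[unfolded has_field_derivative_def]] by simp
  then show ?thesis
    unfolding mollifier_def mollifier_grad_def power_divide[of "norm w"] power_divide[of "norm _" s] power2_norm_eq_inner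
    by (auto intro!: derivative_eq_intros simp: algebra_simps inner_commute)
qed

text \<open>Euler's identity: \<open>mollifier s w\<close> is jointly homogeneous in (s, w) of
  degree minus the dimension, hence its s-derivative is minus the divergence of w
  \<open>mollifier s w\<close>, divided by s.\<close>

lemma DERIV_mollifier_scale:
  fixes w :: "'c::euclidean_space"
  assumes "s > 0"
  shows "((\<lambda>s. mollifier s w) has_real_derivative - (\<Sum>j\<in>Basis. mollifier_grad s j j w) / s) (at s)"
proof -
  have B: "(bump_poly 1 has_real_derivative bump_poly (monom 1 2) x) (at x)" for x
    using DERIV_bump_poly[of 1 x] by simp
  have N: "((\<lambda>s. 1 - (norm w / s)\<^sup>2) has_real_derivative 2 * (norm w)\<^sup>2 / s ^ 3) (at s)"
    using assms by (auto intro!: derivative_eq_intros simp: field_simps power2_eq_square power3_eq_cube)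
  have P: "((\<lambda>s. (1 / s) ^ DIM('c)) has_real_derivative - DIM('c) * (1 / s) ^ DIM('c) / s) (at s)"
  proof -
    have "DIM('c) > 0" by simp
    then obtain m where m: "DIM('c) = Suc m" using gr0_conv_Suc by blast
    show ?thesis unfolding m
      by (rule DERIV_cong[OF DERIV_power_Suc, of _ "- (1 / s\<^sup>2)"])
        (use assms in \<open>auto intro!: derivative_eq_intros simp: power2_eq_square field_simps\<close>)
  qed
  let ?b = "bump_poly 1 (1 - (norm w / s)\<^sup>2)" and ?b' = "bump_poly (monom 1 2) (1 - (norm w / s)\<^sup>2)"
  have "((\<lambda>s. mollifier s w) has_real_derivative
     - DIM('c) * (1 / s) ^ DIM('c) / s * ?b + ?b' * (2 * (norm w)\<^sup>2 / s ^ 3) * (1 / s) ^ DIM('c)) (at s)"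
    unfolding mollifier_def by (rule DERIV_mult[OF P DERIV_chain2[OF B N]])
  also have "- DIM('c) * (1 / s) ^ DIM('c) / s * ?b + ?b' * (2 * (norm w)\<^sup>2 / s ^ 3) * (1 / s) ^ DIM('c)
    = - (\<Sum>j\<in>Basis. mollifier_grad s j j w) / s"
  proof -
    have "(\<Sum>j\<in>Basis. mollifier_grad s j j w) = (\<Sum>j\<in>Basis. (1 / s) ^ DIM('c) * ?b
        - (1 / s) ^ DIM('c) * ?b' * 2 / s\<^sup>2 * ((w \<bullet> j) * (w \<bullet> j)))"
      by (intro sum.cong) (auto simp: mollifier_grad_def mollifier_def)
    also have "\<dots> = DIM('c) * ((1 / s) ^ DIM('c) * ?b) - (1 / s) ^ DIM('c) * ?b' * 2 / s\<^sup>2 * (norm w)\<^sup>2"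
      unfolding power2_norm_eq_inner[of w] euclidean_inner[of w w]
      by (simp add: sum_subtractf sum_distrib_left)
    finally show ?thesis
      using assms by (simp only:) (simp add: field_simps power2_eq_square power3_eq_cube)
  qed
  finally show ?thesis .
qed

lemma C_k_mollifier_shift: "C_k k (\<lambda>y. mollifier s (y - z))"
proof -
  have "C_k k (\<lambda>y. (1 / s) ^ DIM('a) * bump_poly 1 (1 + (-1 / s\<^sup>2) * (norm (y - z :: 'a))\<^sup>2))"
    by (intro C_k_mult C_k_const C_k_bump_poly C_k_add C_k_norm_power2)
  then show ?thesis
    by (simp add: mollifier_def power_divide)
qed

lemma C_k_gauss_kernel: "C_k k (\<lambda>y. gauss_kernel t (x - y))"
proof -
  have "C_k k (\<lambda>y. (1 / t) ^ DIM('a) * exp ((- pi / t\<^sup>2) * (norm (y - x :: 'a))\<^sup>2))"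
    by (intro C_k_mult C_k_const C_k_exp C_k_norm_power2)
  then show ?thesis
    by (simp add: gauss_kernel_def power_divide norm_minus_commute)
qed

section \<open>Test functions for the two weak identities\<close>

lemma test_fun_C_k:
  fixes f :: "'c::euclidean_space \<Rightarrow> real"
  assumes "\<And>k. C_k k f" and "\<And>w. r \<le> norm (w - z) \<Longrightarrow> f w = 0"
  shows "test_fun f"
proof -
  have "{x. f x \<noteq> 0} \<subseteq> cball z r"
    using assms(2) by (force simp: dist_norm norm_minus_commute not_le)
  then have "compact (closure {x. f x \<noteq> 0})"
    by (meson bounded_cball bounded_subset compact_closure)
  then show ?thesis
    using assms(1) by (simp add: test_fun_def smooth_fun_def)
qed

text \<open>Here \<open>y\<close> is fixed and \<open>z\<close> varies: this is what the curl
  condition on the second field is tested with.\<close>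

lemma test_fun_coordinate_mollifier:
  assumes "s > 0"
  shows "test_fun (\<lambda>z. ((y - z) \<bullet> j) * mollifier s (y - z))"
proof (rule test_fun_C_k[where r=s and z=y])
  have "mollifier s (y - z) = mollifier s (z - y)" for z
    by (simp add: mollifier_def norm_minus_commute)
  moreover have "(y - z) \<bullet> j = y \<bullet> j + (-1) * (z \<bullet> j)" for z
    by (simp add: inner_diff_left)
  ultimately show "C_k k (\<lambda>z. ((y - z) \<bullet> j) * mollifier s (y - z))" for k
    by (simp only:) (intro C_k_mult C_k_add C_k_const C_k_inner C_k_mollifier_shift)
qed (simp add: assms mollifier_eq_0 norm_minus_commute)

text \<open>Here \<open>z\<close> is fixed and \<open>y\<close> varies: this is what the divergence
  condition on the first field is tested with. The mollifier factor supplies the compact support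
  that the Gaussian lacks.\<close>

lemma test_fun_gauss_mollifier:
  assumes "s > 0"
  shows "test_fun (\<lambda>y. gauss_kernel t (x - y) * (((y - z) \<bullet> j) * mollifier s (y - z)))"
proof (rule test_fun_C_k[where r=s and z=z])
  have "(y - z) \<bullet> j = y \<bullet> j + (- (z \<bullet> j))" for y
    by (simp add: inner_diff_left)
  then show "C_k k (\<lambda>y. gauss_kernel t (x - y) * (((y - z) \<bullet> j) * mollifier s (y - z)))" for k
    by (simp only:) (intro C_k_mult C_k_add C_k_const C_k_inner C_k_mollifier_shift C_k_gauss_kernel)
qed (simp add: assms mollifier_eq_0 norm_minus_commute)

lemma has_derivative_gauss_kernel_shift:
  "((\<lambda>y. gauss_kernel t (x - y)) has_derivative
     (\<lambda>h. gauss_kernel t (x - y) * (2 * pi * ((x - y) \<bullet> h) / t\<^sup>2))) (at y)"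
proof -
  have "((\<lambda>y. - pi * ((x - y) \<bullet> (x - y) / t\<^sup>2)) has_derivative
      (\<lambda>h. 2 * pi * ((x - y) \<bullet> h) / t\<^sup>2)) (at y)"
    unfolding divide_inverse by (auto intro!: derivative_eq_intros simp: inner_commute algebra_simps)
  note has_derivative_mult_right[OF has_derivative_exp[OF this], of "(1 / t) ^ DIM('a)"]
  then show ?thesis
    unfolding gauss_kernel_def power_divide power2_norm_eq_inner
    by (simp add: mult_ac)
qed

section \<open>The dyadic Hardy-Littlewood maximal function\<close>

text \<open>Only dyadic radii are used, so that the supremum is countable and measurability is immediate.\<close>

definition dyadic_max :: "('c::euclidean_space \<Rightarrow> ennreal) \<Rightarrow> 'c \<Rightarrow> ennreal" where
  "dyadic_max u x = (SUP k::int. ennreal ((1 / 2 powi k) ^ DIM('c)) *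
     (\<integral>\<^sup>+y. u y * indicator (ball x (2 powi k)) y \<partial>lborel))"

lemma measurable_indicator_ball:
  "(\<lambda>p. indicator (ball (fst p) r) (snd p) :: ennreal)
     \<in> borel_measurable (borel \<Otimes>\<^sub>M (borel :: 'c::euclidean_space measure))"
proof -
  have "(\<lambda>p. indicator (ball (fst p) r) (snd p) :: ennreal) = indicator {p::'c \<times> 'c. dist (fst p) (snd p) < r}"
    by (auto simp: indicator_def fun_eq_iff)
  moreover have "{p::'c \<times> 'c. dist (fst p) (snd p) < r} \<in> sets (borel \<Otimes>\<^sub>M borel)"
    unfolding borel_prod by (intro borel_open open_Collect_less continuous_intros)
  ultimately show ?thesis
    by simp
qed

lemma measurable_dyadic_max [measurable]:
  fixes u :: "'c::euclidean_space \<Rightarrow> ennreal"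
  assumes [measurable]: "u \<in> borel_measurable borel"
  shows "dyadic_max u \<in> borel_measurable borel"
proof -
  have "(\<lambda>x. \<integral>\<^sup>+y. u y * indicator (ball x r) y \<partial>lborel) \<in> borel_measurable borel" for r
  proof (rule lborel.borel_measurable_nn_integral)
    have "(\<lambda>p. u (snd p) * indicator (ball (fst p) r) (snd p)) \<in> borel_measurable (borel \<Otimes>\<^sub>M borel)"
      by (intro borel_measurable_times_ennreal measurable_indicator_ball) measurable
    then show "(\<lambda>(x, y). u y * indicator (ball x r) y) \<in> borel_measurable (borel \<Otimes>\<^sub>M lborel)"
      by (simp add: case_prod_beta cong: measurable_cong_sets)
  qed
  then show ?thesis
    unfolding dyadic_max_def[abs_def] by (intro borel_measurable_SUP borel_measurable_times_ennreal) auto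
qed

text \<open>Vitali covering. Every point of the level set carries a ball of radius r with r^N at
  most 1/l times the mass of \<open>u\<close> in it; a disjoint subfamily, enlarged 5 times, still
  covers. The volume of the unit ball appears because \<open>dyadic_max\<close> divides by r^N and
  not by the volume of the ball.\<close>

lemma weak_type_dyadic_max:
  fixes u :: "'c::euclidean_space \<Rightarrow> ennreal"
  assumes [measurable]: "u \<in> borel_measurable borel" and l: "0 < l"
  shows "emeasure lborel {x. ennreal l < dyadic_max u x}
     \<le> ennreal (unit_ball_vol DIM('c) * 5 ^ DIM('c) / l) * (\<integral>\<^sup>+y. u y \<partial>lborel)"
proof (cases "(\<integral>\<^sup>+y. u y \<partial>lborel) = \<infinity>")
  case True
  then show ?thesis
    using l less_imp_neq[OF unit_ball_vol_pos[of "real DIM('c)"]] by (simp add: ennreal_mult_top)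
next
  case False
  then obtain U where U: "(\<integral>\<^sup>+y. u y \<partial>lborel) = ennreal U" "0 \<le> U"
    by (cases "\<integral>\<^sup>+y. u y \<partial>lborel") auto
  let ?N = "DIM('c)" and ?S = "{x. ennreal l < dyadic_max u x}"
  have "\<exists>k::int. ennreal l < ennreal ((1 / 2 powi k) ^ ?N) * (\<integral>\<^sup>+y. u y * indicator (ball x (2 powi k)) y \<partial>lborel)"
    if "x \<in> ?S" for x
    using that unfolding dyadic_max_def less_SUP_iff by auto
  then obtain k :: "'c \<Rightarrow> int" where k: "\<And>x. x \<in> ?S \<Longrightarrow> ennreal l <
      ennreal ((1 / 2 powi k x) ^ ?N) * (\<integral>\<^sup>+y. u y * indicator (ball x (2 powi k x)) y \<partial>lborel)"
    by metis
  define r where "r x = (2::real) powi k x" for x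
  have r0: "r x > 0" for x
    by (simp add: r_def)
  have vol: "ennreal (r x ^ ?N) \<le> ennreal (1 / l) * (\<integral>\<^sup>+y. u y * indicator (ball x (r x)) y \<partial>lborel)"
    if "x \<in> ?S" for x
  proof -
    have "ennreal (r x ^ ?N) = ennreal (r x ^ ?N / l) * ennreal l"
      using l r0[of x] by (simp flip: ennreal_mult)
    also have "\<dots> \<le> ennreal (r x ^ ?N / l) * (ennreal ((1 / r x) ^ ?N) * (\<integral>\<^sup>+y. u y * indicator (ball x (r x)) y \<partial>lborel))"
      using k[OF that] by (intro mult_left_mono) (auto simp: r_def)
    also have "\<dots> = ennreal (1 / l) * (\<integral>\<^sup>+y. u y * indicator (ball x (r x)) y \<partial>lborel)"
      using l r0[of x] by (simp add: mult.assoc[symmetric] power_divide flip: ennreal_mult)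
    finally show ?thesis .
  qed
  \<comment> \<open>The covering lemma needs bounded radii. Finite total mass gives r^N \<le> U/l,
    and r \<le> r^N holds once r \<ge> 1, hence the maximum with 1.\<close>
  have bdd: "r x \<le> max 1 (U / l)" if "x \<in> ?S" for x
  proof -
    have "ennreal (r x ^ ?N) \<le> ennreal (1 / l) * (\<integral>\<^sup>+y. u y \<partial>lborel)"
      using vol[OF that] by (rule order_trans) (intro mult_left_mono nn_integral_mono, auto simp: indicator_def)
    then have "r x ^ ?N \<le> U / l"
      using U l by (simp flip: ennreal_mult)
    moreover have "r x \<le> r x ^ ?N" if "r x \<ge> 1"
      using that by (simp add: self_le_power)
    ultimately show ?thesis
      by linarith
  qed
  have cover: "?S \<subseteq> (\<Union>x\<in>?S. ball x (r x))"
    using r0 by auto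
  have rb: "0 < r x \<and> r x \<le> max 1 (U / l)" if "x \<in> ?S" for x
    using r0 bdd[OF that] by auto
  obtain C where C: "countable C" "C \<subseteq> ?S"
     "pairwise (\<lambda>i j. disjnt (ball i (r i)) (ball j (r j))) C"
     "?S \<subseteq> (\<Union>x\<in>C. ball x (5 * r x))"
    by (rule Vitali_covering_lemma_balls[OF cover rb]) (assumption, rule that)
  define A where "A c n = (if n \<in> to_nat_on C ` C then ball (from_nat_into C n) (c * r (from_nat_into C n)) else {})"
    for c n
  have [measurable]: "A c n \<in> sets borel" for c n
    by (auto simp: A_def)
  have disj: "disjoint_family (A 1)"
    unfolding disjoint_family_on_def
  proof safe
    fix m n x assume mn: "m \<noteq> n" "x \<in> A 1 m" "x \<in> A 1 n"
    then obtain a b where ab: "a \<in> C" "b \<in> C" "m = to_nat_on C a" "n = to_nat_on C b"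
      by (auto simp: A_def split: if_splits)
    then have "a \<noteq> b" using mn by auto
    then have "disjnt (ball a (r a)) (ball b (r b))"
      using C(3) ab by (auto simp: pairwise_def)
    then show "x \<in> {}"
      using mn ab C(1) by (auto simp: A_def disjnt_def)
  qed
  have sub: "?S \<subseteq> (\<Union>n. A 5 n)"
  proof
    fix x assume "x \<in> ?S"
    then obtain a where "a \<in> C" "x \<in> ball a (5 * r a)"
      using C(4) by blast
    then have "x \<in> A 5 (to_nat_on C a)"
      using C(1) by (simp add: A_def)
    then show "x \<in> (\<Union>n. A 5 n)" by blast
  qed
  let ?W = "unit_ball_vol (real ?N) * 5 ^ ?N"
  have each: "emeasure lborel (A 5 n) \<le> ennreal (?W / l) * (\<integral>\<^sup>+y. u y * indicator (A 1 n) y \<partial>lborel)" for n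
  proof (cases "n \<in> to_nat_on C ` C")
    case True
    define a where "a = from_nat_into C n"
    have "a \<in> C" using True C(1) by (auto simp: a_def)
    then have "a \<in> ?S" using C(2) by blast
    have "emeasure lborel (A 5 n) = ennreal ?W * ennreal (r a ^ ?N)"
      using True r0[of a] by (simp add: A_def a_def[symmetric] emeasure_ball power_mult_distrib mult_ac flip: ennreal_mult)
    also have "\<dots> \<le> ennreal ?W * (ennreal (1 / l) * (\<integral>\<^sup>+y. u y * indicator (ball a (r a)) y \<partial>lborel))"
      by (intro mult_left_mono vol \<open>a \<in> ?S\<close>) simp
    also have "\<dots> = ennreal (?W / l) * (\<integral>\<^sup>+y. u y * indicator (A 1 n) y \<partial>lborel)"
      using True l by (simp add: A_def a_def[symmetric] mult.assoc[symmetric] flip: ennreal_mult)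
    finally show ?thesis .
  qed (simp add: A_def)
  have "emeasure lborel ?S \<le> emeasure lborel (\<Union>n. A 5 n)"
    by (intro emeasure_mono sub) auto
  also have "\<dots> \<le> (\<Sum>n. emeasure lborel (A 5 n))"
    by (intro emeasure_subadditive_countably) auto
  also have "\<dots> \<le> (\<Sum>n. ennreal (?W / l) * (\<integral>\<^sup>+y. u y * indicator (A 1 n) y \<partial>lborel))"
    by (intro suminf_le each) auto
  also have "\<dots> = ennreal (?W / l) * (\<integral>\<^sup>+y. (\<Sum>n. u y * indicator (A 1 n) y) \<partial>lborel)"
    by (subst nn_integral_suminf) (auto simp: ennreal_suminf_cmult)
  also have "\<dots> = ennreal (?W / l) * (\<integral>\<^sup>+y. u y * indicator (\<Union>n. A 1 n) y \<partial>lborel)"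
    by (intro arg_cong2[where f=times] nn_integral_cong refl)
      (simp only: ennreal_suminf_cmult suminf_indicator[OF disj])
  also have "\<dots> \<le> ennreal (?W / l) * (\<integral>\<^sup>+y. u y \<partial>lborel)"
    by (intro mult_left_mono nn_integral_mono) (auto simp: indicator_def)
  finally show ?thesis .
qed

text \<open>A maximal function may be infinite. The case distinction keeps infinity at infinity,
  whereas \<open>enn2real\<close> alone would send it to 0.\<close>

definition epowr :: "ennreal \<Rightarrow> real \<Rightarrow> ennreal" where
  "epowr a r = (if a = \<infinity> then \<infinity> else ennreal (enn2real a powr r))"

lemma measurable_epowr [measurable]:
  assumes [measurable]: "f \<in> borel_measurable M"
  shows "(\<lambda>x. epowr (f x) r) \<in> borel_measurable M"
  unfolding epowr_def by measurable

lemma nn_integral_powr_layer: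
  fixes e a :: real
  assumes "e > 0" "a \<ge> 0"
  shows "(\<integral>\<^sup>+t. ennreal (e * t powr (e - 1)) * indicator {0<..<a} t \<partial>lborel) = ennreal (a powr e)"
proof -
  have "((\<lambda>t. t powr (e - 1)) has_integral (a powr (e - 1 + 1) / (e - 1 + 1))) {0..a}"
    using assms by (intro has_integral_powr_from_0) auto
  then have "((\<lambda>t. e * t powr (e - 1)) has_integral a powr e) {0..a}"
    using has_integral_mult_right[of "\<lambda>t. t powr (e - 1)" "a powr e / e" _ e] assms by simp
  from nn_integral_has_integral_lebesgue'[OF _ this] assms
  have "(\<integral>\<^sup>+t. ennreal (e * t powr (e - 1)) * indicator {0..a} t \<partial>lborel) = ennreal (a powr e)"
    by simp
  moreover have "AE t in lborel. ennreal (e * t powr (e - 1)) * indicator {0<..<a} t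
     = ennreal (e * t powr (e - 1)) * indicator {0..a} t"
    using AE_lborel_singleton[of 0] AE_lborel_singleton[of a]
    by eventually_elim (auto simp: indicator_def)
  ultimately show ?thesis
    by (simp add: nn_integral_cong_AE)
qed

lemma epowr_le_layer:
  assumes "e > 0"
  shows "epowr a e \<le> (\<integral>\<^sup>+t. ennreal (e * t powr (e - 1)) * (indicator {0<..} t * indicator {t. ennreal t < a} t) \<partial>lborel)"
    (is "_ \<le> ?I")
proof (cases "a = \<infinity>")
  case True
  \<comment> \<open>The layers below height n^(1/e) alone contribute n, so the integral is at least
    every natural number.\<close>
  have le: "ennreal (real n) \<le> ?I" for n
  proof -
    have "ennreal (real n) = ennreal ((real n powr (1 / e)) powr e)"
      using assms by (simp add: powr_powr)
    also have "\<dots> = (\<integral>\<^sup>+t. ennreal (e * t powr (e - 1)) * indicator {0<..<real n powr (1 / e)} t \<partial>lborel)"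
      using assms by (simp add: nn_integral_powr_layer)
    also have "\<dots> \<le> ?I"
      using True by (intro nn_integral_mono mult_left_mono) (auto simp: indicator_def)
    finally show ?thesis .
  qed
  have "?I = \<infinity>"
  proof (rule ccontr)
    assume "?I \<noteq> \<infinity>"
    then obtain n where "?I < of_nat n"
      using ennreal_Ex_less_of_nat[of ?I] by (auto simp: less_top)
    then show False
      using le[of n] by (simp add: ennreal_of_nat_eq_real_of_nat)
  qed
  then show ?thesis by simp
next
  case False
  then obtain b where b: "a = ennreal b" "b \<ge> 0"
    by (cases a) auto
  then have "epowr a e = (\<integral>\<^sup>+t. ennreal (e * t powr (e - 1)) * indicator {0<..<b} t \<partial>lborel)"
    using assms by (simp add: nn_integral_powr_layer epowr_def)
  also have "\<dots> \<le> ?I"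
    using b by (intro nn_integral_mono mult_left_mono) (auto simp: indicator_def ennreal_less_iff)
  finally show ?thesis .
qed

lemma nn_integral_epowr_le:
  fixes f :: "'c::euclidean_space \<Rightarrow> ennreal"
  assumes [measurable]: "f \<in> borel_measurable borel" and e: "e > 0"
  shows "(\<integral>\<^sup>+x. epowr (f x) e \<partial>lborel)
    \<le> (\<integral>\<^sup>+t. ennreal (e * t powr (e - 1)) * indicator {0<..} t * emeasure lborel {x. ennreal t < f x} \<partial>lborel)"
proof -
  have "(\<integral>\<^sup>+x. epowr (f x) e \<partial>lborel)
     \<le> (\<integral>\<^sup>+x. \<integral>\<^sup>+t. ennreal (e * t powr (e - 1)) * (indicator {0<..} t * indicator {t. ennreal t < f x} t) \<partial>lborel \<partial>lborel)"
    using e by (intro nn_integral_mono epowr_le_layer) auto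
  also have "\<dots> = (\<integral>\<^sup>+t. \<integral>\<^sup>+x. ennreal (e * t powr (e - 1)) * (indicator {0<..} t * indicator {t. ennreal t < f x} t) \<partial>lborel \<partial>lborel)"
    unfolding indicator_def mem_Collect_eq greaterThan_iff of_bool_def
    by (rule lborel_pair.Fubini'[where f="\<lambda>t x. ennreal (e * t powr (e - 1)) * ((if 0 < t then 1 else 0) * (if ennreal t < f x then 1 else 0))"]) measurable
  also have "\<dots> = (\<integral>\<^sup>+t. ennreal (e * t powr (e - 1)) * indicator {0<..} t * emeasure lborel {x. ennreal t < f x} \<partial>lborel)"
  proof (intro nn_integral_cong)
    fix t
    have "(\<integral>\<^sup>+x. ennreal (e * t powr (e - 1)) * (indicator {0<..} t * indicator {t. ennreal t < f x} t) \<partial>lborel)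
      = (\<integral>\<^sup>+x. ennreal (e * t powr (e - 1)) * indicator {0<..} t * indicator {x. ennreal t < f x} x \<partial>lborel)"
      by (intro nn_integral_cong) (auto simp: indicator_def)
    then show "(\<integral>\<^sup>+x. ennreal (e * t powr (e - 1)) * (indicator {0<..} t * indicator {t. ennreal t < f x} t) \<partial>lborel)
      = ennreal (e * t powr (e - 1)) * indicator {0<..} t * emeasure lborel {x. ennreal t < f x}"
      by (simp add: nn_integral_cmult)
  qed
  finally show ?thesis .
qed

text \<open>With the normalisation by r^N, a constant \<open>c\<close> has the average
  \<open>unit_ball_vol DIM('c) * c\<close> over every ball, independently of the radius.\<close>

lemma dyadic_max_add_const_le:
  fixes u v :: "'c::euclidean_space \<Rightarrow> ennreal"
  assumes [measurable]: "u \<in> borel_measurable borel" and c: "c \<ge> 0"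
    and le: "\<And>y. v y \<le> u y + ennreal c"
  shows "dyadic_max v x \<le> dyadic_max u x + ennreal (unit_ball_vol DIM('c) * c)"
  unfolding dyadic_max_def[of v]
proof (rule SUP_least)
  fix k :: int
  let ?r = "(2::real) powi k"
  have "(\<integral>\<^sup>+y. v y * indicator (ball x ?r) y \<partial>lborel)
      \<le> (\<integral>\<^sup>+y. u y * indicator (ball x ?r) y + ennreal c * indicator (ball x ?r) y \<partial>lborel)"
    using le by (intro nn_integral_mono) (auto simp: indicator_def)
  also have "\<dots> = (\<integral>\<^sup>+y. u y * indicator (ball x ?r) y \<partial>lborel) + ennreal c * ennreal (unit_ball_vol DIM('c) * ?r ^ DIM('c))"
    by (subst nn_integral_add) (auto simp: nn_integral_cmult_indicator emeasure_ball intro!: borel_measurable_times_ennreal borel_measurable_indicator)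
  finally have "ennreal ((1 / ?r) ^ DIM('c)) * (\<integral>\<^sup>+y. v y * indicator (ball x ?r) y \<partial>lborel)
     \<le> ennreal ((1 / ?r) ^ DIM('c)) * (\<integral>\<^sup>+y. u y * indicator (ball x ?r) y \<partial>lborel)
       + ennreal ((1 / ?r) ^ DIM('c)) * (ennreal c * ennreal (unit_ball_vol DIM('c) * ?r ^ DIM('c)))"
    by (subst distrib_left[symmetric]) (rule mult_left_mono, auto)
  also have "\<dots> \<le> dyadic_max u x + ennreal (unit_ball_vol DIM('c) * c)"
  proof (rule add_mono)
    show "ennreal ((1 / ?r) ^ DIM('c)) * (\<integral>\<^sup>+y. u y * indicator (ball x ?r) y \<partial>lborel) \<le> dyadic_max u x"
      unfolding dyadic_max_def by (rule SUP_upper) simp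
    show "ennreal ((1 / ?r) ^ DIM('c)) * (ennreal c * ennreal (unit_ball_vol DIM('c) * ?r ^ DIM('c)))
        \<le> ennreal (unit_ball_vol DIM('c) * c)"
      using c by (simp add: power_divide flip: ennreal_mult)
  qed
  finally show "ennreal ((1 / ?r) ^ DIM('c)) * (\<integral>\<^sup>+y. v y * indicator (ball x ?r) y \<partial>lborel)
     \<le> dyadic_max u x + ennreal (unit_ball_vol DIM('c) * c)" .
qed

text \<open>Marcinkiewicz interpolation between the weak type (1,1) bound and boundedness: at each
  level t only the large part of \<open>u\<close> enters the weak type bound, and the level bounds
  are summed by the layer-cake formula.\<close>

lemma strong_type_dyadic_max:
  assumes r: "1 < r"
  obtains C where "0 < C" "\<And>u::'c::euclidean_space \<Rightarrow> real. u \<in> borel_measurable borel \<Longrightarrow> (\<And>y. 0 \<le> u y) \<Longrightarrow>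
    (\<integral>\<^sup>+x. epowr (dyadic_max (\<lambda>y. ennreal (u y)) x) r \<partial>lborel) \<le> ennreal C * (\<integral>\<^sup>+y. ennreal (u y powr r) \<partial>lborel)"
proof -
  define v where "v = unit_ball_vol DIM('c)"
  define W where "W = v * 5 ^ DIM('c)"
  have pos: "v > 0" "W > 0"
    by (auto simp: v_def W_def)
  \<comment> \<open>The value of the integral of r t^(r-1) (2 W / t) u over 0 < t < 2 v u, divided
    by u^r.\<close>
  define C where "C = 2 * W * r / (r - 1) * (2 * v) powr (r - 1)"
  have "0 < C"
    using pos r by (simp add: C_def)
  moreover have "(\<integral>\<^sup>+x. epowr (dyadic_max (\<lambda>y. ennreal (u y)) x) r \<partial>lborel) \<le> ennreal C * (\<integral>\<^sup>+y. ennreal (u y powr r) \<partial>lborel)"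
    if [measurable]: "u \<in> borel_measurable borel" and u0: "\<And>y. 0 \<le> u y" for u :: "'c \<Rightarrow> real"
  proof -
    let ?M = "dyadic_max (\<lambda>y. ennreal (u y))"
    have [measurable]: "?M \<in> borel_measurable borel"
      by simp
    have level: "emeasure lborel {x. ennreal t < ?M x}
        \<le> (\<integral>\<^sup>+y. ennreal (2 * W / t * u y) * indicator {0<..<2 * v * u y} t \<partial>lborel)" if t: "t > 0" for t
    proof -
      \<comment> \<open>The part of \<open>u\<close> above t / (2 v). What is cut off is at most t /
        (2 v) and raises the maximal function by at most t / 2. The truncation is written as an
        indicator in \<open>t\<close>, ready for the exchange of integrals.\<close>
      let ?w = "\<lambda>y. ennreal (u y) * indicator {0<..<2 * v * u y} t"
      have [measurable]: "?w \<in> borel_measurable borel"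
        unfolding indicator_def greaterThanLessThan_iff by measurable
      have "?M x \<le> dyadic_max ?w x + ennreal (v * (t / (2 * v)))" for x
        unfolding v_def[symmetric]
        by (subst (2) v_def, rule dyadic_max_add_const_le)
          (use t pos u0 in \<open>auto simp: indicator_def field_simps not_less v_def[symmetric] intro!: ennreal_leI\<close>)
      then have M_le: "?M x \<le> dyadic_max ?w x + ennreal (t / 2)" for x
        using pos by simp
      have "{x. ennreal t < ?M x} \<subseteq> {x. ennreal (t / 2) < dyadic_max ?w x}"
      proof (rule subsetI, rule CollectI, rule ccontr, drule CollectD)
        fix x assume "ennreal t < ?M x" "\<not> ennreal (t / 2) < dyadic_max ?w x"
        then have "dyadic_max ?w x + ennreal (t / 2) \<le> ennreal (t / 2) + ennreal (t / 2)"
          by (intro add_mono) auto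
        also have "\<dots> = ennreal t"
          using t by (simp flip: ennreal_plus)
        finally show False
          using \<open>ennreal t < ?M x\<close> M_le[of x] by order
      qed
      then have "emeasure lborel {x. ennreal t < ?M x} \<le> emeasure lborel {x. ennreal (t / 2) < dyadic_max ?w x}"
        by (intro emeasure_mono) auto
      also have "\<dots> \<le> ennreal (W / (t / 2)) * (\<integral>\<^sup>+y. ?w y \<partial>lborel)"
        unfolding W_def v_def by (rule weak_type_dyadic_max) (use t in \<open>auto simp: v_def[symmetric]\<close>)
      also have "\<dots> = (\<integral>\<^sup>+y. ennreal (W / (t / 2)) * ?w y \<partial>lborel)"
        by (rule nn_integral_cmult[symmetric]) simp
      also have "\<dots> = (\<integral>\<^sup>+y. ennreal (2 * W / t * u y) * indicator {0<..<2 * v * u y} t \<partial>lborel)"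
      proof (intro nn_integral_cong)
        fix y
        have "ennreal (W / (t / 2)) * ennreal (u y) = ennreal (2 * W / t * u y)"
          using t pos u0[of y] by (simp add: mult.commute flip: ennreal_mult)
        then show "ennreal (W / (t / 2)) * ?w y = ennreal (2 * W / t * u y) * indicator {0<..<2 * v * u y} t"
          by (simp only: mult.assoc[symmetric])
      qed
      finally show ?thesis .
    qed
    have "(\<integral>\<^sup>+x. epowr (?M x) r \<partial>lborel)
       \<le> (\<integral>\<^sup>+t. ennreal (r * t powr (r - 1)) * indicator {0<..} t * emeasure lborel {x. ennreal t < ?M x} \<partial>lborel)"
      using r by (intro nn_integral_epowr_le) auto
    also have "\<dots> \<le> (\<integral>\<^sup>+t. \<integral>\<^sup>+y. ennreal (2 * W * r / (r - 1) * u y) *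
        (ennreal ((r - 1) * t powr (r - 1 - 1)) * indicator {0<..<2 * v * u y} t) \<partial>lborel \<partial>lborel)"
    proof (intro nn_integral_mono)
      fix t :: real
      show "ennreal (r * t powr (r - 1)) * indicator {0<..} t * emeasure lborel {x. ennreal t < ?M x}
        \<le> (\<integral>\<^sup>+y. ennreal (2 * W * r / (r - 1) * u y) *
        (ennreal ((r - 1) * t powr (r - 1 - 1)) * indicator {0<..<2 * v * u y} t) \<partial>lborel)"
      proof (cases "t > 0")
        case True
        have m: "(\<lambda>y. ennreal (2 * W / t * u y) * indicator {0<..<2 * v * u y} t) \<in> borel_measurable lborel"
          unfolding indicator_def greaterThanLessThan_iff by measurable
        have "ennreal (r * t powr (r - 1)) * indicator {0<..} t * emeasure lborel {x. ennreal t < ?M x}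
          \<le> ennreal (r * t powr (r - 1)) * (\<integral>\<^sup>+y. ennreal (2 * W / t * u y) * indicator {0<..<2 * v * u y} t \<partial>lborel)"
          using mult_left_mono[OF level[OF True], of "ennreal (r * t powr (r - 1))"] True by simp
        also have "\<dots> = (\<integral>\<^sup>+y. ennreal (r * t powr (r - 1)) * (ennreal (2 * W / t * u y) * indicator {0<..<2 * v * u y} t) \<partial>lborel)"
          by (rule nn_integral_cmult[OF m, symmetric])
        also have "\<dots> = (\<integral>\<^sup>+y. ennreal (2 * W * r / (r - 1) * u y) *
            (ennreal ((r - 1) * t powr (r - 1 - 1)) * indicator {0<..<2 * v * u y} t) \<partial>lborel)"
        proof (intro nn_integral_cong)
          fix y
          have "r * t powr (r - 1) * (2 * W / t * u y) = 2 * W * r / (r - 1) * u y * ((r - 1) * t powr (r - 1 - 1))"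
          proof -
            have "t powr (r - 1 - 1) = t powr (r - 1) / t"
              using True powr_diff[of t "r - 1" 1] by simp
            then show ?thesis
              using r by simp
          qed
          then have "ennreal (r * t powr (r - 1)) * ennreal (2 * W / t * u y)
             = ennreal (2 * W * r / (r - 1) * u y) * ennreal ((r - 1) * t powr (r - 1 - 1))"
            using True r pos u0[of y] by (subst (1 2) ennreal_mult[symmetric]) auto
          then show "ennreal (r * t powr (r - 1)) * (ennreal (2 * W / t * u y) * indicator {0<..<2 * v * u y} t)
             = ennreal (2 * W * r / (r - 1) * u y) * (ennreal ((r - 1) * t powr (r - 1 - 1)) * indicator {0<..<2 * v * u y} t)"
            by (simp only: mult.assoc[symmetric])
        qed
        finally show ?thesis .
      qed simp
    qed
    also have "\<dots> = (\<integral>\<^sup>+y. \<integral>\<^sup>+t. ennreal (2 * W * r / (r - 1) * u y) *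
        (ennreal ((r - 1) * t powr (r - 1 - 1)) * indicator {0<..<2 * v * u y} t) \<partial>lborel \<partial>lborel)"
      unfolding indicator_def greaterThanLessThan_iff of_bool_def
      by (rule lborel_pair.Fubini'[where f="\<lambda>y t. ennreal (2 * W * r / (r - 1) * u y) *
        (ennreal ((r - 1) * t powr (r - 1 - 1)) * (if 0 < t \<and> t < 2 * v * u y then 1 else 0))"]) measurable
    also have "\<dots> = (\<integral>\<^sup>+y. ennreal C * ennreal (u y powr r) \<partial>lborel)"
    proof (intro nn_integral_cong)
      fix y
      have "(\<integral>\<^sup>+t. ennreal (2 * W * r / (r - 1) * u y) *
        (ennreal ((r - 1) * t powr (r - 1 - 1)) * indicator {0<..<2 * v * u y} t) \<partial>lborel)
        = ennreal (2 * W * r / (r - 1) * u y) * ennreal ((2 * v * u y) powr (r - 1))"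
        using nn_integral_powr_layer[of "r - 1" "2 * v * u y"] r pos u0[of y]
        by (subst nn_integral_cmult) auto
      also have "\<dots> = ennreal (2 * W * r / (r - 1) * u y * (2 * v * u y) powr (r - 1))"
        using r pos u0[of y] by (intro ennreal_mult[symmetric]) auto
      also have "2 * W * r / (r - 1) * u y * (2 * v * u y) powr (r - 1)
          = 2 * W * r / (r - 1) * (2 * v) powr (r - 1) * (u y * u y powr (r - 1))"
        using pos u0[of y] by (simp add: powr_mult)
      also have "\<dots> = C * u y powr r"
        using powr_mult_base[of "u y" "r - 1"] u0[of y] by (simp add: C_def)
      also have "ennreal (C * u y powr r) = ennreal C * ennreal (u y powr r)"
        using \<open>0 < C\<close> by (intro ennreal_mult) auto
      finally show "(\<integral>\<^sup>+t. ennreal (2 * W * r / (r - 1) * u y) *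
        (ennreal ((r - 1) * t powr (r - 1 - 1)) * indicator {0<..<2 * v * u y} t) \<partial>lborel)
        = ennreal C * ennreal (u y powr r)" .
    qed
    also have "\<dots> = ennreal C * (\<integral>\<^sup>+y. ennreal (u y powr r) \<partial>lborel)"
      by (rule nn_integral_cmult) simp
    finally show ?thesis .
  qed
  ultimately show ?thesis
    by (rule that)
qed

text \<open>Comparable to the Poisson kernel at height \<open>t\<close>. The power is one above the
  dimension, which leaves a factor 2^(-j) on the j-th dyadic ball.\<close>

definition decay_kernel :: "real \<Rightarrow> 'c::euclidean_space \<Rightarrow> real" where
  "decay_kernel t w = (1 / t) ^ DIM('c) * (1 / (1 + norm w / t)) ^ (DIM('c) + 1)"

text \<open>The kernel is dominated by a sum over dyadic balls of heights c_j, and c_j times r^N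
  decays like 2^(-j). The constant is 2^N (rounding t up to a power of 2), times 2^(N+1) (kernel
  size on a shell), times 2 (geometric series).\<close>

lemma decay_kernel_le_dyadic_max:
  fixes u :: "'c::euclidean_space \<Rightarrow> ennreal"
  assumes [measurable]: "u \<in> borel_measurable borel" and t: "0 < t"
  shows "(\<integral>\<^sup>+y. ennreal (decay_kernel t (x - y)) * u y \<partial>lborel) \<le> ennreal (4 ^ (DIM('c) + 1)) * dyadic_max u x"
proof -
  let ?N = "DIM('c)"
  define k where "k = \<lceil>log 2 t\<rceil>"
  have k: "t \<le> 2 powi k" "2 powi k \<le> 2 * t"
  proof -
    have "log 2 t \<le> real_of_int k" "real_of_int k \<le> log 2 t + 1"
      unfolding k_def by linarith+
    then have "2 powr (log 2 t) \<le> 2 powr k" "2 powr k \<le> 2 powr (log 2 t + 1)"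
      by simp_all
    then show "t \<le> 2 powi k" "2 powi k \<le> 2 * t"
      using t by (simp_all add: powr_add powr_real_of_int')
  qed
  define c where "c j = (1 / t) ^ ?N * (2 * (1 / 2) ^ j) ^ (?N + 1)" for j
  have c0: "c j \<ge> 0" for j using t by (simp add: c_def)
  define g where "g j y = ennreal (c j) * (u y * indicator (ball x (2 powi (k + int j))) y)" for j y
  have pw: "ennreal (decay_kernel t (x - y)) * u y \<le> (\<Sum>j. g j y)" for y
  proof -
    have ex: "\<exists>j. norm (x - y) < 2 powi (k + int j)"
    proof -
      obtain n where "norm (x - y) / 2 powi k < 2 ^ n"
        using real_arch_pow[of 2 "norm (x - y) / 2 powi k"] by auto
      then have "norm (x - y) < 2 powi (k + int n)"
        by (simp add: power_int_add field_simps)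
      then show ?thesis by blast
    qed
    \<comment> \<open>The innermost ball containing y. For j > 0 minimality gives |x - y| \<ge> t
      2^(j-1); this shift by one, together with the case j = 0, is why c_j contains 2 *
      (1/2)^j.\<close>
    define j where "j = (LEAST j. norm (x - y) < 2 powi (k + int j))"
    have j: "norm (x - y) < 2 powi (k + int j)"
      unfolding j_def using ex by (rule LeastI_ex)
    have "1 / (1 + norm (x - y) / t) \<le> 2 * (1 / 2) ^ j"
    proof (cases j)
      case 0
      have "1 \<le> 1 + norm (x - y) / t" using t by simp
      then have "1 / (1 + norm (x - y) / t) \<le> 1" by simp
      then show ?thesis using 0 by simp
    next
      case (Suc i)
      then have "\<not> norm (x - y) < 2 powi (k + int i)"
        using not_less_Least[of i "\<lambda>j. norm (x - y) < 2 powi (k + int j)"] by (simp add: j_def)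
      then have "2 powi k * 2 ^ i \<le> norm (x - y)"
        by (simp add: power_int_add)
      then have "t * 2 ^ i \<le> norm (x - y)"
        by - (rule order_trans[OF mult_right_mono[OF k(1)]], auto)
      then have "2 ^ i \<le> norm (x - y) / t"
        using t by (simp add: field_simps)
      then have "2 ^ i \<le> 1 + norm (x - y) / t"
        by simp
      from le_imp_inverse_le[OF this] show ?thesis
        using Suc by (simp add: field_simps)
    qed
    then have "(1 / (1 + norm (x - y) / t)) ^ (?N + 1) \<le> (2 * (1 / 2) ^ j) ^ (?N + 1)"
      using t by (intro power_mono) auto
    then have "decay_kernel t (x - y) \<le> c j"
      unfolding decay_kernel_def c_def using t by (intro mult_left_mono) auto
    then have "ennreal (decay_kernel t (x - y)) * u y \<le> g j y"
      using j unfolding g_def by (auto simp: dist_norm intro!: mult_right_mono ennreal_leI)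
    also have "\<dots> \<le> (\<Sum>j. g j y)"
      using sum_le_suminf[of "\<lambda>j. g j y" "{j}"] by auto
    finally show ?thesis .
  qed
  have gM: "(\<integral>\<^sup>+y. g j y \<partial>lborel) \<le> ennreal (2 ^ ?N * 2 ^ (?N + 1) * (1 / 2) ^ j) * dyadic_max u x" for j
  proof -
    let ?r = "2 powi (k + int j)"
    have r: "?r = (2::real) powi k * 2 ^ j"
      by (simp add: power_int_add)
    have "(\<integral>\<^sup>+y. g j y \<partial>lborel) = ennreal (c j * ?r ^ ?N) * (ennreal ((1 / ?r) ^ ?N) * (\<integral>\<^sup>+y. u y * indicator (ball x ?r) y \<partial>lborel))"
      unfolding g_def using c0[of j]
      by (subst nn_integral_cmult)
        (auto simp: mult.assoc[symmetric] power_divide simp flip: ennreal_mult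
          intro!: borel_measurable_times_ennreal borel_measurable_indicator)
    also have "\<dots> \<le> ennreal (c j * ?r ^ ?N) * dyadic_max u x"
      unfolding dyadic_max_def by (intro mult_left_mono SUP_upper) auto
    also have "ennreal (c j * ?r ^ ?N) * dyadic_max u x \<le> ennreal (2 ^ ?N * 2 ^ (?N + 1) * (1 / 2) ^ j) * dyadic_max u x"
    proof (intro mult_right_mono ennreal_leI)
      have "c j * ?r ^ ?N = (2 powi k / t) ^ ?N * 2 ^ (?N + 1) * (1 / 2) ^ j"
        by (simp add: c_def r power_mult_distrib power_divide power_add field_simps flip: power_mult)
      also have "\<dots> \<le> 2 ^ ?N * 2 ^ (?N + 1) * (1 / 2) ^ j"
        using k t by (intro mult_right_mono power_mono) (auto simp: field_simps)
      finally show "c j * ?r ^ ?N \<le> 2 ^ ?N * 2 ^ (?N + 1) * (1 / 2) ^ j" .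
    qed simp
    finally show ?thesis .
  qed
  have "(\<integral>\<^sup>+y. ennreal (decay_kernel t (x - y)) * u y \<partial>lborel) \<le> (\<integral>\<^sup>+y. (\<Sum>j. g j y) \<partial>lborel)"
    by (intro nn_integral_mono pw)
  also have "\<dots> = (\<Sum>j. \<integral>\<^sup>+y. g j y \<partial>lborel)"
    unfolding g_def
    by (rule nn_integral_suminf) (auto intro!: borel_measurable_times_ennreal borel_measurable_indicator)
  also have "\<dots> \<le> (\<Sum>j. ennreal (2 ^ ?N * 2 ^ (?N + 1) * (1 / 2) ^ j) * dyadic_max u x)"
    by (intro suminf_le gM) auto
  also have "\<dots> = (\<Sum>j. ennreal (2 ^ ?N * 2 ^ (?N + 1) * (1 / 2) ^ j)) * dyadic_max u x"
    by (rule ennreal_suminf_multc)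
  also have "(\<Sum>j. ennreal (2 ^ ?N * 2 ^ (?N + 1) * (1 / 2) ^ j)) = ennreal (2 ^ ?N * 2 ^ (?N + 1) * 2)"
    using sums_mult[OF geometric_sums[of "1/2::real"], of "2 ^ ?N * 2 ^ (?N + 1)"]
    by (intro suminf_ennreal_eq) auto
  also have "(2::real) ^ ?N * 2 ^ (?N + 1) * 2 = 4 ^ (?N + 1)"
    by (simp flip: power_mult_distrib)
  finally show ?thesis .
qed

section \<open>Bilinear forms with difference kernels\<close>

lemma nn_integral_lborel_affine:
  fixes f :: "'c::euclidean_space \<Rightarrow> ennreal"
  assumes [measurable]: "f \<in> borel_measurable borel" and c: "c \<noteq> 0"
  shows "(\<integral>\<^sup>+x. f x \<partial>lborel) = ennreal (\<bar>c\<bar> ^ DIM('c)) * (\<integral>\<^sup>+x. f (t + c *\<^sub>R x) \<partial>lborel)"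
  by (subst lborel_affine[OF c, of t])
    (simp add: nn_integral_density nn_integral_distr nn_integral_cmult)

lemma nn_integral_lborel_reflect:
  fixes f :: "'c::euclidean_space \<Rightarrow> ennreal"
  assumes [measurable]: "f \<in> borel_measurable borel"
  shows "(\<integral>\<^sup>+z. f (y - z) \<partial>lborel) = (\<integral>\<^sup>+z. f z \<partial>lborel)"
  using nn_integral_lborel_affine[of f "-1" y] by simp

lemma nn_integral_lborel_translate:
  fixes f :: "'c::euclidean_space \<Rightarrow> ennreal"
  assumes [measurable]: "f \<in> borel_measurable borel"
  shows "(\<integral>\<^sup>+y. f (y - z) \<partial>lborel) = (\<integral>\<^sup>+y. f y \<partial>lborel)"
  using nn_integral_lborel_affine[of f 1 "- z"] by (simp add: add.commute)

lemma nn_integral_diff_kernel_fst: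
  fixes a k :: "'c::euclidean_space \<Rightarrow> ennreal"
  assumes [measurable]: "a \<in> borel_measurable borel" "k \<in> borel_measurable borel"
  shows "(\<integral>\<^sup>+w. a (fst w) * k (fst w - snd w) \<partial>(lborel \<Otimes>\<^sub>M lborel)) = (\<integral>\<^sup>+y. a y \<partial>lborel) * (\<integral>\<^sup>+w. k w \<partial>lborel)"
proof -
  have "(\<integral>\<^sup>+w. a (fst w) * k (fst w - snd w) \<partial>(lborel \<Otimes>\<^sub>M lborel))
    = (\<integral>\<^sup>+y. \<integral>\<^sup>+z. a y * k (y - z) \<partial>lborel \<partial>lborel)"
    by (subst lborel.nn_integral_fst[symmetric]) auto
  also have "\<dots> = (\<integral>\<^sup>+y. a y * (\<integral>\<^sup>+w. k w \<partial>lborel) \<partial>lborel)"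
    by (simp add: nn_integral_cmult nn_integral_lborel_reflect)
  finally show ?thesis
    by (simp add: nn_integral_multc)
qed

lemma nn_integral_diff_kernel_snd:
  fixes b k :: "'c::euclidean_space \<Rightarrow> ennreal"
  assumes [measurable]: "b \<in> borel_measurable borel" "k \<in> borel_measurable borel"
  shows "(\<integral>\<^sup>+w. b (snd w) * k (fst w - snd w) \<partial>(lborel \<Otimes>\<^sub>M lborel)) = (\<integral>\<^sup>+y. b y \<partial>lborel) * (\<integral>\<^sup>+w. k w \<partial>lborel)"
proof -
  have "(\<integral>\<^sup>+w. b (snd w) * k (fst w - snd w) \<partial>(lborel \<Otimes>\<^sub>M lborel))
    = (\<integral>\<^sup>+z. \<integral>\<^sup>+y. b z * k (y - z) \<partial>lborel \<partial>lborel)"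
    by (subst lborel_pair.nn_integral_snd[symmetric]) (auto simp: split_beta')
  also have "\<dots> = (\<integral>\<^sup>+z. b z * (\<integral>\<^sup>+w. k w \<partial>lborel) \<partial>lborel)"
    by (simp add: nn_integral_cmult nn_integral_lborel_translate)
  finally show ?thesis
    by (simp add: nn_integral_multc)
qed

text \<open>Young's inequality with both constants rounded up to 1: if m is the larger of a^p and
  b^q, then a \<le> m^(1/p) and b \<le> m^(1/q), and the exponents add up to 1.\<close>

lemma mult_le_powr_add_powr:
  fixes a b p q :: real
  assumes p: "1 < p" "1 < q" "1 / p + 1 / q = 1" and ab: "0 \<le> a" "0 \<le> b"
  shows "a * b \<le> a powr p + b powr q"
proof (cases "a = 0 \<or> b = 0")
  case False
  define m where "m = max (a powr p) (b powr q)"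
  have m: "m > 0" using False ab by (auto simp: m_def less_max_iff_disj)
  have "a = (a powr p) powr (1 / p)" "b = (b powr q) powr (1 / q)"
    using ab p by (simp_all add: powr_powr)
  moreover have "(a powr p) powr (1 / p) \<le> m powr (1 / p)" "(b powr q) powr (1 / q) \<le> m powr (1 / q)"
    using p by (auto simp: m_def intro!: powr_mono2)
  ultimately have "a * b \<le> m powr (1 / p) * m powr (1 / q)"
    using ab by (metis mult_mono powr_ge_zero)
  also have "\<dots> = m"
    using p m by (simp flip: powr_add)
  also have "\<dots> \<le> a powr p + b powr q"
    by (simp add: m_def)
  finally show ?thesis .
qed auto

lemma scaled_mult_le_powr_add_powr:
  fixes a b d p q :: real
  assumes p: "1 < p" "1 < q" "1 / p + 1 / q = 1" and ab: "0 \<le> a" "0 \<le> b" and d: "0 < d"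
  shows "a * b \<le> d powr p * a powr p + d powr (- q) * b powr q"
proof -
  have "a * b = (d * a) * (inverse d * b)"
    using d by simp
  also have "\<dots> \<le> (d * a) powr p + (inverse d * b) powr q"
    using assms by (intro mult_le_powr_add_powr) auto
  also have "\<dots> = d powr p * a powr p + d powr (- q) * b powr q"
    using d ab by (simp add: powr_mult powr_minus inverse_powr)
  finally show ?thesis .
qed

lemma powr_add_le:
  fixes a b q :: real
  assumes "0 \<le> a" "0 \<le> b" "0 \<le> q"
  shows "(a + b) powr q \<le> 2 powr q * (a powr q + b powr q)"
proof -
  have "(a + b) powr q \<le> (2 * max a b) powr q"
    using assms by (intro powr_mono2) auto
  also have "\<dots> = 2 powr q * max a b powr q"
    using assms by (simp add: powr_mult)
  also have "max a b powr q \<le> a powr q + b powr q"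
    by (auto simp: max_def)
  finally show ?thesis
    by simp
qed

section \<open>Mass and integrability of the mollifier, and integrability of forms near the
  diagonal\<close>

lemma continuous_on_mollifier: "continuous_on UNIV (mollifier s)"
  using C_k_mollifier_shift[of 0 s 0] by simp

lemma measurable_mollifier [measurable]: "mollifier s \<in> borel_measurable borel"
  by (intro borel_measurable_continuous_onI continuous_on_mollifier)

lemma integrable_mollifier: "0 < s \<Longrightarrow> integrable lborel (mollifier s :: 'c::euclidean_space \<Rightarrow> real)"
proof (rule Bochner_Integration.integrable_bound[where f="\<lambda>w. (1 / s) ^ DIM('c) * indicator (ball 0 s) w"])
  assume s: "0 < s"
  show "AE w in lborel. norm (mollifier s w) \<le> norm ((1 / s) ^ DIM('c) * indicator (ball 0 s) (w::'c) :: real)"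
    using mollifier_le[OF s, where 'c='c] mollifier_nonneg[OF s, where 'a='c] s by (auto intro!: AE_I2)
qed (auto simp: emeasure_ball intro!: integrable_real_indicator)

lemma nn_integral_mollifier:
  assumes s: "0 < s"
  shows "(\<integral>\<^sup>+w. ennreal (mollifier s (w::'c::euclidean_space)) \<partial>lborel) = ennreal (\<integral>w. mollifier 1 (w::'c) \<partial>lborel)"
proof -
  have "(\<integral>\<^sup>+w. ennreal (mollifier s (w::'c)) \<partial>lborel)
      = ennreal (s ^ DIM('c)) * (\<integral>\<^sup>+w. ennreal (mollifier s (s *\<^sub>R (w::'c))) \<partial>lborel)"
    using nn_integral_lborel_affine[of "\<lambda>w. ennreal (mollifier s (w::'c))" s 0] s by simp
  also have "(\<integral>\<^sup>+w. ennreal (mollifier s (s *\<^sub>R (w::'c))) \<partial>lborel)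
     = (\<integral>\<^sup>+w. ennreal ((1 / s) ^ DIM('c) * mollifier 1 (w::'c)) \<partial>lborel)"
    using s by (simp add: mollifier_def)
  also have "\<dots> = ennreal ((1 / s) ^ DIM('c)) * (\<integral>\<^sup>+w. ennreal (mollifier 1 (w::'c)) \<partial>lborel)"
    using s by (simp add: ennreal_mult mollifier_nonneg nn_integral_cmult)
  also have "ennreal (s ^ DIM('c)) * (ennreal ((1 / s) ^ DIM('c)) * (\<integral>\<^sup>+w. ennreal (mollifier 1 (w::'c)) \<partial>lborel))
    = (\<integral>\<^sup>+w. ennreal (mollifier 1 (w::'c)) \<partial>lborel)"
    using s by (simp add: mult.assoc[symmetric] power_divide flip: ennreal_mult)
  also have "\<dots> = ennreal (\<integral>w. mollifier 1 (w::'c) \<partial>lborel)"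
    by (rule nn_integral_eq_integral) (auto simp: integrable_mollifier mollifier_nonneg)
  finally show ?thesis .
qed

lemma integral_mollifier_pos: "0 < (\<integral>w. mollifier 1 (w::'c::euclidean_space) \<partial>lborel)"
proof -
  \<comment> \<open>For |w| < 1/2 the argument 1 - |w|^2 of the profile is at least 1/2, so the
    profile is at least exp(-2) there.\<close>
  have "0 < exp (-2) * measure lborel (ball (0::'c) (1/2))"
    by (simp add: measure_def emeasure_ball)
  also have "\<dots> = (\<integral>w. exp (-2) * indicator (ball (0::'c) (1/2)) w \<partial>lborel)"
    by simp
  also have "\<dots> \<le> (\<integral>w. mollifier 1 (w::'c) \<partial>lborel)"
  proof (rule integral_mono)
    fix w :: 'c
    show "exp (-2) * indicator (ball 0 (1/2)) w \<le> mollifier 1 w"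
    proof (cases "norm w < 1/2")
      case True
      then have n: "(norm w)\<^sup>2 \<le> (1/2)\<^sup>2"
        by (intro power_mono) auto
      then have "1 / (1 - (norm w)\<^sup>2) \<le> 1 / (1 / 2)"
        by (intro divide_left_mono) (auto simp: power2_eq_square)
      then have "exp (-2) \<le> exp (- (1 / (1 - (norm w)\<^sup>2)))"
        by simp
      then show ?thesis
        using True n by (simp add: mollifier_def bump_poly_def power2_eq_square)
    qed (auto simp: mollifier_nonneg)
  qed (auto simp: integrable_mollifier emeasure_ball intro!: integrable_real_indicator)
  finally show ?thesis .
qed

text \<open>Additive form of Young's convolution inequality: after the product is split into a sum,
  each term depends on one variable only, and the other variable integrates the kernel to its total
  mass.\<close>

lemma nn_integral_young_diff_kernel:
  fixes u v :: "'c::euclidean_space \<Rightarrow> real" and k :: "'c \<Rightarrow> ennreal"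
  assumes p: "1 < p" "1 < q" "1 / p + 1 / q = 1" and d: "0 < d"
    and [measurable]: "u \<in> borel_measurable borel" "v \<in> borel_measurable borel" "k \<in> borel_measurable borel"
  shows "(\<integral>\<^sup>+w. ennreal \<bar>u (fst w) * v (snd w)\<bar> * k (fst w - snd w) \<partial>(lborel \<Otimes>\<^sub>M lborel))
    \<le> (ennreal (d powr p) * (\<integral>\<^sup>+y. ennreal (\<bar>u y\<bar> powr p) \<partial>lborel)
      + ennreal (d powr (- q)) * (\<integral>\<^sup>+y. ennreal (\<bar>v y\<bar> powr q) \<partial>lborel)) * (\<integral>\<^sup>+w. k w \<partial>lborel)"
proof -
  have "(\<integral>\<^sup>+w. ennreal \<bar>u (fst w) * v (snd w)\<bar> * k (fst w - snd w) \<partial>(lborel \<Otimes>\<^sub>M lborel))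
    \<le> (\<integral>\<^sup>+w. ennreal (d powr p * \<bar>u (fst w)\<bar> powr p) * k (fst w - snd w)
        + ennreal (d powr (- q) * \<bar>v (snd w)\<bar> powr q) * k (fst w - snd w) \<partial>(lborel \<Otimes>\<^sub>M lborel))"
    by (intro nn_integral_mono)
      (use scaled_mult_le_powr_add_powr[OF p abs_ge_zero abs_ge_zero d]
        in \<open>auto simp: abs_mult intro!: mult_right_mono ennreal_leI simp flip: distrib_right ennreal_plus\<close>)
  also have "\<dots> = (\<integral>\<^sup>+y. ennreal (d powr p * \<bar>u y\<bar> powr p) \<partial>lborel) * (\<integral>\<^sup>+w. k w \<partial>lborel)
     + (\<integral>\<^sup>+y. ennreal (d powr (- q) * \<bar>v y\<bar> powr q) \<partial>lborel) * (\<integral>\<^sup>+w. k w \<partial>lborel)"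
    using nn_integral_diff_kernel_fst[of "\<lambda>y. ennreal (d powr p * \<bar>u y\<bar> powr p)" k]
      nn_integral_diff_kernel_snd[of "\<lambda>y. ennreal (d powr (- q) * \<bar>v y\<bar> powr q)" k]
    by (subst nn_integral_add) auto
  finally show ?thesis
    by (simp add: ennreal_mult nn_integral_cmult distrib_right)
qed

text \<open>The source of integrability for the double integrals below, and so for each use of
  Fubini. A bounded kernel living within distance \<open>s\<close> of the diagonal is dominated by a
  multiple of the indicator of a ball, which has finite mass.\<close>

lemma integrable_near_diagonal:
  fixes u v :: "'c::euclidean_space \<Rightarrow> real"
  assumes p: "1 < p" "1 < q" "1 / p + 1 / q = 1"
    and [measurable]: "u \<in> borel_measurable borel" "v \<in> borel_measurable borel"
      "K \<in> borel_measurable (borel \<Otimes>\<^sub>M borel)"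
    and u: "integrable lborel (\<lambda>y. \<bar>u y\<bar> powr p)" and v: "integrable lborel (\<lambda>y. \<bar>v y\<bar> powr q)"
    and K: "\<And>y z. \<bar>K (y, z)\<bar> \<le> C * indicator (ball 0 s) (y - z)"
  shows "integrable (lborel \<Otimes>\<^sub>M lborel) (\<lambda>w. u (fst w) * v (snd w) * K w)"
proof (rule integrableI_bounded)
  have [measurable]: "ball (0::'c) s \<in> sets borel"
    by simp
  have "0 \<le> C * indicator (ball 0 s) (y - z)" for y z :: 'c
    using K[of y z] by linarith
  then have "(\<integral>\<^sup>+w. ennreal (norm (u (fst w) * v (snd w) * K w)) \<partial>(lborel \<Otimes>\<^sub>M lborel))
    \<le> (\<integral>\<^sup>+w. ennreal \<bar>u (fst w) * v (snd w)\<bar> * ennreal (C * indicator (ball 0 s) (fst w - snd w)) \<partial>(lborel \<Otimes>\<^sub>M lborel))"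
    using K by (intro nn_integral_mono) (auto simp: abs_mult intro!: ennreal_leI mult_left_mono simp flip: ennreal_mult)
  also have "\<dots> \<le> (ennreal (1 powr p) * (\<integral>\<^sup>+y. ennreal (\<bar>u y\<bar> powr p) \<partial>lborel)
      + ennreal (1 powr (- q)) * (\<integral>\<^sup>+y. ennreal (\<bar>v y\<bar> powr q) \<partial>lborel))
      * (\<integral>\<^sup>+w. ennreal (C * indicator (ball 0 s) (w::'c)) \<partial>lborel)"
    by (rule nn_integral_young_diff_kernel[OF p, of 1]) (simp, measurable)
  also have "\<dots> < \<infinity>"
  proof -
    have "(\<integral>\<^sup>+w. ennreal (C * indicator (ball 0 s) (w::'c)) \<partial>lborel)
        \<le> (\<integral>\<^sup>+w. ennreal \<bar>C\<bar> * indicator (ball 0 s) (w::'c) \<partial>lborel)"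
      by (intro nn_integral_mono) (auto simp: indicator_def intro!: ennreal_leI)
    also have "\<dots> < \<infinity>"
      using emeasure_lborel_ball_finite[of "0::'c" s]
      by (subst nn_integral_cmult_indicator) (auto simp: ennreal_mult_less_top)
    finally have "(\<integral>\<^sup>+w. ennreal (C * indicator (ball 0 s) (w::'c)) \<partial>lborel) < \<infinity>" .
    moreover have "(\<integral>\<^sup>+y. ennreal (\<bar>u y\<bar> powr p) \<partial>lborel) < \<infinity>" "(\<integral>\<^sup>+y. ennreal (\<bar>v y\<bar> powr q) \<partial>lborel) < \<infinity>"
      using u v by (auto simp: integrable_iff_bounded)
    ultimately show ?thesis
      by (simp add: ennreal_mult_less_top)
  qed
  finally show "(\<integral>\<^sup>+w. ennreal (norm (u (fst w) * v (snd w) * K w)) \<partial>(lborel \<Otimes>\<^sub>M lborel)) < \<infinity>" .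
qed measurable

section \<open>Mollified bilinear forms at small scales\<close>

text \<open>Density of continuous compactly supported functions in L^q. \<open>v\<close> is
  truncated in value and in space; the truncation, like every Lebesgue measurable function, is an
  almost everywhere limit of continuous functions, and dominated convergence does the rest.\<close>

lemma continuous_compact_support_approx:
  fixes v :: "'c::euclidean_space \<Rightarrow> real"
  assumes [measurable]: "v \<in> borel_measurable borel" and v: "integrable lborel (\<lambda>y. \<bar>v y\<bar> powr q)"
    and q: "0 < q" and e: "0 < e"
  obtains g M R where "continuous_on UNIV g" "\<And>x. \<bar>g x\<bar> \<le> M" "\<And>x. R \<le> norm x \<Longrightarrow> g x = 0"
    "(\<integral>\<^sup>+x. ennreal (\<bar>v x - g x\<bar> powr q) \<partial>lborel) < ennreal e"
proof -
  \<comment> \<open>Two errors are added, and \<open>powr_add_le\<close> costs the factor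
    2^q.\<close>
  define e' where "e' = e / (2 * 2 powr q)"
  have e': "e' > 0" using e by (simp add: e'_def)
  define vn where "vn n x = (if \<bar>v x\<bar> \<le> real n \<and> norm x \<le> real n then v x else 0)" for n x
  have [measurable]: "vn n \<in> borel_measurable borel" for n
    unfolding vn_def by measurable
  have "(\<lambda>n. \<integral>\<^sup>+x. ennreal (\<bar>v x - vn n x\<bar> powr q) \<partial>lborel) \<longlonglongrightarrow> (\<integral>\<^sup>+x. ennreal (\<bar>v x - v x\<bar> powr q) \<partial>(lborel::'c measure))"
  proof (rule nn_integral_dominated_convergence[where w="\<lambda>x. ennreal (\<bar>v x\<bar> powr q)"])
    show "(\<integral>\<^sup>+x. ennreal (\<bar>v x\<bar> powr q) \<partial>lborel) < \<infinity>"
      using v by (simp add: integrable_iff_bounded)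
    show "AE x in lborel. (\<lambda>n. ennreal (\<bar>v x - vn n x\<bar> powr q)) \<longlonglongrightarrow> ennreal (\<bar>v x - v x\<bar> powr q)"
    proof (rule AE_I2, rule tendsto_eventually)
      fix x
      have "\<forall>\<^sub>F n in sequentially. max \<bar>v x\<bar> (norm x) \<le> real n"
        using eventually_ge_at_top[of "nat \<lceil>max \<bar>v x\<bar> (norm x)\<rceil>"] by eventually_elim linarith
      then show "\<forall>\<^sub>F n in sequentially. ennreal (\<bar>v x - vn n x\<bar> powr q) = ennreal (\<bar>v x - v x\<bar> powr q)"
        by eventually_elim (auto simp: vn_def)
    qed
  qed (auto simp: vn_def)
  then have "(\<lambda>n. \<integral>\<^sup>+x. ennreal (\<bar>v x - vn n x\<bar> powr q) \<partial>lborel) \<longlonglongrightarrow> 0"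
    by simp
  then have "\<forall>\<^sub>F n in sequentially. (\<integral>\<^sup>+x. ennreal (\<bar>v x - vn n x\<bar> powr q) \<partial>lborel) < ennreal e'"
    using e' by (intro order_tendstoD(2)) auto
  then obtain n where n: "(\<integral>\<^sup>+x. ennreal (\<bar>v x - vn n x\<bar> powr q) \<partial>lborel) < ennreal e'"
    by (auto simp: eventually_sequentially)
  have "vn n \<in> borel_measurable lebesgue"
    by (rule measurable_completion) simp
  then have "vn n measurable_on UNIV"
    by (rule lebesgue_measurable_imp_measurable_on) simp
  then obtain N G where N: "negligible N" and G: "\<And>k. continuous_on UNIV (G k)"
    and lim: "\<And>x. x \<notin> N \<Longrightarrow> (\<lambda>k. G k x) \<longlonglongrightarrow> vn n x"
    unfolding measurable_on_def by auto
  \<comment> \<open>Clipping to [-n, n] and a cut-off equal to 1 on the ball of radius n: both leave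
    the limit \<open>vn n\<close> unchanged and provide the common majorant for dominated
    convergence.\<close>
  define g where "g k x = max 0 (min 1 (real n + 1 - norm x)) * max (- real n) (min (real n) (G k x))" for k and x :: 'c
  have cg: "continuous_on UNIV (g k)" for k
    unfolding g_def by (intro continuous_intros G)
  have [measurable]: "g k \<in> borel_measurable borel" for k
    by (intro borel_measurable_continuous_onI cg)
  have gn: "\<bar>g k x\<bar> \<le> real n" for k x
  proof -
    have "\<bar>g k x\<bar> \<le> 1 * real n"
      unfolding g_def abs_mult by (intro mult_mono) auto
    then show ?thesis by simp
  qed
  have g0: "g k x = 0" if "real n + 1 \<le> norm x" for k x
    using that by (simp add: g_def)
  have vnn: "\<bar>vn n x\<bar> \<le> real n" for x
    by (simp add: vn_def)
  have "N \<in> null_sets lebesgue"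
    using N by (simp add: negligible_iff_null_sets)
  then have AE_N: "AE x in lborel. x \<notin> N"
    using AE_not_in[of N lebesgue] by (simp add: AE_completion_iff)
  have m: "(\<lambda>x. ennreal (\<bar>vn n x - g k x\<bar> powr q)) \<in> borel_measurable lborel"
    "(\<lambda>x. ennreal (\<bar>vn n x - vn n x\<bar> powr q)) \<in> borel_measurable lborel" for k
    by measurable
  have m': "(\<lambda>x. ennreal ((2 * real n) powr q) * indicator (cball 0 (real n + 1)) (x::'c)) \<in> borel_measurable lborel"
    by (rule borel_measurable_times_ennreal[OF borel_measurable_const borel_measurable_indicator]) simp
  have "(\<lambda>k. \<integral>\<^sup>+x. ennreal (\<bar>vn n x - g k x\<bar> powr q) \<partial>lborel) \<longlonglongrightarrow> (\<integral>\<^sup>+x. ennreal (\<bar>vn n x - vn n x\<bar> powr q) \<partial>(lborel::'c measure))"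
  proof (rule nn_integral_dominated_convergence[where w="\<lambda>x. ennreal ((2 * real n) powr q) * indicator (cball 0 (real n + 1)) x"])
    show "(\<integral>\<^sup>+x. ennreal ((2 * real n) powr q) * indicator (cball 0 (real n + 1)) x \<partial>(lborel::'c measure)) < \<infinity>"
      using emeasure_lborel_cball_finite[of "0::'c" "real n + 1"]
      by (subst nn_integral_cmult_indicator) (auto simp: ennreal_mult_less_top)
    fix k
    show "AE x in lborel. ennreal (\<bar>vn n x - g k x\<bar> powr q) \<le> ennreal ((2 * real n) powr q) * indicator (cball 0 (real n + 1)) x"
    proof (rule AE_I2)
      fix x
      show "ennreal (\<bar>vn n x - g k x\<bar> powr q) \<le> ennreal ((2 * real n) powr q) * indicator (cball 0 (real n + 1)) x"
      proof (cases "norm x \<le> real n + 1")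
        case True
        have "\<bar>vn n x - g k x\<bar> \<le> 2 * real n"
          using gn[of k x] vnn[of x] by linarith
        then show ?thesis
          using True q by (auto intro!: ennreal_leI powr_mono2)
      next
        case False
        then show ?thesis
          using g0[of x k] by (simp add: vn_def)
      qed
    qed
  next
    show "AE x in lborel. (\<lambda>k. ennreal (\<bar>vn n x - g k x\<bar> powr q)) \<longlonglongrightarrow> ennreal (\<bar>vn n x - vn n x\<bar> powr q)"
      using AE_N
    proof eventually_elim
      case (elim x)
      have lim_g: "(\<lambda>k. g k x) \<longlonglongrightarrow> max 0 (min 1 (real n + 1 - norm x)) * max (- real n) (min (real n) (vn n x))"
        unfolding g_def by (intro tendsto_mult tendsto_max tendsto_min tendsto_const lim elim)
      have eq: "max 0 (min 1 (real n + 1 - norm x)) * max (- real n) (min (real n) (vn n x)) = vn n x"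
      proof (cases "\<bar>v x\<bar> \<le> real n \<and> norm x \<le> real n")
        case True
        then have "max 0 (min 1 (real n + 1 - norm x)) = 1" "max (- real n) (min (real n) (v x)) = v x"
          by linarith+
        then show ?thesis
          using True by (simp add: vn_def)
      next
        case False
        then have "vn n x = 0"
          by (auto simp: vn_def)
        then show ?thesis
          by simp
      qed
      have "(\<lambda>k. \<bar>vn n x - g k x\<bar>) \<longlonglongrightarrow> \<bar>vn n x - vn n x\<bar>"
        by (intro tendsto_rabs tendsto_diff tendsto_const lim_g[unfolded eq])
      from tendsto_powr'[OF this tendsto_const, of q] show ?case
        using q by (intro tendsto_ennrealI) auto
    qed
  qed (rule m m')+
  then have "(\<lambda>k. \<integral>\<^sup>+x. ennreal (\<bar>vn n x - g k x\<bar> powr q) \<partial>lborel) \<longlonglongrightarrow> 0"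
    by simp
  then have "\<forall>\<^sub>F k in sequentially. (\<integral>\<^sup>+x. ennreal (\<bar>vn n x - g k x\<bar> powr q) \<partial>lborel) < ennreal e'"
    using e' by (intro order_tendstoD(2)) auto
  then obtain k where k: "(\<integral>\<^sup>+x. ennreal (\<bar>vn n x - g k x\<bar> powr q) \<partial>lborel) < ennreal e'"
    by (auto simp: eventually_sequentially)
  have "(\<integral>\<^sup>+x. ennreal (\<bar>v x - g k x\<bar> powr q) \<partial>lborel)
     \<le> (\<integral>\<^sup>+x. ennreal (2 powr q) * (ennreal (\<bar>v x - vn n x\<bar> powr q) + ennreal (\<bar>vn n x - g k x\<bar> powr q)) \<partial>lborel)"
  proof (intro nn_integral_mono)
    fix x
    have "\<bar>v x - g k x\<bar> powr q \<le> (\<bar>v x - vn n x\<bar> + \<bar>vn n x - g k x\<bar>) powr q"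
      using q by (intro powr_mono2) auto
    also have "\<dots> \<le> 2 powr q * (\<bar>v x - vn n x\<bar> powr q + \<bar>vn n x - g k x\<bar> powr q)"
      using q by (intro powr_add_le) auto
    finally show "ennreal (\<bar>v x - g k x\<bar> powr q)
       \<le> ennreal (2 powr q) * (ennreal (\<bar>v x - vn n x\<bar> powr q) + ennreal (\<bar>vn n x - g k x\<bar> powr q))"
      by (simp add: ennreal_leI flip: ennreal_mult ennreal_plus)
  qed
  also have "\<dots> = ennreal (2 powr q) * ((\<integral>\<^sup>+x. ennreal (\<bar>v x - vn n x\<bar> powr q) \<partial>lborel)
      + (\<integral>\<^sup>+x. ennreal (\<bar>vn n x - g k x\<bar> powr q) \<partial>lborel))"
    by (simp add: nn_integral_cmult nn_integral_add)
  also have "\<dots> < ennreal (2 powr q) * (ennreal e' + ennreal e')"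
    using add_strict_mono[OF n k] by (intro ennreal_mult_strict_left_mono) auto
  also have "\<dots> = ennreal e"
    using e' by (simp add: e'_def flip: ennreal_plus ennreal_mult)
  finally show ?thesis
    using cg gn g0 that by blast
qed

abbreviation mollifier_form :: "real \<Rightarrow> ('c::euclidean_space \<Rightarrow> real) \<Rightarrow> ('c \<Rightarrow> real) \<Rightarrow> real" where
  "mollifier_form s u v \<equiv> \<integral>w. u (fst w) * v (snd w) * mollifier s (fst w - snd w) \<partial>(lborel \<Otimes>\<^sub>M lborel)"

lemma abs_integral_le_of_nn_integral:
  fixes f :: "'a \<Rightarrow> real"
  assumes "(\<integral>\<^sup>+x. ennreal \<bar>f x\<bar> \<partial>M) \<le> ennreal b" "0 \<le> b"
  shows "\<bar>\<integral>x. f x \<partial>M\<bar> \<le> b"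
proof (cases "integrable M f")
  case True
  then have "ennreal \<bar>\<integral>x. f x \<partial>M\<bar> \<le> (\<integral>\<^sup>+x. ennreal \<bar>f x\<bar> \<partial>M)"
    using integral_norm_bound_ennreal[OF True] by simp
  then show ?thesis
    using assms by (meson ennreal_le_iff order_trans)
qed (use assms in \<open>simp add: not_integrable_integral_eq\<close>)

context
  fixes p q :: real and u :: "'c::euclidean_space \<Rightarrow> real"
  assumes pq: "1 < p" "1 < q" "1 / p + 1 / q = 1"
    and u_meas [measurable]: "u \<in> borel_measurable borel"
    and u: "integrable lborel (\<lambda>y. \<bar>u y\<bar> powr p)"
begin

lemma integrable_mollifier_form:
  assumes s: "0 < s" and [measurable]: "v \<in> borel_measurable borel"
    and v: "integrable lborel (\<lambda>y. \<bar>v y\<bar> powr q)"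
  shows "integrable (lborel \<Otimes>\<^sub>M lborel) (\<lambda>w. u (fst w) * v (snd w) * mollifier s (fst w - snd w))"
proof (rule integrable_near_diagonal[OF pq _ _ _ u v, where C="(1 / s) ^ DIM('c)" and s=s])
  fix y z :: 'c
  show "\<bar>mollifier s (fst (y, z) - snd (y, z))\<bar> \<le> (1 / s) ^ DIM('c) * indicator (ball 0 s) (y - z)"
    using mollifier_le[OF s, of "y - z"] mollifier_nonneg[OF s, of "y - z"] by simp
qed measurable

lemma integrable_product:
  assumes [measurable]: "v \<in> borel_measurable borel" and v: "integrable lborel (\<lambda>y. \<bar>v y\<bar> powr q)"
  shows "integrable lborel (\<lambda>y. u y * v y)"
proof (rule Bochner_Integration.integrable_bound)
  show "integrable lborel (\<lambda>y. \<bar>u y\<bar> powr p + \<bar>v y\<bar> powr q)"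
    using u v by simp
  show "AE y in lborel. norm (u y * v y) \<le> norm (\<bar>u y\<bar> powr p + \<bar>v y\<bar> powr q)"
    using mult_le_powr_add_powr[OF pq abs_ge_zero abs_ge_zero] by (auto simp: abs_mult)
qed measurable

text \<open>Uniform in \<open>s\<close>, since all mollifiers have the same mass. This uniformity
  lets the limit s -> 0 pass from continuous functions to L^q.\<close>

lemma mollifier_form_bound:
  assumes s: "0 < s" and d: "0 < d" and [measurable]: "v \<in> borel_measurable borel"
    and b: "(\<integral>\<^sup>+y. ennreal (\<bar>v y\<bar> powr q) \<partial>lborel) \<le> ennreal b" "0 \<le> b"
  shows "\<bar>mollifier_form s u v\<bar> \<le> (d powr p * (\<integral>y. \<bar>u y\<bar> powr p \<partial>lborel) + d powr (- q) * b)
      * (\<integral>w. mollifier 1 (w::'c) \<partial>lborel)"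
proof (rule abs_integral_le_of_nn_integral)
  have U: "(\<integral>\<^sup>+y. ennreal (\<bar>u y\<bar> powr p) \<partial>lborel) = ennreal (\<integral>y. \<bar>u y\<bar> powr p \<partial>lborel)"
    by (rule nn_integral_eq_integral[OF u]) auto
  have "(\<integral>\<^sup>+w. ennreal \<bar>u (fst w) * v (snd w) * mollifier s (fst w - snd w)\<bar> \<partial>(lborel \<Otimes>\<^sub>M lborel))
     = (\<integral>\<^sup>+w. ennreal \<bar>u (fst w) * v (snd w)\<bar> * ennreal (mollifier s (fst w - snd w)) \<partial>(lborel \<Otimes>\<^sub>M lborel))"
    using mollifier_nonneg[OF s, where 'a='c] by (simp add: abs_mult flip: ennreal_mult)
  also have "\<dots> \<le> (ennreal (d powr p) * (\<integral>\<^sup>+y. ennreal (\<bar>u y\<bar> powr p) \<partial>lborel)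
      + ennreal (d powr (- q)) * (\<integral>\<^sup>+y. ennreal (\<bar>v y\<bar> powr q) \<partial>lborel)) * (\<integral>\<^sup>+w. ennreal (mollifier s (w::'c)) \<partial>lborel)"
    by (rule nn_integral_young_diff_kernel[OF pq d]) measurable
  also have "\<dots> \<le> (ennreal (d powr p) * ennreal (\<integral>y. \<bar>u y\<bar> powr p \<partial>lborel)
      + ennreal (d powr (- q)) * ennreal b) * ennreal (\<integral>w. mollifier 1 (w::'c) \<partial>lborel)"
    unfolding nn_integral_mollifier[OF s] U by (intro mult_right_mono add_mono mult_left_mono b order_refl) auto
  also have "\<dots> = ennreal ((d powr p * (\<integral>y. \<bar>u y\<bar> powr p \<partial>lborel) + d powr (- q) * b)
      * (\<integral>w. mollifier 1 (w::'c) \<partial>lborel))"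
    using b integral_mollifier_pos[where 'c='c] by (simp flip: ennreal_mult ennreal_plus)
  finally show "(\<integral>\<^sup>+w. ennreal \<bar>u (fst w) * v (snd w) * mollifier s (fst w - snd w)\<bar> \<partial>(lborel \<Otimes>\<^sub>M lborel))
      \<le> ennreal ((d powr p * (\<integral>y. \<bar>u y\<bar> powr p \<partial>lborel) + d powr (- q) * b) * (\<integral>w. mollifier 1 (w::'c) \<partial>lborel))" .
qed (use b integral_mollifier_pos[where 'c='c] in auto)

lemma product_integral_bound:
  assumes d: "0 < d" and [measurable]: "v \<in> borel_measurable borel"
    and b: "(\<integral>\<^sup>+y. ennreal (\<bar>v y\<bar> powr q) \<partial>lborel) \<le> ennreal b" "0 \<le> b"
  shows "\<bar>\<integral>y. u y * v y \<partial>lborel\<bar> \<le> d powr p * (\<integral>y. \<bar>u y\<bar> powr p \<partial>lborel) + d powr (- q) * b"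
proof (rule abs_integral_le_of_nn_integral)
  have U: "(\<integral>\<^sup>+y. ennreal (\<bar>u y\<bar> powr p) \<partial>lborel) = ennreal (\<integral>y. \<bar>u y\<bar> powr p \<partial>lborel)"
    by (rule nn_integral_eq_integral[OF u]) auto
  have "(\<integral>\<^sup>+y. ennreal \<bar>u y * v y\<bar> \<partial>lborel)
    \<le> (\<integral>\<^sup>+y. ennreal (d powr p) * ennreal (\<bar>u y\<bar> powr p) + ennreal (d powr (- q)) * ennreal (\<bar>v y\<bar> powr q) \<partial>lborel)"
    using scaled_mult_le_powr_add_powr[OF pq abs_ge_zero abs_ge_zero d]
    by (intro nn_integral_mono) (auto simp: abs_mult ennreal_leI simp flip: ennreal_mult ennreal_plus)
  also have "\<dots> = ennreal (d powr p) * (\<integral>\<^sup>+y. ennreal (\<bar>u y\<bar> powr p) \<partial>lborel)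
      + ennreal (d powr (- q)) * (\<integral>\<^sup>+y. ennreal (\<bar>v y\<bar> powr q) \<partial>lborel)"
    by (simp add: nn_integral_add nn_integral_cmult)
  also have "\<dots> \<le> ennreal (d powr p) * ennreal (\<integral>y. \<bar>u y\<bar> powr p \<partial>lborel) + ennreal (d powr (- q)) * ennreal b"
    unfolding U by (intro add_mono mult_left_mono b order_refl) auto
  also have "\<dots> = ennreal (d powr p * (\<integral>y. \<bar>u y\<bar> powr p \<partial>lborel) + d powr (- q) * b)"
    using b by (simp flip: ennreal_mult ennreal_plus)
  finally show "(\<integral>\<^sup>+y. ennreal \<bar>u y * v y\<bar> \<partial>lborel)
    \<le> ennreal (d powr p * (\<integral>y. \<bar>u y\<bar> powr p \<partial>lborel) + d powr (- q) * b)" .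
qed (use b in auto)

lemma integrable_compact_support_powr:
  fixes g :: "'c \<Rightarrow> real"
  assumes "continuous_on UNIV g" "\<And>x. \<bar>g x\<bar> \<le> M" "\<And>x. R \<le> norm x \<Longrightarrow> g x = 0" "0 < r"
  shows "integrable lborel (\<lambda>y. \<bar>g y\<bar> powr r)"
proof (rule Bochner_Integration.integrable_bound[where f="\<lambda>y. M powr r * indicator (cball 0 R) y"])
  have [measurable]: "g \<in> borel_measurable borel"
    by (intro borel_measurable_continuous_onI assms)
  show "(\<lambda>y. \<bar>g y\<bar> powr r) \<in> borel_measurable lborel"
    by measurable
  show "AE y in lborel. norm (\<bar>g y\<bar> powr r) \<le> norm (M powr r * indicator (cball 0 R) y)"
    using assms by (intro AE_I2) (auto simp: indicator_def intro!: powr_mono2)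
qed (use emeasure_lborel_cball_finite[of "0::'c" R] in \<open>auto intro!: integrable_real_indicator\<close>)

text \<open>With g(y) in place of g(z) the double integral equals its claimed limit exactly, because
  the z-integral of the mollifier is the constant mass. The error of this replacement is governed by
  uniform continuity.\<close>

lemma mollifier_form_continuous_tendsto:
  assumes g: "continuous_on UNIV g" "\<And>x. \<bar>g x\<bar> \<le> M" "\<And>x. R \<le> norm x \<Longrightarrow> g x = 0"
  shows "((\<lambda>s. mollifier_form s u g) \<longlongrightarrow> (\<integral>w. mollifier 1 (w::'c) \<partial>lborel) * (\<integral>y. u y * g y \<partial>lborel)) (at_right 0)"
proof (rule tendstoI)
  fix e :: real assume e: "0 < e"
  have [measurable]: "g \<in> borel_measurable borel"
    by (intro borel_measurable_continuous_onI g)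
  have gq: "integrable lborel (\<lambda>y. \<bar>g y\<bar> powr q)"
    using g pq by (intro integrable_compact_support_powr) auto
  define c0 where "c0 = (\<integral>w. mollifier 1 (w::'c) \<partial>lborel)"
  have c0: "c0 > 0"
    unfolding c0_def by (rule integral_mollifier_pos)
  let ?B = "cball (0::'c) (R + 1)"
  \<comment> \<open>Outside this ball g(y) and g(z) both vanish when |y - z| < s < 1. As an L^q
    function it makes \<open>u\<close> times \<open>one\<close> integrable.\<close>
  define one where "one y = (indicator ?B y :: real)" for y
  have [measurable]: "one \<in> borel_measurable borel"
    unfolding one_def[abs_def] by (intro borel_measurable_indicator) simp
  have one_q: "integrable lborel (\<lambda>y. \<bar>one y\<bar> powr q)"
  proof -
    have "(\<lambda>y. \<bar>one y\<bar> powr q) = indicator ?B"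
      using pq by (auto simp: one_def indicator_def fun_eq_iff)
    then show ?thesis
      using emeasure_lborel_cball_finite[of "0::'c" "R + 1"] by (auto intro!: integrable_real_indicator)
  qed
  define L where "L = (\<integral>y. \<bar>u y * one y\<bar> \<partial>lborel)"
  have L: "(\<integral>\<^sup>+y. ennreal \<bar>u y * one y\<bar> \<partial>lborel) = ennreal L" "L \<ge> 0"
    using integrable_product[OF _ one_q] by (auto simp: L_def intro!: nn_integral_eq_integral)
  define \<eta> where "\<eta> = e / (2 * (L * c0 + 1))"
  have \<eta>: "\<eta> > 0" "\<eta> * (L * c0) < e"
  proof -
    have Lc: "0 \<le> L * c0"
      using L c0 by simp
    then show "\<eta> > 0"
      using e by (simp add: \<eta>_def)
    have "e * (L * c0) < e * (2 * (L * c0 + 1))"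
      using e Lc by (intro mult_strict_left_mono) auto
    then show "\<eta> * (L * c0) < e"
      using Lc by (simp add: \<eta>_def pos_divide_less_eq)
  qed
  \<comment> \<open>Radius R + 2 contains z whenever |y| \<le> R + 1 and |y - z| < 1.\<close>
  have "uniformly_continuous_on (cball 0 (R + 2)) g"
    using g(1) by (intro compact_uniformly_continuous) (auto intro: continuous_on_subset)
  then obtain r where r: "r > 0" "\<And>x y. x \<in> cball 0 (R + 2) \<Longrightarrow> y \<in> cball 0 (R + 2) \<Longrightarrow> dist y x < r \<Longrightarrow> dist (g y) (g x) < \<eta>"
    unfolding uniformly_continuous_on_def using \<eta>(1) by metis
  have "\<forall>\<^sub>F s in at_right 0. 0 < s \<and> s < min 1 r"
    using r(1) by (auto simp: eventually_at_right_field intro!: exI[of _ "min 1 r"])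
  then show "\<forall>\<^sub>F s in at_right 0. dist (mollifier_form s u g) ((\<integral>w. mollifier 1 (w::'c) \<partial>lborel) * (\<integral>y. u y * g y \<partial>lborel)) < e"
  proof eventually_elim
    case (elim s)
    then have s: "0 < s" "s < 1" "s < r" by auto
    have near: "\<bar>g z - g y\<bar> * mollifier s (y - z) \<le> \<eta> * one y * mollifier s (y - z)" for y z
    proof (cases "norm (y - z) < s")
      case True
      show ?thesis
      proof (cases "norm y \<le> R + 1")
        case True
        have "norm z \<le> norm y + norm (y - z)"
          by (metis norm_minus_commute norm_triangle_sub)
        then have "dist (g z) (g y) < \<eta>"
          using True \<open>norm (y - z) < s\<close> s by (intro r(2)) (auto simp: dist_norm norm_minus_commute)
        then show ?thesis
          using True mollifier_nonneg[OF s(1), of "y - z"]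
          by (auto simp: dist_real_def one_def intro!: mult_right_mono)
      next
        case False
        have "norm y \<le> norm z + norm (y - z)"
          by (rule norm_triangle_sub)
        then have "g z = 0" "g y = 0"
          using False \<open>norm (y - z) < s\<close> s g(3) by auto
        then show ?thesis
          using \<eta>(1) mollifier_nonneg[OF s(1), of "y - z"] by (simp add: one_def)
      qed
    qed (use s in \<open>simp add: mollifier_eq_0\<close>)
    have I1: "integrable (lborel \<Otimes>\<^sub>M lborel) (\<lambda>w. u (fst w) * g (snd w) * mollifier s (fst w - snd w))"
      by (rule integrable_mollifier_form[OF s(1) _ gq]) simp
    \<comment> \<open>\<open>integrable_near_diagonal\<close> asks for an L^q function of z, but g
      now depends on y. The inserted factor \<open>one (snd w)\<close> supplies it and equals 1
      wherever the remaining factors can be nonzero.\<close>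
    have "integrable (lborel \<Otimes>\<^sub>M lborel) (\<lambda>w. u (fst w) * one (snd w) * (g (fst w) * mollifier s (fst w - snd w)))"
    proof (rule integrable_near_diagonal[OF pq _ _ _ u one_q, where C="M * (1 / s) ^ DIM('c)" and s=s])
      fix y z :: 'c
      have "\<bar>g y * mollifier s (y - z)\<bar> \<le> M * ((1 / s) ^ DIM('c) * indicator (ball 0 s) (y - z))"
        unfolding abs_mult using g(2)[of y] mollifier_le[OF s(1), of "y - z"] mollifier_nonneg[OF s(1), of "y - z"]
        by (intro mult_mono) auto
      then show "\<bar>g (fst (y, z)) * mollifier s (fst (y, z) - snd (y, z))\<bar> \<le> M * (1 / s) ^ DIM('c) * indicator (ball 0 s) (y - z)"
        by (simp add: mult.assoc)
    qed measurable
    also have "(\<lambda>w. u (fst w) * one (snd w) * (g (fst w) * mollifier s (fst w - snd w)))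
      = (\<lambda>w. u (fst w) * g (fst w) * mollifier s (fst w - snd w))"
    proof
      fix w :: "'c \<times> 'c"
      have "one (snd w) = 1" if "norm (fst w) < R" "norm (fst w - snd w) < s"
        using that s norm_triangle_ineq2[of "snd w" "fst w"] by (auto simp: one_def norm_minus_commute)
      then show "u (fst w) * one (snd w) * (g (fst w) * mollifier s (fst w - snd w))
        = u (fst w) * g (fst w) * mollifier s (fst w - snd w)"
        using g(3)[of "fst w"] mollifier_eq_0[OF s(1), of "fst w - snd w"] by (cases "norm (fst w) < R"; cases "norm (fst w - snd w) < s") auto
    qed
    finally have I2: "integrable (lborel \<Otimes>\<^sub>M lborel) (\<lambda>w. u (fst w) * g (fst w) * mollifier s (fst w - snd w))" .
    have "(\<integral>w. u (fst w) * g (fst w) * mollifier s (fst w - snd w) \<partial>(lborel \<Otimes>\<^sub>M lborel))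
       = (\<integral>y. \<integral>z. u y * g y * mollifier s (y - z) \<partial>lborel \<partial>lborel)"
      using lborel_pair.integral_fst'[OF I2] by simp
    also have "\<dots> = (\<integral>y. u y * g y * c0 \<partial>lborel)"
    proof (intro Bochner_Integration.integral_cong refl)
      fix y :: 'c
      have "(\<integral>z. mollifier s (y - z) \<partial>lborel) = enn2real (\<integral>\<^sup>+z. ennreal (mollifier s (y - z)) \<partial>lborel)"
        using mollifier_nonneg[OF s(1), where 'a='c] by (intro integral_eq_nn_integral) auto
      also have "\<dots> = c0"
        using nn_integral_lborel_reflect[of "\<lambda>w. ennreal (mollifier s w)" y] c0
        by (simp add: nn_integral_mollifier[OF s(1)] c0_def)
      finally show "(\<integral>z. u y * g y * mollifier s (y - z) \<partial>lborel) = u y * g y * c0"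
        by simp
    qed
    finally have eq: "c0 * (\<integral>y. u y * g y \<partial>lborel) = (\<integral>w. u (fst w) * g (fst w) * mollifier s (fst w - snd w) \<partial>(lborel \<Otimes>\<^sub>M lborel))"
      by simp
    have "mollifier_form s u g - c0 * (\<integral>y. u y * g y \<partial>lborel)
      = (\<integral>w. u (fst w) * (g (snd w) - g (fst w)) * mollifier s (fst w - snd w) \<partial>(lborel \<Otimes>\<^sub>M lborel))"
      unfolding eq by (subst Bochner_Integration.integral_diff[OF I1 I2, symmetric]) (simp add: algebra_simps)
    moreover have "\<bar>\<integral>w. u (fst w) * (g (snd w) - g (fst w)) * mollifier s (fst w - snd w) \<partial>(lborel \<Otimes>\<^sub>M lborel)\<bar> \<le> \<eta> * (L * c0)"
    proof (rule abs_integral_le_of_nn_integral)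
      have "(\<integral>\<^sup>+w. ennreal \<bar>u (fst w) * (g (snd w) - g (fst w)) * mollifier s (fst w - snd w)\<bar> \<partial>(lborel \<Otimes>\<^sub>M lborel))
        \<le> (\<integral>\<^sup>+w. ennreal \<eta> * ennreal \<bar>u (fst w) * one (fst w)\<bar> * ennreal (mollifier s (fst w - snd w)) \<partial>(lborel \<Otimes>\<^sub>M lborel))"
      proof (intro nn_integral_mono)
        fix w :: "'c \<times> 'c"
        have "\<bar>u (fst w)\<bar> * (\<bar>g (snd w) - g (fst w)\<bar> * mollifier s (fst w - snd w))
          \<le> \<bar>u (fst w)\<bar> * (\<eta> * one (fst w) * mollifier s (fst w - snd w))"
          by (intro mult_left_mono near) auto
        moreover have "one (fst w) \<ge> 0" "mollifier s (fst w - snd w) \<ge> 0"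
          using mollifier_nonneg[OF s(1), of "fst w - snd w"] by (auto simp: one_def)
        ultimately show "ennreal \<bar>u (fst w) * (g (snd w) - g (fst w)) * mollifier s (fst w - snd w)\<bar>
          \<le> ennreal \<eta> * ennreal \<bar>u (fst w) * one (fst w)\<bar> * ennreal (mollifier s (fst w - snd w))"
          using \<eta>(1) by (simp add: abs_mult ennreal_leI mult_ac flip: ennreal_mult)
      qed
      also have "\<dots> = (\<integral>\<^sup>+y. ennreal \<eta> * ennreal \<bar>u y * one y\<bar> \<partial>lborel) * ennreal c0"
        using nn_integral_diff_kernel_fst[of "\<lambda>y. ennreal \<eta> * ennreal \<bar>u y * one y\<bar>" "\<lambda>w. ennreal (mollifier s w)"]
        by (simp add: nn_integral_mollifier[OF s(1)] c0_def)
      also have "\<dots> = ennreal (\<eta> * (L * c0))"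
        using L(2) \<eta>(1) c0
        by (subst nn_integral_cmult) (simp_all add: L(1) mult.assoc ennreal_mult)
      finally show "(\<integral>\<^sup>+w. ennreal \<bar>u (fst w) * (g (snd w) - g (fst w)) * mollifier s (fst w - snd w)\<bar> \<partial>(lborel \<Otimes>\<^sub>M lborel))
        \<le> ennreal (\<eta> * (L * c0))" by simp
    qed (use \<eta> L c0 in auto)
    ultimately show ?case
      using \<eta>(2) by (simp add: dist_real_def c0_def)
  qed
qed

text \<open>Density argument: \<open>v\<close> is split into a continuous \<open>g\<close> and an
  L^q-small rest, whose form and whose limit are both small uniformly in \<open>s\<close>.\<close>

theorem mollifier_form_tendsto:
  assumes [measurable]: "v \<in> borel_measurable borel" and v: "integrable lborel (\<lambda>y. \<bar>v y\<bar> powr q)"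
  shows "((\<lambda>s. mollifier_form s u v) \<longlongrightarrow> (\<integral>w. mollifier 1 (w::'c) \<partial>lborel) * (\<integral>y. u y * v y \<partial>lborel)) (at_right 0)"
proof (rule tendstoI)
  fix e :: real assume e: "0 < e"
  define c0 where "c0 = (\<integral>w. mollifier 1 (w::'c) \<partial>lborel)"
  have c0: "c0 > 0"
    unfolding c0_def by (rule integral_mollifier_pos)
  define U where "U = (\<integral>y. \<bar>u y\<bar> powr p \<partial>lborel)"
  have U: "U \<ge> 0" by (simp add: U_def)
  \<comment> \<open>The weight \<open>d\<close> is chosen to make the contribution of
    \<open>u\<close> small; the approximation error \<open>b\<close> is fixed afterwards so that the
    factor d^(-q) does no harm. Each contributes e / (6 c0), hence e / 3 for the form and for the
    limit.\<close>
  define d where "d = (e / (6 * c0 * (U + 1))) powr (1 / p)"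
  have d: "d > 0" using e c0 U by (simp add: d_def)
  have dp: "d powr p * U \<le> e / (6 * c0)"
  proof -
    have "d powr p = e / (6 * c0 * (U + 1))"
      using e c0 U pq by (simp add: d_def powr_powr)
    then have "d powr p * U = e / (6 * c0) * (U / (U + 1))"
      by simp
    also have "\<dots> \<le> e / (6 * c0) * 1"
      using e c0 U by (intro mult_left_mono) auto
    finally show ?thesis by simp
  qed
  define b where "b = e / (6 * c0) * d powr q"
  have b: "b > 0" using e c0 d by (simp add: b_def)
  have db: "d powr (- q) * b = e / (6 * c0)"
    using d by (simp add: b_def powr_minus)
  obtain g M R where g: "continuous_on UNIV g" "\<And>x. \<bar>g x\<bar> \<le> M" "\<And>x. R \<le> norm x \<Longrightarrow> g x = 0"
    and gv: "(\<integral>\<^sup>+x. ennreal (\<bar>v x - g x\<bar> powr q) \<partial>lborel) < ennreal b"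
    using continuous_compact_support_approx[OF _ v _ b] pq by auto
  have [measurable]: "g \<in> borel_measurable borel"
    by (intro borel_measurable_continuous_onI g)
  have gq: "integrable lborel (\<lambda>y. \<bar>g y\<bar> powr q)"
    using g pq by (intro integrable_compact_support_powr) auto
  have hq: "integrable lborel (\<lambda>y. \<bar>v y - g y\<bar> powr q)"
    using gv by (auto simp: integrable_iff_bounded intro: order.strict_trans)
  have "\<forall>\<^sub>F s in at_right 0. dist (mollifier_form s u g) (c0 * (\<integral>y. u y * g y \<partial>lborel)) < e / 3"
    using mollifier_form_continuous_tendsto[OF g] e unfolding c0_def by (intro tendstoD) auto
  moreover have "\<forall>\<^sub>F s in at_right 0. (0::real) < s"
    by (simp add: eventually_at_right_less)
  ultimately show "\<forall>\<^sub>F s in at_right 0. dist (mollifier_form s u v) ((\<integral>w. mollifier 1 (w::'c) \<partial>lborel) * (\<integral>y. u y * v y \<partial>lborel)) < e"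
  proof eventually_elim
    case (elim s)
    have h1: "\<bar>mollifier_form s u (\<lambda>y. v y - g y)\<bar> \<le> (d powr p * U + d powr (- q) * b) * c0"
      unfolding U_def c0_def using gv b by (intro mollifier_form_bound elim d) auto
    have h2: "\<bar>\<integral>y. u y * (v y - g y) \<partial>lborel\<bar> \<le> d powr p * U + d powr (- q) * b"
      unfolding U_def using gv b by (intro product_integral_bound d) auto
    have small: "(d powr p * U + d powr (- q) * b) * c0 \<le> e / 3"
    proof -
      have "(d powr p * U + d powr (- q) * b) * c0 \<le> (e / (6 * c0) + e / (6 * c0)) * c0"
        using dp db c0 by (intro mult_right_mono add_mono) auto
      then show ?thesis using c0 by (simp add: field_simps)
    qed
    have s1: "mollifier_form s u v = mollifier_form s u g + mollifier_form s u (\<lambda>y. v y - g y)"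
      using Bochner_Integration.integral_add[OF integrable_mollifier_form[OF elim(2) _ gq]
          integrable_mollifier_form[OF elim(2) _ hq]] by (simp add: algebra_simps)
    have s2: "(\<integral>y. u y * v y \<partial>lborel) = (\<integral>y. u y * g y \<partial>lborel) + (\<integral>y. u y * (v y - g y) \<partial>lborel)"
      using Bochner_Integration.integral_add[OF integrable_product[OF _ gq] integrable_product[OF _ hq]]
      by (simp add: algebra_simps)
    have "\<bar>c0 * (\<integral>y. u y * (v y - g y) \<partial>lborel)\<bar> \<le> c0 * (d powr p * U + d powr (- q) * b)"
      unfolding abs_mult using c0 h2 by (intro mult_mono) auto
    then have h3: "\<bar>c0 * (\<integral>y. u y * (v y - g y) \<partial>lborel)\<bar> \<le> e / 3"
      using small by (simp add: mult.commute)
    have "\<bar>mollifier_form s u v - c0 * (\<integral>y. u y * v y \<partial>lborel)\<bar> < e"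
      using elim(1) h1 h3 small unfolding s1 s2 dist_real_def distrib_left by linarith
    then show ?case
      by (simp add: dist_real_def c0_def)
  qed
qed

end

section \<open>The scale derivative of the mollified form\<close>

text \<open>The mean value inequality bounds every difference quotient by \<open>w\<close>, so
  dominated convergence applies along each sequence of increments tending to 0.\<close>

lemma DERIV_integral_dominated:
  fixes f f' :: "'a \<Rightarrow> real \<Rightarrow> real"
  assumes s0: "s0 \<in> {a<..<b}"
    and int: "\<And>s. s \<in> {a<..<b} \<Longrightarrow> integrable M (\<lambda>x. f x s)"
    and der: "\<And>x s. s \<in> {a<..<b} \<Longrightarrow> (f x has_real_derivative f' x s) (at s)"
    and bound: "\<And>x s. s \<in> {a<..<b} \<Longrightarrow> \<bar>f' x s\<bar> \<le> w x"
    and w: "integrable M w" and meas: "(\<lambda>x. f' x s0) \<in> borel_measurable M"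
  shows "((\<lambda>s. \<integral>x. f x s \<partial>M) has_real_derivative (\<integral>x. f' x s0 \<partial>M)) (at s0)"
proof -
  let ?S = "{a - s0<..<b - s0}"
  have quot: "\<bar>(f x (s0 + h) - f x s0) / h\<bar> \<le> w x" if h: "h \<in> ?S - {0}" for x h
  proof -
    have "norm (f x (s0 + h) - f x s0) \<le> w x * norm (s0 + h - s0)"
    proof (rule field_differentiable_bound[of "{a<..<b}"])
      show "(f x has_field_derivative f' x s) (at s within {a<..<b})" if "s \<in> {a<..<b}" for s
        using der[OF that] by (rule DERIV_subset) simp
    qed (use h s0 bound in auto)
    then show ?thesis
      using h by (simp add: field_simps)
  qed
  have "((\<lambda>h. ((\<integral>x. f x (s0 + h) \<partial>M) - (\<integral>x. f x s0 \<partial>M)) / h) \<longlongrightarrow> (\<integral>x. f' x s0 \<partial>M)) (at 0 within ?S)"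
    unfolding tendsto_at_iff_sequentially comp_def
  proof safe
    fix X :: "nat \<Rightarrow> real"
    assume X: "\<forall>i. X i \<in> ?S - {0}" "X \<longlonglongrightarrow> 0"
    have Xi: "s0 + X i \<in> {a<..<b}" "X i \<noteq> 0" for i
      using X(1)[rule_format, of i] by auto
    have "(\<lambda>i. \<integral>x. (f x (s0 + X i) - f x s0) / X i \<partial>M) \<longlonglongrightarrow> (\<integral>x. f' x s0 \<partial>M)"
    proof (rule integral_dominated_convergence[OF meas _ w])
      show "(\<lambda>x. (f x (s0 + X i) - f x s0) / X i) \<in> borel_measurable M" for i
        using int[OF Xi(1), of i] int[OF s0] by simp
      show "AE x in M. (\<lambda>i. (f x (s0 + X i) - f x s0) / X i) \<longlonglongrightarrow> f' x s0"
      proof (rule AE_I2)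
        fix x
        have "((\<lambda>h. (f x (s0 + h) - f x s0) / h) \<longlongrightarrow> f' x s0) (at 0)"
          using der[OF s0] by (simp add: DERIV_def)
        then show "(\<lambda>i. (f x (s0 + X i) - f x s0) / X i) \<longlonglongrightarrow> f' x s0"
          using X(2) Xi(2) unfolding tendsto_at_iff_sequentially comp_def by auto
      qed
      show "AE x in M. norm ((f x (s0 + X i) - f x s0) / X i) \<le> w x" for i
        using quot X(1) by auto
    qed
    moreover have "(\<integral>x. (f x (s0 + X i) - f x s0) / X i \<partial>M) = ((\<integral>x. f x (s0 + X i) \<partial>M) - (\<integral>x. f x s0 \<partial>M)) / X i" for i
      using int[OF Xi(1), of i] int[OF s0] by simp
    ultimately show "(\<lambda>i. ((\<integral>x. f x (s0 + X i) \<partial>M) - (\<integral>x. f x s0 \<partial>M)) / X i) \<longlonglongrightarrow> (\<integral>x. f' x s0 \<partial>M)"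
      by (simp only:)
  qed
  moreover have "at (0::real) within ?S = at 0"
    using s0 by (intro at_within_open) auto
  ultimately show ?thesis
    by (simp add: DERIV_def)
qed

lemma measurable_mollifier_grad [measurable]: "mollifier_grad s j k \<in> borel_measurable borel"
proof -
  have [measurable]: "bump_poly P \<in> borel_measurable borel" for P
    by (intro borel_measurable_continuous_onI continuous_at_imp_continuous_on ballI DERIV_isCont[OF DERIV_bump_poly])
  show ?thesis
    unfolding mollifier_grad_def[abs_def] by measurable
qed

section \<open>Polynomial majorants of the Gaussian and of its gradient\<close>

lemma power_le_fact_times_exp:
  fixes x :: real
  assumes "0 \<le> x"
  shows "x ^ n \<le> fact n * exp x"
proof -
  have "(\<lambda>n. x ^ n /\<^sub>R fact n) sums exp x"
    by (rule exp_converges)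
  then have "x ^ n /\<^sub>R fact n \<le> exp x"
    using sum_le_suminf[of "\<lambda>n. x ^ n /\<^sub>R fact n" "{n}"] assms by (auto simp: sums_iff)
  then show ?thesis
    by (simp add: field_simps)
qed

text \<open>Up to \<open>t ^ DIM('c)\<close> this is the square of \<open>decay_kernel\<close>, so that one factor can be moved from
  \<open>y\<close> to a nearby point \<open>z\<close>.\<close>

definition gauss_majorant :: "real \<Rightarrow> 'c::euclidean_space \<Rightarrow> real" where
  "gauss_majorant t w = (1 / t) ^ DIM('c) * (1 / (1 + norm w / t)) ^ (2 * DIM('c) + 2)"

text \<open>With r = |w| / t, the inequality x^n \<le> n! exp x is used at x = 1 + r and n = 2 N +
  3, one power above \<open>gauss_majorant\<close>; the spare power absorbs the factor 1 + 2 pi r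
  from the gradient. The exp 2 comes from 1 + r - pi r^2 \<le> 2.\<close>

lemma gauss_kernel_bounds:
  fixes w :: "'c::euclidean_space"
  defines "C \<equiv> 2 * pi * fact (2 * DIM('c) + 3) * exp 2"
  assumes t: "0 < t"
  shows "gauss_kernel t w \<le> C * gauss_majorant t w"
    and "gauss_kernel t w * (2 * pi * norm w / t\<^sup>2) \<le> C / t * gauss_majorant t w"
proof -
  define r where "r = norm w / t"
  let ?n = "2 * DIM('c) + 2"
  have r: "0 \<le> r" using t by (simp add: r_def)
  have "(1 + r) ^ (?n + 1) \<le> fact (?n + 1) * exp (1 + r)"
    using r by (intro power_le_fact_times_exp) auto
  then have "exp (- pi * r\<^sup>2) * (1 + r) ^ (?n + 1) \<le> exp (- pi * r\<^sup>2) * (fact (?n + 1) * exp (1 + r))"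
    by (intro mult_left_mono) auto
  also have "\<dots> = fact (?n + 1) * exp (1 + r - pi * r\<^sup>2)"
    by (simp add: exp_add exp_diff exp_minus field_simps)
  also have "\<dots> \<le> fact (?n + 1) * exp 2"
  proof -
    have "1 * r\<^sup>2 \<le> pi * r\<^sup>2"
      using pi_gt3 by (intro mult_right_mono) auto
    moreover have "0 \<le> (r - 1)\<^sup>2 + r\<^sup>2" by simp
    then have "r \<le> 1 + r\<^sup>2" by (simp add: power2_eq_square algebra_simps)
    ultimately show ?thesis by simp
  qed
  finally have main: "exp (- pi * r\<^sup>2) * (1 + r) ^ (?n + 1) \<le> fact (?n + 1) * exp 2" .
  have key: "exp (- pi * r\<^sup>2) * (1 + 2 * pi * r) \<le> C * (1 / (1 + r)) ^ ?n"
  proof -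
    have "exp (- pi * r\<^sup>2) * (1 + 2 * pi * r) \<le> exp (- pi * r\<^sup>2) * (2 * pi * (1 + r))"
      using r pi_gt3 by (intro mult_left_mono) (auto simp: algebra_simps)
    also have "\<dots> = 2 * pi * (exp (- pi * r\<^sup>2) * (1 + r) ^ (?n + 1)) * (1 / (1 + r)) ^ ?n"
      using r by (simp add: power_divide)
    also have "\<dots> \<le> 2 * pi * (fact (?n + 1) * exp 2) * (1 / (1 + r)) ^ ?n"
      using r pi_gt3 by (intro mult_right_mono mult_left_mono main) auto
    finally show ?thesis
      by (simp add: C_def mult_ac numeral_3_eq_3)
  qed
  have g: "gauss_kernel t w = (1 / t) ^ DIM('c) * exp (- pi * r\<^sup>2)"
    by (simp add: gauss_kernel_def r_def)
  have "exp (- pi * r\<^sup>2) \<le> C * (1 / (1 + r)) ^ ?n"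
  proof -
    have "exp (- pi * r\<^sup>2) * 1 \<le> exp (- pi * r\<^sup>2) * (1 + 2 * pi * r)"
      using r pi_gt3 by (intro mult_left_mono) auto
    then show ?thesis
      using key by linarith
  qed
  then have "(1 / t) ^ DIM('c) * exp (- pi * r\<^sup>2) \<le> (1 / t) ^ DIM('c) * (C * (1 / (1 + r)) ^ ?n)"
    using t by (intro mult_left_mono) auto
  then show "gauss_kernel t w \<le> C * gauss_majorant t w"
    unfolding g gauss_majorant_def r_def[symmetric] by (simp add: mult_ac)
  have "exp (- pi * r\<^sup>2) * (2 * pi * r) \<le> C * (1 / (1 + r)) ^ ?n"
  proof -
    have "exp (- pi * r\<^sup>2) * (2 * pi * r) \<le> exp (- pi * r\<^sup>2) * (1 + 2 * pi * r)"
      by (intro mult_left_mono) auto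
    then show ?thesis
      using key by linarith
  qed
  then have "(1 / t) ^ DIM('c) / t * (exp (- pi * r\<^sup>2) * (2 * pi * r)) \<le> (1 / t) ^ DIM('c) / t * (C * (1 / (1 + r)) ^ ?n)"
    using t by (intro mult_left_mono) auto
  moreover have "gauss_kernel t w * (2 * pi * norm w / t\<^sup>2) = (1 / t) ^ DIM('c) / t * (exp (- pi * r\<^sup>2) * (2 * pi * r))"
    unfolding g using t by (simp add: r_def power2_eq_square)
  ultimately show "gauss_kernel t w * (2 * pi * norm w / t\<^sup>2) \<le> C / t * gauss_majorant t w"
    unfolding gauss_majorant_def r_def[symmetric] by (simp add: mult_ac)
qed

lemma gauss_majorant_le: "0 < t \<Longrightarrow> gauss_majorant t (w::'c::euclidean_space) \<le> (1 / t) ^ DIM('c)"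
  unfolding gauss_majorant_def by (intro mult_left_le power_le_one) (auto simp: divide_le_eq add_pos_nonneg)

lemma gauss_kernel_nonneg: "0 < t \<Longrightarrow> 0 \<le> gauss_kernel t w"
  by (simp add: gauss_kernel_def)

text \<open>Partial derivative in \<open>y\<close>, not in \<open>x\<close>, of the Gaussian centred
  at \<open>x\<close>, hence the positive sign.\<close>

definition gauss_grad :: "real \<Rightarrow> 'c::euclidean_space \<Rightarrow> 'c \<Rightarrow> 'c \<Rightarrow> real" where
  "gauss_grad t x i y = gauss_kernel t (x - y) * (2 * pi * ((x - y) \<bullet> i) / t\<^sup>2)"

lemma measurable_gauss_kernel [measurable]: "gauss_kernel t \<in> borel_measurable borel"
  unfolding gauss_kernel_def[abs_def] by measurable

lemma measurable_gauss_grad [measurable]: "gauss_grad t x i \<in> borel_measurable borel"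
  unfolding gauss_grad_def[abs_def] by measurable

lemma abs_gauss_grad_le:
  fixes x y :: "'c::euclidean_space"
  assumes t: "0 < t" and i: "i \<in> Basis"
  shows "\<bar>gauss_grad t x i y\<bar> \<le> 2 * pi * fact (2 * DIM('c) + 3) * exp 2 / t * gauss_majorant t (x - y)"
proof -
  have "\<bar>gauss_grad t x i y\<bar> = gauss_kernel t (x - y) * (2 * pi * \<bar>(x - y) \<bullet> i\<bar> / t\<^sup>2)"
    using gauss_kernel_nonneg[OF t, of "x - y"] by (simp add: gauss_grad_def abs_mult)
  also have "\<dots> \<le> gauss_kernel t (x - y) * (2 * pi * norm (x - y) / t\<^sup>2)"
    using gauss_kernel_nonneg[OF t, of "x - y"] Basis_le_norm[OF i, of "x - y"]
    by (intro mult_left_mono divide_right_mono) auto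
  also note gauss_kernel_bounds(2)[OF t, of "x - y"]
  finally show ?thesis .
qed

lemma integrable_bounded_mult_powr:
  fixes c f :: "'c::euclidean_space \<Rightarrow> real"
  assumes [measurable]: "c \<in> borel_measurable borel" "f \<in> borel_measurable borel"
    and c: "\<And>y. \<bar>c y\<bar> \<le> M" and f: "integrable lborel (\<lambda>y. \<bar>f y\<bar> powr r)" and r: "0 < r"
  shows "integrable lborel (\<lambda>y. \<bar>c y * f y\<bar> powr r)"
proof (rule Bochner_Integration.integrable_bound[where f="\<lambda>y. M powr r * \<bar>f y\<bar> powr r"])
  show "AE y in lborel. norm (\<bar>c y * f y\<bar> powr r) \<le> norm (M powr r * \<bar>f y\<bar> powr r)"
    using c r by (intro AE_I2) (auto simp: abs_mult powr_mult intro!: mult_right_mono powr_mono2)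
qed (use f in \<open>simp_all\<close>)

section \<open>Exchange of derivatives for a div-curl pair\<close>

locale div_curl_pair =
  fixes p q :: real and F G :: "'c::euclidean_space \<Rightarrow> 'c"
  assumes pq: "1 < p" "1 < q" "1 / p + 1 / q = 1"
    and F_meas [measurable]: "F \<in> borel_measurable borel" and G_meas [measurable]: "G \<in> borel_measurable borel"
    and F_Lp: "integrable lborel (\<lambda>y. norm (F y) powr p)" and G_Lq: "integrable lborel (\<lambda>y. norm (G y) powr q)"
    and div: "div_free F" and curl: "curl_free G"
begin

lemma F_component: "i \<in> Basis \<Longrightarrow> integrable lborel (\<lambda>y. \<bar>F y \<bullet> i\<bar> powr p)"
  by (rule Bochner_Integration.integrable_bound[OF F_Lp])
    (use pq Basis_le_norm in \<open>auto intro!: AE_I2 powr_mono2\<close>)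

lemma G_component: "i \<in> Basis \<Longrightarrow> integrable lborel (\<lambda>y. \<bar>G y \<bullet> i\<bar> powr q)"
  by (rule Bochner_Integration.integrable_bound[OF G_Lq])
    (use pq Basis_le_norm in \<open>auto intro!: AE_I2 powr_mono2\<close>)

text \<open>The curl condition tested with the j-th component of (y - z)
  \<open>mollifier s (y - z)\<close> as a function of z; the sign from differentiating in z is the
  same on both sides. Summing the left over j gives the divergence, while the right is a derivative
  in the single direction \<open>i\<close> that is paired with component \<open>i\<close> of
  \<open>F\<close>.\<close>

lemma curl_step:
  assumes s: "0 < s" and i: "i \<in> Basis" and j: "j \<in> Basis"
  shows "(\<integral>z. (G z \<bullet> i) * mollifier_grad s j j (y - z) \<partial>lborel) = (\<integral>z. (G z \<bullet> j) * mollifier_grad s j i (y - z) \<partial>lborel)"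
proof -
  have d: "dpart k (\<lambda>z. ((y - z) \<bullet> j) * mollifier s (y - z)) z = - mollifier_grad s j k (y - z)" for k z
  proof (rule trans[OF dpart_eq])
    have "((\<lambda>z. y - z) has_derivative (\<lambda>h. - h)) (at z)"
      by (auto intro!: derivative_eq_intros)
    from has_derivative_compose[OF this has_derivative_coordinate_mollifier[OF s]]
    show "((\<lambda>z. ((y - z) \<bullet> j) * mollifier s (y - z)) has_derivative (\<lambda>h. mollifier_grad s j (- h) (y - z))) (at z)" .
    show "mollifier_grad s j (- k) (y - z) = - mollifier_grad s j k (y - z)"
      by (simp add: mollifier_grad_def)
  qed
  have "(\<integral>z. (G z \<bullet> i) * dpart j (\<lambda>z. ((y - z) \<bullet> j) * mollifier s (y - z)) z \<partial>lborel)
     = (\<integral>z. (G z \<bullet> j) * dpart i (\<lambda>z. ((y - z) \<bullet> j) * mollifier s (y - z)) z \<partial>lborel)"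
    using curl test_fun_coordinate_mollifier[OF s, of y j] i j unfolding curl_free_def by blast
  then show ?thesis
    unfolding d by simp
qed

text \<open>The divergence condition tested in y with the Gaussian times the j-th component of (y -
  z) \<open>mollifier s (y - z)\<close>. The product rule gives two terms: one differentiates the
  mollifier, the other only the Gaussian.\<close>

lemma div_step:
  assumes s: "0 < s"
  shows "(\<integral>y. (\<Sum>i\<in>Basis. (F y \<bullet> i) * (gauss_kernel t (x - y) * mollifier_grad s j i (y - z)
      + gauss_grad t x i y * (((y - z) \<bullet> j) * mollifier s (y - z)))) \<partial>lborel) = 0"
proof -
  have "dpart i (\<lambda>y. gauss_kernel t (x - y) * (((y - z) \<bullet> j) * mollifier s (y - z))) y
    = gauss_kernel t (x - y) * mollifier_grad s j i (y - z)
      + gauss_grad t x i y * (((y - z) \<bullet> j) * mollifier s (y - z))" for i y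
  proof (rule trans[OF dpart_eq])
    have "((\<lambda>y. y - z) has_derivative (\<lambda>h. h)) (at y)"
      by (auto intro!: derivative_eq_intros)
    from has_derivative_mult[OF has_derivative_gauss_kernel_shift
        has_derivative_compose[OF this has_derivative_coordinate_mollifier[OF s]]]
    show "((\<lambda>y. gauss_kernel t (x - y) * (((y - z) \<bullet> j) * mollifier s (y - z))) has_derivative
      (\<lambda>h. gauss_kernel t (x - y) * mollifier_grad s j h (y - z)
        + gauss_kernel t (x - y) * (2 * pi * ((x - y) \<bullet> h) / t\<^sup>2) * (((y - z) \<bullet> j) * mollifier s (y - z)))) (at y)" .
  qed (simp add: gauss_grad_def)
  moreover have "(\<integral>y. (\<Sum>i\<in>Basis. (F y \<bullet> i) * dpart i (\<lambda>y. gauss_kernel t (x - y) * (((y - z) \<bullet> j) * mollifier s (y - z))) y) \<partial>lborel) = 0"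
    using div test_fun_gauss_mollifier[OF s, of t x z j] unfolding div_free_def by blast
  ultimately show ?thesis
    by simp
qed

lemma gauss_F_component:
  assumes t: "0 < t" and i: "i \<in> Basis"
  shows "integrable lborel (\<lambda>y. \<bar>gauss_kernel t (x - y) * (F y \<bullet> i)\<bar> powr p)"
    and "integrable lborel (\<lambda>y. \<bar>gauss_grad t x i y * (F y \<bullet> i)\<bar> powr p)"
proof -
  show "integrable lborel (\<lambda>y. \<bar>gauss_kernel t (x - y) * (F y \<bullet> i)\<bar> powr p)"
  proof (rule integrable_bounded_mult_powr[OF _ _ _ F_component[OF i]])
    show "\<bar>gauss_kernel t (x - y)\<bar> \<le> (1 / t) ^ DIM('c)" for y
      using t by (simp add: gauss_kernel_def divide_le_eq mult_left_le)
  qed (use pq in auto)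
  show "integrable lborel (\<lambda>y. \<bar>gauss_grad t x i y * (F y \<bullet> i)\<bar> powr p)"
  proof (rule integrable_bounded_mult_powr[OF _ _ _ F_component[OF i]])
    show "\<bar>gauss_grad t x i y\<bar> \<le> 2 * pi * fact (2 * DIM('c) + 3) * exp 2 / t * (1 / t) ^ DIM('c)" for y
      by (rule order_trans[OF abs_gauss_grad_le[OF t i]], intro mult_left_mono gauss_majorant_le) (use t in auto)
  qed (use pq in auto)
qed

lemma integrable_kernel_forms:
  assumes t: "0 < t" and s: "0 < s" and i: "i \<in> Basis" and j: "j \<in> Basis" and k: "k \<in> Basis" and l: "l \<in> Basis"
  shows "integrable (lborel \<Otimes>\<^sub>M lborel) (\<lambda>w. gauss_kernel t (x - fst w) * (F (fst w) \<bullet> i) * (G (snd w) \<bullet> j) * mollifier_grad s k l (fst w - snd w))"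
    and "integrable (lborel \<Otimes>\<^sub>M lborel) (\<lambda>w. gauss_grad t x i (fst w) * (F (fst w) \<bullet> i) * (G (snd w) \<bullet> j) * (((fst w - snd w) \<bullet> k) * mollifier s (fst w - snd w)))"
proof -
  show "integrable (lborel \<Otimes>\<^sub>M lborel) (\<lambda>w. gauss_kernel t (x - fst w) * (F (fst w) \<bullet> i) * (G (snd w) \<bullet> j) * mollifier_grad s k l (fst w - snd w))"
  proof (rule integrable_near_diagonal[OF pq _ _ _ gauss_F_component(1)[OF t i] G_component[OF j], where C="5 * (1 / s) ^ DIM('c)" and s=s])
    show "\<bar>mollifier_grad s k l (fst (y, z) - snd (y, z))\<bar> \<le> 5 * (1 / s) ^ DIM('c) * indicator (ball 0 s) (y - z)" for y z
      using abs_mollifier_grad_le[OF s k l, of "y - z"] by simp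
  qed measurable
  show "integrable (lborel \<Otimes>\<^sub>M lborel) (\<lambda>w. gauss_grad t x i (fst w) * (F (fst w) \<bullet> i) * (G (snd w) \<bullet> j) * (((fst w - snd w) \<bullet> k) * mollifier s (fst w - snd w)))"
  proof (rule integrable_near_diagonal[OF pq _ _ _ gauss_F_component(2)[OF t i] G_component[OF j], where C="s * (1 / s) ^ DIM('c)" and s=s])
    fix y z :: 'c
    have "\<bar>(y - z) \<bullet> k\<bar> \<le> s" if "norm (y - z) < s"
      using Basis_le_norm[OF k, of "y - z"] that by linarith
    then have "\<bar>((y - z) \<bullet> k) * mollifier s (y - z)\<bar> \<le> s * ((1 / s) ^ DIM('c) * indicator (ball 0 s) (y - z))"
      unfolding abs_mult using s mollifier_le[OF s, of "y - z"] mollifier_nonneg[OF s, of "y - z"] mollifier_eq_0[OF s, of "y - z"]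
      by (cases "norm (y - z) < s") (auto intro!: mult_mono)
    then show "\<bar>((fst (y, z) - snd (y, z)) \<bullet> k) * mollifier s (fst (y, z) - snd (y, z))\<bar>
       \<le> s * (1 / s) ^ DIM('c) * indicator (ball 0 s) (y - z)"
      by (simp add: mult.assoc)
  qed measurable
qed

lemma DERIV_mollifier_form:
  assumes t: "0 < t" and s: "0 < s" and i: "i \<in> Basis"
  shows "((\<lambda>s. mollifier_form s (\<lambda>y. gauss_kernel t (x - y) * (F y \<bullet> i)) (\<lambda>z. G z \<bullet> i)) has_real_derivative
    - (\<Sum>j\<in>Basis. \<integral>w. gauss_kernel t (x - fst w) * (F (fst w) \<bullet> i) * (G (snd w) \<bullet> i)
        * mollifier_grad s j j (fst w - snd w) \<partial>(lborel \<Otimes>\<^sub>M lborel)) / s) (at s)"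
proof -
  let ?u = "\<lambda>y. gauss_kernel t (x - y) * (F y \<bullet> i)" and ?v = "\<lambda>z. G z \<bullet> i"
  \<comment> \<open>For r between s/2 and 2 s one has 1/r \<le> 2/s. \<open>B\<close> collects the N
    diagonal terms, each at most 5 (1/r)^N, and the factor 1/r.\<close>
  define B where "B = DIM('c) * 5 * (2 / s) ^ DIM('c) * (2 / s)"
  have "((\<lambda>s. mollifier_form s ?u ?v) has_real_derivative
     (\<integral>w. ?u (fst w) * ?v (snd w) * (- (\<Sum>j\<in>Basis. mollifier_grad s j j (fst w - snd w)) / s) \<partial>(lborel \<Otimes>\<^sub>M lborel))) (at s)"
  proof (rule DERIV_integral_dominated[where a="s / 2" and b="2 * s"
        and w="\<lambda>w. \<bar>?u (fst w) * ?v (snd w) * (B * indicator (ball 0 (2 * s)) (fst w - snd w))\<bar>"])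
    fix r assume r: "r \<in> {s / 2<..<2 * s}"
    then have r0: "r > 0" using s by auto
    show "integrable (lborel \<Otimes>\<^sub>M lborel) (\<lambda>w. ?u (fst w) * ?v (snd w) * mollifier r (fst w - snd w))"
      by (rule integrable_mollifier_form[OF pq _ gauss_F_component(1)[OF t i] r0 _ G_component[OF i]]) measurable
    show "((\<lambda>r. ?u (fst w) * ?v (snd w) * mollifier r (fst w - snd w)) has_real_derivative
       ?u (fst w) * ?v (snd w) * (- (\<Sum>j\<in>Basis. mollifier_grad r j j (fst w - snd w)) / r)) (at r)" for w
      by (intro DERIV_cmult DERIV_mollifier_scale r0)
    show "\<bar>?u (fst w) * ?v (snd w) * (- (\<Sum>j\<in>Basis. mollifier_grad r j j (fst w - snd w)) / r)\<bar>
       \<le> \<bar>?u (fst w) * ?v (snd w) * (B * indicator (ball 0 (2 * s)) (fst w - snd w))\<bar>" for w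
    proof -
      let ?d = "fst w - snd w"
      have i1: "1 / r \<le> 2 / s"
        using r s by (auto simp: field_simps)
      have "\<bar>\<Sum>j\<in>Basis. mollifier_grad r j j ?d\<bar> \<le> (\<Sum>j\<in>(Basis::'c set). 5 * (1 / r) ^ DIM('c) * indicator (ball 0 r) ?d)"
        by (intro sum_abs[THEN order_trans] sum_mono abs_mollifier_grad_le r0)
      also have "\<dots> \<le> DIM('c) * (5 * (2 / s) ^ DIM('c) * indicator (ball 0 (2 * s)) ?d)"
        using r r0 i1 by (auto simp: indicator_def intro!: power_mono)
      finally have "\<bar>\<Sum>j\<in>Basis. mollifier_grad r j j ?d\<bar> * (1 / r) \<le> DIM('c) * (5 * (2 / s) ^ DIM('c) * indicator (ball 0 (2 * s)) ?d) * (2 / s)"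
        using i1 r0 by (intro mult_mono) auto
      also have "\<dots> = \<bar>B * indicator (ball 0 (2 * s)) ?d\<bar>"
        using s by (simp add: B_def)
      finally have "\<bar>- (\<Sum>j\<in>Basis. mollifier_grad r j j ?d) / r\<bar> \<le> \<bar>B * indicator (ball 0 (2 * s)) ?d\<bar>"
        using r0 by simp
      then show ?thesis
        unfolding abs_mult[of "?u (fst w) * ?v (snd w)"] by (intro mult_left_mono) auto
    qed
  next
    have [measurable]: "ball (0::'c) (2 * s) \<in> sets borel" by simp
    have "integrable (lborel \<Otimes>\<^sub>M lborel) (\<lambda>w. ?u (fst w) * ?v (snd w) * (B * indicator (ball 0 (2 * s)) (fst w - snd w)))"
      by (rule integrable_near_diagonal[OF pq _ _ _ gauss_F_component(1)[OF t i] G_component[OF i], where C=B and s="2 * s"])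
        (use s in \<open>auto simp: B_def\<close>)
    then show "integrable (lborel \<Otimes>\<^sub>M lborel) (\<lambda>w. \<bar>?u (fst w) * ?v (snd w) * (B * indicator (ball 0 (2 * s)) (fst w - snd w))\<bar>)"
      by (rule integrable_abs)
  qed (use s in auto)
  also have "(\<integral>w. ?u (fst w) * ?v (snd w) * (- (\<Sum>j\<in>Basis. mollifier_grad s j j (fst w - snd w)) / s) \<partial>(lborel \<Otimes>\<^sub>M lborel))
    = (\<integral>w. (\<Sum>j\<in>Basis. ?u (fst w) * ?v (snd w) * mollifier_grad s j j (fst w - snd w)) * (- 1 / s) \<partial>(lborel \<Otimes>\<^sub>M lborel))"
    by (simp add: sum_distrib_left)
  also have "\<dots> = (\<Sum>j\<in>Basis. \<integral>w. ?u (fst w) * ?v (snd w) * mollifier_grad s j j (fst w - snd w) \<partial>(lborel \<Otimes>\<^sub>M lborel)) * (- 1 / s)"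
    using integrable_kernel_forms(1)[OF t s i i]
    by (subst integral_mult_left_zero, subst Bochner_Integration.integral_sum) auto
  finally show ?thesis
    by simp
qed

text \<open>Fubini with z as the inner variable: for fixed y the factors in y come out, and
  \<open>curl_step\<close> applies to what remains.\<close>

lemma curl_form:
  assumes t: "0 < t" and s: "0 < s" and i: "i \<in> Basis" and j: "j \<in> Basis"
  shows "(\<integral>w. gauss_kernel t (x - fst w) * (F (fst w) \<bullet> i) * (G (snd w) \<bullet> i) * mollifier_grad s j j (fst w - snd w) \<partial>(lborel \<Otimes>\<^sub>M lborel))
     = (\<integral>w. gauss_kernel t (x - fst w) * (F (fst w) \<bullet> i) * (G (snd w) \<bullet> j) * mollifier_grad s j i (fst w - snd w) \<partial>(lborel \<Otimes>\<^sub>M lborel))"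
proof -
  have "(\<integral>z. gauss_kernel t (x - y) * (F y \<bullet> i) * (G z \<bullet> i) * mollifier_grad s j j (y - z) \<partial>lborel)
    = (\<integral>z. gauss_kernel t (x - y) * (F y \<bullet> i) * (G z \<bullet> j) * mollifier_grad s j i (y - z) \<partial>lborel)" for y
    unfolding mult.assoc[of "gauss_kernel t (x - y) * (F y \<bullet> i)"] by (simp only: integral_mult_right_zero curl_step[OF s i j])
  then show ?thesis
    unfolding lborel_pair.integral_fst'[OF integrable_kernel_forms(1)[OF t s i i j j, of x], symmetric]
      lborel_pair.integral_fst'[OF integrable_kernel_forms(1)[OF t s i j j i, of x], symmetric]
    by (simp only: fst_conv snd_conv)
qed

text \<open>Fubini with y as the inner variable: for fixed z the sum of both families of integrands
  is a component of \<open>G z\<close> times an integral that vanishes by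
  \<open>div_step\<close>.\<close>

lemma div_form:
  assumes t: "0 < t" and s: "0 < s" and j: "j \<in> Basis"
  shows "(\<Sum>i\<in>Basis. \<integral>w. gauss_kernel t (x - fst w) * (F (fst w) \<bullet> i) * (G (snd w) \<bullet> j) * mollifier_grad s j i (fst w - snd w) \<partial>(lborel \<Otimes>\<^sub>M lborel))
    = - (\<Sum>i\<in>Basis. \<integral>w. gauss_grad t x i (fst w) * (F (fst w) \<bullet> i) * (G (snd w) \<bullet> j) * (((fst w - snd w) \<bullet> j) * mollifier s (fst w - snd w)) \<partial>(lborel \<Otimes>\<^sub>M lborel))"
proof -
  let ?A = "\<lambda>i w. gauss_kernel t (x - fst w) * (F (fst w) \<bullet> i) * (G (snd w) \<bullet> j) * mollifier_grad s j i (fst w - snd w)"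
  let ?B = "\<lambda>i w. gauss_grad t x i (fst w) * (F (fst w) \<bullet> i) * (G (snd w) \<bullet> j) * (((fst w - snd w) \<bullet> j) * mollifier s (fst w - snd w))"
  have intA: "integrable (lborel \<Otimes>\<^sub>M lborel) (?A i)" and intB: "integrable (lborel \<Otimes>\<^sub>M lborel) (?B i)" if "i \<in> Basis" for i
    using integrable_kernel_forms[OF t s that j j] that j by auto
  have int: "integrable (lborel \<Otimes>\<^sub>M lborel) (\<lambda>w. \<Sum>i\<in>Basis. ?A i w + ?B i w)"
    by (intro Bochner_Integration.integrable_sum Bochner_Integration.integrable_add intA intB)
  have "(\<Sum>i\<in>Basis. integral\<^sup>L (lborel \<Otimes>\<^sub>M lborel) (?A i)) + (\<Sum>i\<in>Basis. integral\<^sup>L (lborel \<Otimes>\<^sub>M lborel) (?B i))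
     = (\<Sum>i\<in>Basis. \<integral>w. ?A i w + ?B i w \<partial>(lborel \<Otimes>\<^sub>M lborel))"
    unfolding sum.distrib[symmetric] using intA intB by (intro sum.cong refl Bochner_Integration.integral_add[symmetric])
  also have "\<dots> = (\<integral>w. (\<Sum>i\<in>Basis. ?A i w + ?B i w) \<partial>(lborel \<Otimes>\<^sub>M lborel))"
    using intA intB by (intro Bochner_Integration.integral_sum[symmetric] Bochner_Integration.integrable_add)
  also have "\<dots> = (\<integral>z. \<integral>y. (\<Sum>i\<in>Basis. ?A i (y, z) + ?B i (y, z)) \<partial>lborel \<partial>lborel)"
    using lborel_pair.integral_snd[of "\<lambda>y z. \<Sum>i\<in>Basis. ?A i (y, z) + ?B i (y, z)"] int by (simp add: split_beta')
  also have "\<dots> = (\<integral>z. (G z \<bullet> j) * (\<integral>y. (\<Sum>i\<in>Basis. (F y \<bullet> i) * (gauss_kernel t (x - y) * mollifier_grad s j i (y - z)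
      + gauss_grad t x i y * (((y - z) \<bullet> j) * mollifier s (y - z)))) \<partial>lborel) \<partial>lborel)"
    unfolding integral_mult_right_zero[symmetric] sum_distrib_left
    by (intro Bochner_Integration.integral_cong sum.cong refl) (simp add: algebra_simps)
  also have "\<dots> = 0"
    by (simp add: div_step[OF s])
  finally show ?thesis
    by linarith
qed

text \<open>No derivative of the mollifier is left. Its argument has a component of size at most s
  on the support, which cancels the division by s, so the derivative is not singular like
  1/s.\<close>

theorem DERIV_form:
  assumes t: "0 < t" and s: "0 < s"
  shows "((\<lambda>s. \<Sum>i\<in>Basis. mollifier_form s (\<lambda>y. gauss_kernel t (x - y) * (F y \<bullet> i)) (\<lambda>z. G z \<bullet> i)) has_real_derivative
    (\<Sum>j\<in>Basis. \<Sum>i\<in>Basis. \<integral>w. gauss_grad t x i (fst w) * (F (fst w) \<bullet> i) * (G (snd w) \<bullet> j)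
        * (((fst w - snd w) \<bullet> j) * mollifier s (fst w - snd w)) \<partial>(lborel \<Otimes>\<^sub>M lborel)) / s) (at s)"
proof -
  let ?A = "\<lambda>i j. \<integral>w. gauss_kernel t (x - fst w) * (F (fst w) \<bullet> i) * (G (snd w) \<bullet> j) * mollifier_grad s j i (fst w - snd w) \<partial>(lborel \<Otimes>\<^sub>M lborel)"
  let ?B = "\<lambda>i j. \<integral>w. gauss_grad t x i (fst w) * (F (fst w) \<bullet> i) * (G (snd w) \<bullet> j) * (((fst w - snd w) \<bullet> j) * mollifier s (fst w - snd w)) \<partial>(lborel \<Otimes>\<^sub>M lborel)"
  have "((\<lambda>s. \<Sum>i\<in>Basis. mollifier_form s (\<lambda>y. gauss_kernel t (x - y) * (F y \<bullet> i)) (\<lambda>z. G z \<bullet> i)) has_real_derivative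
    (\<Sum>i\<in>Basis. - (\<Sum>j\<in>Basis. ?A i j) / s)) (at s)"
  proof (rule DERIV_sum)
    fix i :: 'c assume i: "i \<in> Basis"
    show "((\<lambda>s. mollifier_form s (\<lambda>y. gauss_kernel t (x - y) * (F y \<bullet> i)) (\<lambda>z. G z \<bullet> i)) has_real_derivative
      - (\<Sum>j\<in>Basis. ?A i j) / s) (at s)"
      using DERIV_mollifier_form[OF t s i, of x] by (simp add: curl_form[OF t s i] cong: sum.cong)
  qed
  also have "(\<Sum>i\<in>Basis. - (\<Sum>j\<in>Basis. ?A i j) / s) = - (\<Sum>j\<in>Basis. \<Sum>i\<in>Basis. ?A i j) / s"
    by (subst sum.swap) (simp add: sum_negf sum_divide_distrib)
  also have "\<dots> = (\<Sum>j\<in>Basis. \<Sum>i\<in>Basis. ?B i j) / s"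
    by (simp add: div_form[OF t s] sum_negf cong: sum.cong)
  finally show ?thesis .
qed

end

section \<open>The pointwise maximal estimate\<close>

text \<open>The left side is a weighted geometric mean of the three summands on the right, with weights
  \<open>\<theta>\<close>, \<open>1 - 1 / \<beta>\<close> and \<open>1 - 1 / \<alpha>\<close>; the parameter \<open>X\<close> balances their integrals.\<close>

lemma mult_le_interpolated_sum:
  fixes a b \<alpha> \<beta> X :: real
  assumes \<alpha>: "1 \<le> \<alpha>" and \<beta>: "1 \<le> \<beta>" and \<theta>: "\<theta> = 1 / \<alpha> + 1 / \<beta> - 1" "0 \<le> \<theta>"
    and ab: "0 \<le> a" "0 \<le> b" and X: "0 < X"
  shows "a * b \<le> X powr (\<theta> - 1) * (a powr \<alpha> * b powr \<beta>) + X powr \<theta> * a powr \<alpha> + X powr \<theta> * b powr \<beta>"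
proof (cases "a = 0 \<or> b = 0")
  case False
  define u where "u = X powr (\<theta> - 1) * (a powr \<alpha> * b powr \<beta>)"
  define v where "v = X powr \<theta> * a powr \<alpha>"
  define w where "w = X powr \<theta> * b powr \<beta>"
  have pos: "a > 0" "b > 0" "u > 0" "v > 0" "w > 0"
    using False ab X by (auto simp: u_def v_def w_def)
  define m where "m = max u (max v w)"
  have m: "m > 0" "u \<le> m" "v \<le> m" "w \<le> m" "m \<le> u + v + w"
    using pos by (auto simp: m_def)
  have ln_eqs: "ln u = (\<theta> - 1) * ln X + \<alpha> * ln a + \<beta> * ln b"
     "ln v = \<theta> * ln X + \<alpha> * ln a" "ln w = \<theta> * ln X + \<beta> * ln b"
    using pos X by (simp_all add: u_def v_def w_def ln_mult ln_powr)
  have inv: "\<alpha> * (1 / \<alpha>) = 1" "\<beta> * (1 / \<beta>) = 1" "1 / \<alpha> \<le> 1" "1 / \<beta> \<le> 1"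
    using \<alpha> \<beta> by auto
  define c where "c = 1 / \<alpha>"
  define d where "d = 1 / \<beta>"
  have \<theta>': "\<theta> = c + d - 1" and cd: "\<alpha> * c = 1" "\<beta> * d = 1" "c \<le> 1" "d \<le> 1"
    using inv \<theta> by (auto simp: c_def d_def)
  have "\<theta> * ln u + (1 - d) * ln v + (1 - c) * ln w
    = (\<theta> * (\<theta> - 1) + (1 - d) * \<theta> + (1 - c) * \<theta>) * ln X + (\<theta> + (1 - d)) * \<alpha> * ln a + (\<theta> + (1 - c)) * \<beta> * ln b"
    unfolding ln_eqs by (simp add: algebra_simps)
  also have "\<theta> * (\<theta> - 1) + (1 - d) * \<theta> + (1 - c) * \<theta> = 0"
    unfolding \<theta>' by (simp add: algebra_simps)
  also have "(\<theta> + (1 - d)) * \<alpha> = 1"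
    unfolding \<theta>' using cd by (simp add: mult.commute)
  also have "(\<theta> + (1 - c)) * \<beta> = 1"
    unfolding \<theta>' using cd by (simp add: mult.commute)
  finally have "ln a + ln b = \<theta> * ln u + (1 - d) * ln v + (1 - c) * ln w"
    by simp
  also have "\<dots> \<le> \<theta> * ln m + (1 - d) * ln m + (1 - c) * ln m"
    using m pos cd \<theta>(2) by (intro add_mono mult_left_mono) auto
  also have "\<dots> = (\<theta> + (1 - d) + (1 - c)) * ln m"
    by (simp add: algebra_simps)
  also have "\<dots> = ln m"
    unfolding \<theta>' by simp
  finally have "ln (a * b) \<le> ln m"
    using pos by (simp add: ln_mult)
  then have "a * b \<le> m"
    using pos m by simp
  then show ?thesis
    using m unfolding u_def v_def w_def by linarith
qed (use ab in auto)

lemma decay_kernel_nonneg: "0 < t \<Longrightarrow> 0 \<le> decay_kernel t w"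
  by (simp add: decay_kernel_def)

lemma decay_kernel_le: "0 < t \<Longrightarrow> t ^ DIM('c) * decay_kernel t (w::'c::euclidean_space) \<le> 1"
  unfolding decay_kernel_def
  by (simp add: power_divide divide_le_eq add_pos_nonneg flip: power_Suc)

lemma measurable_decay_kernel [measurable]: "decay_kernel t \<in> borel_measurable borel"
  unfolding decay_kernel_def[abs_def] by measurable

lemma measurable_gauss_majorant [measurable]: "gauss_majorant t \<in> borel_measurable borel"
  unfolding gauss_majorant_def[abs_def] by measurable

lemma gauss_majorant_nonneg: "0 < t \<Longrightarrow> 0 \<le> gauss_majorant t w"
  by (simp add: gauss_majorant_def)

text \<open>For |y - z| \<le> t the quantities 1 + |x - y| / t and 1 + |x - z| / t differ by at most
  a factor 2. Half of the decay is moved from y to z at the price 2^(N+1).\<close>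

lemma gauss_majorant_le_decay_kernels:
  fixes x y z :: "'c::euclidean_space"
  assumes t: "0 < t" and yz: "norm (y - z) \<le> t"
  shows "gauss_majorant t (x - y) \<le> 2 ^ (DIM('c) + 1) * (t ^ DIM('c) * decay_kernel t (x - y) * decay_kernel t (x - z))"
proof -
  have "norm (x - z) \<le> norm (x - y) + norm (y - z)"
    using norm_triangle_ineq[of "x - y" "y - z"] by simp
  then have "norm (x - z) / t \<le> norm (x - y) / t + 1"
    using t yz by (simp add: field_simps)
  then have "1 + norm (x - z) / t \<le> 2 * (1 + norm (x - y) / t)"
    using divide_nonneg_pos[OF norm_ge_zero t, of "x - y"] unfolding distrib_left by linarith
  moreover have pos: "0 < 1 + norm (x - z) / t" "0 < 1 + norm (x - y) / t"
    using t by (auto intro: add_pos_nonneg)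
  ultimately have "1 / (1 + norm (x - y) / t) \<le> 2 * (1 / (1 + norm (x - z) / t))"
    by (simp add: field_simps)
  then have "(1 / (1 + norm (x - y) / t)) ^ (DIM('c) + 1) \<le> (2 * (1 / (1 + norm (x - z) / t))) ^ (DIM('c) + 1)"
    using pos by (intro power_mono) auto
  then have *: "(1 / (1 + norm (x - y) / t)) ^ (DIM('c) + 1) \<le> 2 ^ (DIM('c) + 1) * (1 / (1 + norm (x - z) / t)) ^ (DIM('c) + 1)"
    by (simp only: power_mult_distrib)
  have tt: "t ^ DIM('c) * (1 / t) ^ DIM('c) = 1"
    using t by (simp flip: power_mult_distrib)
  have "gauss_majorant t (x - y) = ((1 / t) ^ DIM('c) * (1 / (1 + norm (x - y) / t)) ^ (DIM('c) + 1)) * (1 / (1 + norm (x - y) / t)) ^ (DIM('c) + 1)"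
    unfolding gauss_majorant_def mult.assoc power_add[symmetric] by (simp add: mult_2)
  also have "\<dots> \<le> ((1 / t) ^ DIM('c) * (1 / (1 + norm (x - y) / t)) ^ (DIM('c) + 1)) * (2 ^ (DIM('c) + 1) * (1 / (1 + norm (x - z) / t)) ^ (DIM('c) + 1))"
    using t pos by (intro mult_left_mono *) auto
  also have "\<dots> = 2 ^ (DIM('c) + 1) * ((t ^ DIM('c) * (1 / t) ^ DIM('c)) * decay_kernel t (x - y) * (1 / (1 + norm (x - z) / t)) ^ (DIM('c) + 1))"
    unfolding tt decay_kernel_def by (simp only: mult_ac mult_1)
  also have "\<dots> = 2 ^ (DIM('c) + 1) * (t ^ DIM('c) * decay_kernel t (x - y) * decay_kernel t (x - z))"
    unfolding decay_kernel_def[of t "x - z"] by (simp only: mult_ac)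
  finally show ?thesis .
qed

text \<open>After dividing \<open>f\<close> by \<open>A\<close> and \<open>g\<close> by
  \<open>B\<close>, both weighted averages are at most 1. The interpolation inequality with X =
  (t/s)^N then yields three terms of the same size X^\<theta>: one is a product of averages, the
  other two are an average times the mollifier mass. This is the origin of 1 + 2 c0.\<close>

lemma kernel_bilinear_estimate:
  fixes f g :: "'c::euclidean_space \<Rightarrow> real"
  assumes \<alpha>: "1 \<le> \<alpha>" and \<beta>: "1 \<le> \<beta>" and \<theta>: "\<theta> = 1 / \<alpha> + 1 / \<beta> - 1" "0 \<le> \<theta>"
    and [measurable]: "f \<in> borel_measurable borel" "g \<in> borel_measurable borel"
    and nonneg: "\<And>y. 0 \<le> f y" "\<And>y. 0 \<le> g y"
    and st: "0 < s" "s \<le> t" and AB: "0 < A" "0 < B"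
    and hA: "(\<integral>\<^sup>+y. ennreal (decay_kernel t (x - y)) * ennreal (f y powr \<alpha>) \<partial>lborel) \<le> ennreal (A powr \<alpha>)"
    and hB: "(\<integral>\<^sup>+y. ennreal (decay_kernel t (x - y)) * ennreal (g y powr \<beta>) \<partial>lborel) \<le> ennreal (B powr \<beta>)"
  shows "(\<integral>\<^sup>+w. ennreal (gauss_majorant t (x - fst w) * (f (fst w) * g (snd w)) * mollifier s (fst w - snd w)) \<partial>(lborel \<Otimes>\<^sub>M lborel))
    \<le> ennreal (2 ^ (DIM('c) + 1) * (1 + 2 * (\<integral>w. mollifier 1 (w::'c) \<partial>lborel)) * (A * B) * ((t / s) ^ DIM('c)) powr \<theta>)"
proof -
  let ?N = "DIM('c)" and ?Q = "\<lambda>y. decay_kernel t (x - y)"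
  have t: "0 < t" using st by simp
  define X where "X = (t / s) ^ ?N"
  have X: "X > 0" using st t by (simp add: X_def)
  define c0 where "c0 = (\<integral>w. mollifier 1 (w::'c) \<partial>lborel)"
  have c0: "c0 > 0"
    unfolding c0_def by (rule integral_mollifier_pos)
  define K where "K = 2 ^ (?N + 1) * (A * B)"
  have K: "K > 0" using AB by (simp add: K_def)
  define a where "a y = (f y / A) powr \<alpha>" for y
  define b where "b z = (g z / B) powr \<beta>" for z
  have [measurable]: "a \<in> borel_measurable borel" "b \<in> borel_measurable borel"
    unfolding a_def b_def by measurable
  have ab0: "0 \<le> a y" "0 \<le> b y" for y
    by (auto simp: a_def b_def)
  have ha: "(\<integral>\<^sup>+y. ennreal (?Q y * a y) \<partial>lborel) \<le> 1"
  proof -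
    have "(\<integral>\<^sup>+y. ennreal (?Q y * a y) \<partial>lborel) = (\<integral>\<^sup>+y. ennreal (1 / A powr \<alpha>) * (ennreal (?Q y) * ennreal (f y powr \<alpha>)) \<partial>lborel)"
      using AB nonneg decay_kernel_nonneg[OF t, where 'a='c]
      by (intro nn_integral_cong) (simp add: a_def powr_divide flip: ennreal_mult)
    also have "\<dots> \<le> ennreal (1 / A powr \<alpha>) * ennreal (A powr \<alpha>)"
      by (subst nn_integral_cmult) (auto intro!: mult_left_mono hA)
    also have "\<dots> = 1"
      using AB by (simp flip: ennreal_mult)
    finally show ?thesis .
  qed
  have hb: "(\<integral>\<^sup>+y. ennreal (?Q y * b y) \<partial>lborel) \<le> 1"
  proof -
    have "(\<integral>\<^sup>+y. ennreal (?Q y * b y) \<partial>lborel) = (\<integral>\<^sup>+y. ennreal (1 / B powr \<beta>) * (ennreal (?Q y) * ennreal (g y powr \<beta>)) \<partial>lborel)"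
      using AB nonneg decay_kernel_nonneg[OF t, where 'a='c]
      by (intro nn_integral_cong) (simp add: b_def powr_divide flip: ennreal_mult)
    also have "\<dots> \<le> ennreal (1 / B powr \<beta>) * ennreal (B powr \<beta>)"
      by (subst nn_integral_cmult) (auto intro!: mult_left_mono hB)
    also have "\<dots> = 1"
      using AB by (simp flip: ennreal_mult)
    finally show ?thesis .
  qed
  let ?T1 = "\<lambda>w. ennreal (K * X powr \<theta>) * (ennreal (?Q (fst w) * a (fst w)) * ennreal (?Q (snd w) * b (snd w)))"
  let ?T2 = "\<lambda>w. ennreal (K * X powr \<theta>) * (ennreal (?Q (fst w) * a (fst w)) * ennreal (mollifier s (fst w - snd w)))"
  let ?T3 = "\<lambda>w. ennreal (K * X powr \<theta>) * (ennreal (?Q (snd w) * b (snd w)) * ennreal (mollifier s (fst w - snd w)))"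
  have pw: "ennreal (gauss_majorant t (x - y) * (f y * g z) * mollifier s (y - z)) \<le> ?T1 (y, z) + ?T2 (y, z) + ?T3 (y, z)" for y z
  proof (cases "norm (y - z) < s")
    case True
    let ?m = "mollifier s (y - z)"
    note m0 = mollifier_nonneg[OF st(1), of "y - z"]
    note Q0 = decay_kernel_nonneg[OF t, of "x - y"] decay_kernel_nonneg[OF t, of "x - z"]
    have m1: "?m \<le> (1 / s) ^ ?N"
      using mollifier_le[OF st(1), of "y - z"] True by simp
    have fg: "f y * g z \<le> (A * B) * (X powr (\<theta> - 1) * (a y * b z) + X powr \<theta> * a y + X powr \<theta> * b z)"
    proof -
      have "(f y / A) * (g z / B) \<le> X powr (\<theta> - 1) * (a y * b z) + X powr \<theta> * a y + X powr \<theta> * b z"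
        unfolding a_def b_def using nonneg AB by (intro mult_le_interpolated_sum \<alpha> \<beta> \<theta> X) auto
      then have "(A * B) * ((f y / A) * (g z / B)) \<le> (A * B) * (X powr (\<theta> - 1) * (a y * b z) + X powr \<theta> * a y + X powr \<theta> * b z)"
        using AB by (intro mult_left_mono) auto
      then show ?thesis
        using AB by simp
    qed
    have "gauss_majorant t (x - y) * (f y * g z)
      \<le> (2 ^ (?N + 1) * (t ^ ?N * ?Q y * ?Q z)) * ((A * B) * (X powr (\<theta> - 1) * (a y * b z) + X powr \<theta> * a y + X powr \<theta> * b z))"
      using True st t Q0 nonneg by (intro mult_mono gauss_majorant_le_decay_kernels fg) auto
    then have "gauss_majorant t (x - y) * (f y * g z) * ?m
      \<le> (2 ^ (?N + 1) * (t ^ ?N * ?Q y * ?Q z)) * ((A * B) * (X powr (\<theta> - 1) * (a y * b z) + X powr \<theta> * a y + X powr \<theta> * b z)) * ?m"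
      using m0 by (intro mult_right_mono)
    also have "\<dots> = K * X powr (\<theta> - 1) * (?Q y * a y) * (?Q z * b z) * (t ^ ?N * ?m)
        + K * X powr \<theta> * (?Q y * a y) * ?m * (t ^ ?N * ?Q z)
        + K * X powr \<theta> * (?Q z * b z) * ?m * (t ^ ?N * ?Q y)"
      unfolding K_def by (simp only: distrib_left distrib_right mult_ac)
    \<comment> \<open>In the first summand the mollifier is spent: t^N times it is at most X, which
      raises X^(\<theta>-1) to X^\<theta>. In the other two a decay kernel is spent against t^N, and
      the mollifier is kept to be integrated.\<close>
    also have "\<dots> \<le> K * X powr (\<theta> - 1) * (?Q y * a y) * (?Q z * b z) * X
        + K * X powr \<theta> * (?Q y * a y) * ?m * 1
        + K * X powr \<theta> * (?Q z * b z) * ?m * 1"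
    proof (intro add_mono mult_left_mono)
      show "t ^ ?N * ?m \<le> X"
        using mult_left_mono[OF m1, of "t ^ ?N"] t by (simp add: X_def power_divide)
    qed (use K X Q0 ab0 m0 decay_kernel_le[OF t] in auto)
    also have "\<dots> = K * X powr \<theta> * ((?Q y * a y) * (?Q z * b z)) + K * X powr \<theta> * ((?Q y * a y) * ?m) + K * X powr \<theta> * ((?Q z * b z) * ?m)"
    proof -
      have "X powr \<theta> = X powr (\<theta> - 1) * X"
        using X powr_add[of X "\<theta> - 1" 1] by simp
      then show ?thesis by (simp only: mult_ac mult_1_right)
    qed
    finally show ?thesis
      using K Q0 ab0 m0 by (simp add: ennreal_leI flip: ennreal_mult ennreal_plus)
  qed (use st in \<open>simp add: mollifier_eq_0\<close>)
  have "(\<integral>\<^sup>+w. ennreal (gauss_majorant t (x - fst w) * (f (fst w) * g (snd w)) * mollifier s (fst w - snd w)) \<partial>(lborel \<Otimes>\<^sub>M lborel))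
    \<le> (\<integral>\<^sup>+w. ?T1 w + ?T2 w + ?T3 w \<partial>(lborel \<Otimes>\<^sub>M lborel))"
    using pw by (intro nn_integral_mono) (auto simp: split_paired_all)
  also have "\<dots> = integral\<^sup>N (lborel \<Otimes>\<^sub>M lborel) ?T1 + integral\<^sup>N (lborel \<Otimes>\<^sub>M lborel) ?T2 + integral\<^sup>N (lborel \<Otimes>\<^sub>M lborel) ?T3"
    by (subst nn_integral_add, measurable, subst nn_integral_add, measurable)
  also have "\<dots> \<le> ennreal (K * X powr \<theta>) * 1 + ennreal (K * X powr \<theta>) * ennreal c0 + ennreal (K * X powr \<theta>) * ennreal c0"
  proof (intro add_mono)
    have "(\<integral>\<^sup>+w. ennreal (?Q (fst w) * a (fst w)) * ennreal (?Q (snd w) * b (snd w)) \<partial>(lborel \<Otimes>\<^sub>M lborel))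
      = (\<integral>\<^sup>+y. ennreal (?Q y * a y) \<partial>lborel) * (\<integral>\<^sup>+z. ennreal (?Q z * b z) \<partial>lborel)"
      by (subst lborel.nn_integral_fst[symmetric]) (auto simp: nn_integral_cmult nn_integral_multc)
    also have "\<dots> \<le> 1 * 1"
      by (intro mult_mono ha hb) auto
    also have "\<dots> = (1::ennreal)"
      by simp
    finally show "integral\<^sup>N (lborel \<Otimes>\<^sub>M lborel) ?T1 \<le> ennreal (K * X powr \<theta>) * 1"
      by (subst nn_integral_cmult, measurable) (rule mult_left_mono, auto)
    have "(\<integral>\<^sup>+w. ennreal (?Q (fst w) * a (fst w)) * ennreal (mollifier s (fst w - snd w)) \<partial>(lborel \<Otimes>\<^sub>M lborel)) \<le> ennreal c0"
      using mult_right_mono[OF ha, of "ennreal c0"]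
      by (subst nn_integral_diff_kernel_fst) (auto simp: nn_integral_mollifier[OF st(1)] c0_def)
    then show "integral\<^sup>N (lborel \<Otimes>\<^sub>M lborel) ?T2 \<le> ennreal (K * X powr \<theta>) * ennreal c0"
      by (subst nn_integral_cmult, measurable) (rule mult_left_mono, auto)
    have "(\<integral>\<^sup>+w. ennreal (?Q (snd w) * b (snd w)) * ennreal (mollifier s (fst w - snd w)) \<partial>(lborel \<Otimes>\<^sub>M lborel)) \<le> ennreal c0"
      using mult_right_mono[OF hb, of "ennreal c0"]
      by (subst nn_integral_diff_kernel_snd) (auto simp: nn_integral_mollifier[OF st(1)] c0_def)
    then show "integral\<^sup>N (lborel \<Otimes>\<^sub>M lborel) ?T3 \<le> ennreal (K * X powr \<theta>) * ennreal c0"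
      by (subst nn_integral_cmult, measurable) (rule mult_left_mono, auto)
  qed
  also have "\<dots> = ennreal (K * X powr \<theta> * 1 + K * X powr \<theta> * c0 + K * X powr \<theta> * c0)"
  proof -
    have KX: "0 \<le> K * X powr \<theta>"
      using K by simp
    have "ennreal (K * X powr \<theta> * 1 + K * X powr \<theta> * c0 + K * X powr \<theta> * c0)
      = ennreal (K * X powr \<theta> * 1 + K * X powr \<theta> * c0) + ennreal (K * X powr \<theta> * c0)"
      using KX c0 by (intro ennreal_plus) auto
    also have "ennreal (K * X powr \<theta> * 1 + K * X powr \<theta> * c0) = ennreal (K * X powr \<theta> * 1) + ennreal (K * X powr \<theta> * c0)"
      using KX c0 by (intro ennreal_plus) auto
    also have "ennreal (K * X powr \<theta> * c0) = ennreal (K * X powr \<theta>) * ennreal c0"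
      using KX c0 by (intro ennreal_mult) auto
    finally show ?thesis
      by simp
  qed
  also have "K * X powr \<theta> * 1 + K * X powr \<theta> * c0 + K * X powr \<theta> * c0 = 2 ^ (?N + 1) * (1 + 2 * c0) * (A * B) * X powr \<theta>"
    by (simp add: K_def algebra_simps)
  finally show ?thesis
    by (simp add: c0_def X_def)
qed

context div_curl_pair
begin

text \<open>The 3 N^2 is N from the endpoint s = t plus 2 N^2 from the derivative, which has N^2
  terms and whose bound (t/s)^\<kappa> / t integrates over (0, t) to 1 / (1 - \<kappa>) \<le> 2.
  Division by c0 undoes the unnormalised mollifier.\<close>

lemma gauss_average_bound:
  fixes \<alpha> \<beta> \<theta> t A B :: real
  assumes \<alpha>: "1 \<le> \<alpha>" and \<beta>: "1 \<le> \<beta>" and \<theta>: "\<theta> = 1 / \<alpha> + 1 / \<beta> - 1" "0 \<le> \<theta>" "DIM('c) * \<theta> \<le> 1 / 2"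
    and t: "0 < t" and AB: "0 < A" "0 < B"
    and hA: "(\<integral>\<^sup>+y. ennreal (decay_kernel t (x - y)) * ennreal (norm (F y) powr \<alpha>) \<partial>lborel) \<le> ennreal (A powr \<alpha>)"
    and hB: "(\<integral>\<^sup>+y. ennreal (decay_kernel t (x - y)) * ennreal (norm (G y) powr \<beta>) \<partial>lborel) \<le> ennreal (B powr \<beta>)"
  defines "c0 \<equiv> \<integral>w. mollifier 1 (w::'c) \<partial>lborel"
  shows "\<bar>\<integral>y. gauss_kernel t (x - y) * (F y \<bullet> G y) \<partial>lborel\<bar>
     \<le> 3 * (DIM('c))\<^sup>2 * (2 * pi * fact (2 * DIM('c) + 3) * exp 2) * (2 ^ (DIM('c) + 1) * (1 + 2 * c0)) / c0 * (A * B)"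
proof -
  let ?N = "DIM('c)"
  define C1 where "C1 = 2 * pi * fact (2 * ?N + 3) * exp (2::real)"
  define C2 where "C2 = 2 ^ (?N + 1) * (1 + 2 * c0)"
  define \<kappa> where "\<kappa> = ?N * \<theta>"
  have c0: "c0 > 0"
    unfolding c0_def by (rule integral_mollifier_pos)
  have C: "C1 > 0" "C2 > 0"
    using c0 by (auto simp: C1_def C2_def add_pos_pos)
  have \<kappa>: "0 \<le> \<kappa>" "\<kappa> \<le> 1 / 2"
    using \<theta> by (auto simp: \<kappa>_def)
  define I where "I s = (\<Sum>i\<in>Basis. mollifier_form s (\<lambda>y. gauss_kernel t (x - y) * (F y \<bullet> i)) (\<lambda>z. G z \<bullet> i))" for s
  have est: "(\<integral>\<^sup>+w. ennreal (gauss_majorant t (x - fst w) * (norm (F (fst w)) * norm (G (snd w))) * mollifier s (fst w - snd w)) \<partial>(lborel \<Otimes>\<^sub>M lborel))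
     \<le> ennreal (C2 * (A * B) * (t / s) powr \<kappa>)" if s: "0 < s" "s \<le> t" for s
  proof -
    have "((t / s) ^ ?N) powr \<theta> = (t / s) powr \<kappa>"
      using s t by (simp add: \<kappa>_def powr_powr flip: powr_realpow)
    then show ?thesis
      using kernel_bilinear_estimate[OF \<alpha> \<beta> \<theta>(1,2) _ _ _ _ s AB hA hB] by (simp add: C2_def c0_def)
  qed
  have It: "\<bar>I t\<bar> \<le> ?N * (C1 * C2 * (A * B))"
  proof -
    have "\<bar>mollifier_form t (\<lambda>y. gauss_kernel t (x - y) * (F y \<bullet> i)) (\<lambda>z. G z \<bullet> i)\<bar> \<le> C1 * C2 * (A * B)"
      if i: "i \<in> Basis" for i
    proof (rule abs_integral_le_of_nn_integral)
      have "(\<integral>\<^sup>+w. ennreal \<bar>gauss_kernel t (x - fst w) * (F (fst w) \<bullet> i) * (G (snd w) \<bullet> i) * mollifier t (fst w - snd w)\<bar> \<partial>(lborel \<Otimes>\<^sub>M lborel))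
        \<le> (\<integral>\<^sup>+w. ennreal C1 * ennreal (gauss_majorant t (x - fst w) * (norm (F (fst w)) * norm (G (snd w))) * mollifier t (fst w - snd w)) \<partial>(lborel \<Otimes>\<^sub>M lborel))"
      proof (intro nn_integral_mono)
        fix w :: "'c \<times> 'c"
        have "\<bar>gauss_kernel t (x - fst w) * (F (fst w) \<bullet> i) * (G (snd w) \<bullet> i) * mollifier t (fst w - snd w)\<bar>
          = gauss_kernel t (x - fst w) * (\<bar>F (fst w) \<bullet> i\<bar> * \<bar>G (snd w) \<bullet> i\<bar>) * mollifier t (fst w - snd w)"
          using gauss_kernel_nonneg[OF t, of "x - fst w"] mollifier_nonneg[OF t, of "fst w - snd w"] by (simp add: abs_mult)
        also have "\<dots> \<le> (C1 * gauss_majorant t (x - fst w)) * (norm (F (fst w)) * norm (G (snd w))) * mollifier t (fst w - snd w)"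
          using gauss_kernel_bounds(1)[OF t, of "x - fst w"] C gauss_majorant_nonneg[OF t, of "x - fst w"]
            Basis_le_norm[OF i] mollifier_nonneg[OF t, of "fst w - snd w"]
          by (intro mult_mono mult_right_mono) (auto simp: C1_def)
        finally show "ennreal \<bar>gauss_kernel t (x - fst w) * (F (fst w) \<bullet> i) * (G (snd w) \<bullet> i) * mollifier t (fst w - snd w)\<bar>
          \<le> ennreal C1 * ennreal (gauss_majorant t (x - fst w) * (norm (F (fst w)) * norm (G (snd w))) * mollifier t (fst w - snd w))"
          using C gauss_majorant_nonneg[OF t, of "x - fst w"] mollifier_nonneg[OF t, of "fst w - snd w"]
          by (simp add: ennreal_leI mult.assoc flip: ennreal_mult)
      qed
      also have "\<dots> \<le> ennreal C1 * ennreal (C2 * (A * B) * (t / t) powr \<kappa>)"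
        by (subst nn_integral_cmult, measurable) (intro mult_left_mono est t order_refl, simp)
      also have "\<dots> = ennreal (C1 * C2 * (A * B))"
        using C AB t by (simp add: mult.assoc flip: ennreal_mult)
      finally show "(\<integral>\<^sup>+w. ennreal \<bar>gauss_kernel t (x - fst w) * (F (fst w) \<bullet> i) * (G (snd w) \<bullet> i) * mollifier t (fst w - snd w)\<bar> \<partial>(lborel \<Otimes>\<^sub>M lborel))
        \<le> ennreal (C1 * C2 * (A * B))" .
    qed (use C AB in simp)
    then have "\<bar>I t\<bar> \<le> (\<Sum>i\<in>(Basis::'c set). C1 * C2 * (A * B))"
      unfolding I_def by (intro sum_abs[THEN order_trans] sum_mono)
    then show ?thesis by simp
  qed
  define K where "K = ?N * (?N * (C1 * C2 * (A * B)))"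
  have K: "K \<ge> 0" using C AB by (simp add: K_def)
  let ?D = "\<lambda>s. (\<Sum>j\<in>Basis. \<Sum>i\<in>Basis. \<integral>w. gauss_grad t x i (fst w) * (F (fst w) \<bullet> i) * (G (snd w) \<bullet> j)
        * (((fst w - snd w) \<bullet> j) * mollifier s (fst w - snd w)) \<partial>(lborel \<Otimes>\<^sub>M lborel)) / s"
  have D: "(I has_real_derivative ?D s) (at s)" if "0 < s" for s
    unfolding I_def by (rule DERIV_form[OF t that])
  have Dbound: "\<bar>?D s\<bar> \<le> K / t * (t / s) powr \<kappa>" if s: "0 < s" "s \<le> t" for s
  proof -
    have "\<bar>\<integral>w. gauss_grad t x i (fst w) * (F (fst w) \<bullet> i) * (G (snd w) \<bullet> j)
        * (((fst w - snd w) \<bullet> j) * mollifier s (fst w - snd w)) \<partial>(lborel \<Otimes>\<^sub>M lborel)\<bar> \<le> s * C1 / t * (C2 * (A * B) * (t / s) powr \<kappa>)"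
      if i: "i \<in> Basis" and j: "j \<in> Basis" for i j
    proof (rule abs_integral_le_of_nn_integral)
      have "(\<integral>\<^sup>+w. ennreal \<bar>gauss_grad t x i (fst w) * (F (fst w) \<bullet> i) * (G (snd w) \<bullet> j)
          * (((fst w - snd w) \<bullet> j) * mollifier s (fst w - snd w))\<bar> \<partial>(lborel \<Otimes>\<^sub>M lborel))
        \<le> (\<integral>\<^sup>+w. ennreal (s * C1 / t) * ennreal (gauss_majorant t (x - fst w) * (norm (F (fst w)) * norm (G (snd w))) * mollifier s (fst w - snd w)) \<partial>(lborel \<Otimes>\<^sub>M lborel))"
      proof (intro nn_integral_mono)
        fix w :: "'c \<times> 'c"
        let ?d = "fst w - snd w"
        note m0 = mollifier_nonneg[OF s(1), of ?d] and M0 = gauss_majorant_nonneg[OF t, of "x - fst w"]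
        have "\<bar>?d \<bullet> j\<bar> * mollifier s ?d \<le> s * mollifier s ?d"
          using Basis_le_norm[OF j, of ?d] mollifier_eq_0[OF s(1), of ?d] m0
          by (cases "norm ?d < s") (auto intro!: mult_right_mono)
        moreover have "\<bar>gauss_grad t x i (fst w)\<bar> \<le> C1 / t * gauss_majorant t (x - fst w)"
          using abs_gauss_grad_le[OF t i, of x "fst w"] by (simp add: C1_def)
        moreover have "\<bar>F (fst w) \<bullet> i\<bar> * \<bar>G (snd w) \<bullet> j\<bar> \<le> norm (F (fst w)) * norm (G (snd w))"
          using Basis_le_norm[OF i] Basis_le_norm[OF j] by (intro mult_mono) auto
        ultimately have "\<bar>gauss_grad t x i (fst w)\<bar> * (\<bar>F (fst w) \<bullet> i\<bar> * \<bar>G (snd w) \<bullet> j\<bar>) * (\<bar>?d \<bullet> j\<bar> * mollifier s ?d)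
          \<le> (C1 / t * gauss_majorant t (x - fst w)) * (norm (F (fst w)) * norm (G (snd w))) * (s * mollifier s ?d)"
          using C M0 t m0 by (intro mult_mono[OF mult_mono]) auto
        then have "\<bar>gauss_grad t x i (fst w) * (F (fst w) \<bullet> i) * (G (snd w) \<bullet> j) * ((?d \<bullet> j) * mollifier s ?d)\<bar>
          \<le> (s * C1 / t) * (gauss_majorant t (x - fst w) * (norm (F (fst w)) * norm (G (snd w))) * mollifier s ?d)"
          using m0 by (simp add: abs_mult mult_ac)
        then show "ennreal \<bar>gauss_grad t x i (fst w) * (F (fst w) \<bullet> i) * (G (snd w) \<bullet> j) * ((?d \<bullet> j) * mollifier s ?d)\<bar>
          \<le> ennreal (s * C1 / t) * ennreal (gauss_majorant t (x - fst w) * (norm (F (fst w)) * norm (G (snd w))) * mollifier s ?d)"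
          using C s t M0 m0 by (subst ennreal_mult[symmetric]) (auto intro!: ennreal_leI)
      qed
      also have "\<dots> \<le> ennreal (s * C1 / t) * ennreal (C2 * (A * B) * (t / s) powr \<kappa>)"
        by (subst nn_integral_cmult, measurable) (intro mult_left_mono est s, simp)
      also have "\<dots> = ennreal (s * C1 / t * (C2 * (A * B) * (t / s) powr \<kappa>))"
        using C AB s t by (intro ennreal_mult[symmetric]) auto
      finally show "(\<integral>\<^sup>+w. ennreal \<bar>gauss_grad t x i (fst w) * (F (fst w) \<bullet> i) * (G (snd w) \<bullet> j)
          * (((fst w - snd w) \<bullet> j) * mollifier s (fst w - snd w))\<bar> \<partial>(lborel \<Otimes>\<^sub>M lborel))
        \<le> ennreal (s * C1 / t * (C2 * (A * B) * (t / s) powr \<kappa>))" .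
    qed (use C AB s t in simp)
    then have "\<bar>?D s\<bar> * s \<le> (\<Sum>j\<in>(Basis::'c set). \<Sum>i\<in>(Basis::'c set). s * C1 / t * (C2 * (A * B) * (t / s) powr \<kappa>))"
      using s(1) by (simp del: sum_constant) (intro sum_abs[THEN order_trans] sum_mono, assumption+)
    also have "\<dots> = K / t * (t / s) powr \<kappa> * s"
      by (simp add: K_def)
    finally have fin: "\<bar>?D s\<bar> * s \<le> K / t * (t / s) powr \<kappa> * s" .
    show ?thesis
      by (rule mult_right_le_imp_le[OF fin s(1)])
  qed
  \<comment> \<open>An antiderivative of the bound for the derivative of \<open>I\<close>.
    Monotonicity of H - I and H + I replaces integrating that derivative; moreover H \<ge> 0 and H t
    \<le> 2 K.\<close>
  define H where "H s = K * t powr (\<kappa> - 1) * (s powr (1 - \<kappa>) / (1 - \<kappa>))" for s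
  have DH: "(H has_real_derivative K / t * (t / s) powr \<kappa>) (at s)" if s: "0 < s" for s
  proof -
    have "((\<lambda>s. s powr (1 - \<kappa>)) has_real_derivative (1 - \<kappa>) * s powr (1 - \<kappa> - 1)) (at s)"
      by (rule has_real_derivative_powr[OF s])
    then have "(H has_real_derivative K * t powr (\<kappa> - 1) * ((1 - \<kappa>) * s powr (1 - \<kappa> - 1) / (1 - \<kappa>))) (at s)"
      unfolding H_def by (intro DERIV_cmult DERIV_cdivide)
    also have "K * t powr (\<kappa> - 1) * ((1 - \<kappa>) * s powr (1 - \<kappa> - 1) / (1 - \<kappa>)) = K * t powr (\<kappa> - 1) * s powr (- \<kappa>)"
      using \<kappa> by simp
    also have "\<dots> = K / t * (t / s) powr \<kappa>"
      using s t by (simp add: powr_diff powr_minus_divide powr_divide)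
    finally show ?thesis .
  qed
  have Hbound: "H t - H \<epsilon> \<le> 2 * K" if "0 < \<epsilon>" for \<epsilon>
  proof -
    have "H t = K * (1 / (1 - \<kappa>))"
      using t by (simp add: H_def flip: powr_add)
    also have "\<dots> \<le> K * 2"
      using K \<kappa> by (intro mult_left_mono) (auto simp: divide_le_eq)
    finally have "H t \<le> 2 * K" by simp
    moreover have "H \<epsilon> \<ge> 0"
      using K \<kappa> by (simp add: H_def)
    ultimately show ?thesis by linarith
  qed
  have diff: "\<bar>I t - I \<epsilon>\<bar> \<le> 2 * K" if \<epsilon>: "0 < \<epsilon>" "\<epsilon> \<le> t" for \<epsilon>
  proof -
    have "H \<epsilon> - I \<epsilon> \<le> H t - I t"
    proof (rule DERIV_nonneg_imp_nondecreasing[OF \<epsilon>(2)])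
      fix s assume "\<epsilon> \<le> s" "s \<le> t"
      then have s: "0 < s" "s \<le> t"
        using \<epsilon> by auto
      have "0 \<le> K / t * (t / s) powr \<kappa> - ?D s"
        using Dbound[OF s] unfolding abs_le_iff by simp
      then show "\<exists>y. ((\<lambda>s. H s - I s) has_real_derivative y) (at s) \<and> 0 \<le> y"
        using DERIV_diff[OF DH[OF s(1)] D[OF s(1)]] by blast
    qed
    moreover have "H \<epsilon> + I \<epsilon> \<le> H t + I t"
    proof (rule DERIV_nonneg_imp_nondecreasing[OF \<epsilon>(2)])
      fix s assume "\<epsilon> \<le> s" "s \<le> t"
      then have s: "0 < s" "s \<le> t"
        using \<epsilon> by auto
      have "0 \<le> K / t * (t / s) powr \<kappa> + ?D s"
        using Dbound[OF s] unfolding abs_le_iff by simp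
      then show "\<exists>y. ((\<lambda>s. H s + I s) has_real_derivative y) (at s) \<and> 0 \<le> y"
        using DERIV_add[OF DH[OF s(1)] D[OF s(1)]] by blast
    qed
    ultimately show ?thesis
      using Hbound[OF \<epsilon>(1)] by linarith
  qed
  have lim: "(I \<longlongrightarrow> (\<Sum>i\<in>Basis. c0 * (\<integral>y. gauss_kernel t (x - y) * (F y \<bullet> i) * (G y \<bullet> i) \<partial>lborel))) (at_right 0)"
    unfolding I_def c0_def
    by (intro tendsto_sum mollifier_form_tendsto[OF pq _ gauss_F_component(1)[OF t] _ G_component]) auto
  have sumeq: "(\<Sum>i\<in>Basis. c0 * (\<integral>y. gauss_kernel t (x - y) * (F y \<bullet> i) * (G y \<bullet> i) \<partial>lborel))
    = c0 * (\<integral>y. gauss_kernel t (x - y) * (F y \<bullet> G y) \<partial>lborel)"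
  proof -
    have "(\<Sum>i\<in>Basis. \<integral>y. gauss_kernel t (x - y) * (F y \<bullet> i) * (G y \<bullet> i) \<partial>lborel)
      = (\<integral>y. (\<Sum>i\<in>Basis. gauss_kernel t (x - y) * (F y \<bullet> i) * (G y \<bullet> i)) \<partial>lborel)"
      by (intro Bochner_Integration.integral_sum[symmetric] integrable_product[OF pq _ gauss_F_component(1)[OF t] _ G_component]) auto
    also have "\<dots> = (\<integral>y. gauss_kernel t (x - y) * (F y \<bullet> G y) \<partial>lborel)"
    proof (intro Bochner_Integration.integral_cong refl)
      fix y
      show "(\<Sum>i\<in>Basis. gauss_kernel t (x - y) * (F y \<bullet> i) * (G y \<bullet> i)) = gauss_kernel t (x - y) * (F y \<bullet> G y)"
        unfolding euclidean_inner[of "F y" "G y"] by (simp only: sum_distrib_left mult.assoc)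
    qed
    finally show ?thesis
      by (simp only: sum_distrib_left[symmetric])
  qed
  have "\<bar>c0 * (\<integral>y. gauss_kernel t (x - y) * (F y \<bullet> G y) \<partial>lborel)\<bar> \<le> ?N * (C1 * C2 * (A * B)) + 2 * K"
  proof (rule tendsto_upperbound)
    show "((\<lambda>s. \<bar>I s\<bar>) \<longlongrightarrow> \<bar>c0 * (\<integral>y. gauss_kernel t (x - y) * (F y \<bullet> G y) \<partial>lborel)\<bar>) (at_right 0)"
      using tendsto_rabs[OF lim] by (simp add: sumeq)
    have "\<forall>\<^sub>F s in at_right 0. 0 < s \<and> s < t"
      using t by (auto simp: eventually_at_right_field)
    then show "\<forall>\<^sub>F s in at_right 0. \<bar>I s\<bar> \<le> ?N * (C1 * C2 * (A * B)) + 2 * K"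
    proof eventually_elim
      case (elim s)
      then show ?case
        using diff[of s] It by linarith
    qed
  qed simp
  also have "?N * (C1 * C2 * (A * B)) + 2 * K \<le> 3 * (?N)\<^sup>2 * C1 * C2 * (A * B)"
  proof -
    have "real ?N * 1 \<le> real ?N * real ?N"
      by (intro mult_left_mono) (auto simp: Suc_le_eq)
    then have le: "real ?N * (C1 * C2 * (A * B)) \<le> real ?N * real ?N * (C1 * C2 * (A * B))"
      using C AB by (intro mult_right_mono) auto
    have "3 * (?N)\<^sup>2 * C1 * C2 * (A * B) = 3 * (real ?N * real ?N * (C1 * C2 * (A * B)))"
      by (simp add: power2_eq_square)
    moreover have "K = real ?N * real ?N * (C1 * C2 * (A * B))"
      by (simp add: K_def)
    ultimately show ?thesis
      using le by linarith
  qed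
  finally have "c0 * \<bar>\<integral>y. gauss_kernel t (x - y) * (F y \<bullet> G y) \<partial>lborel\<bar> \<le> 3 * (?N)\<^sup>2 * C1 * C2 * (A * B)"
    using c0 by (simp add: abs_mult)
  then have "\<bar>\<integral>y. gauss_kernel t (x - y) * (F y \<bullet> G y) \<partial>lborel\<bar> \<le> 3 * (?N)\<^sup>2 * C1 * C2 * (A * B) / c0"
    using c0 by (simp add: pos_le_divide_eq mult.commute)
  then show ?thesis
    by (simp add: C1_def C2_def)
qed

end

section \<open>Hardy norm bounds\<close>

text \<open>Required because \<open>hardy_norm\<close> is infinite by definition for a
  non-integrable function.\<close>

lemma (in div_curl_pair) integrable_inner: "integrable lborel (\<lambda>y. F y \<bullet> G y)"
  unfolding euclidean_inner[of "F _" "G _"]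
  by (intro Bochner_Integration.integrable_sum integrable_product[OF pq _ F_component _ G_component]) auto

text \<open>The bounds \<open>A\<close> and \<open>B\<close> are read off from the two maximal
  functions at \<open>x\<close>, which do not depend on \<open>t\<close>, so the supremum over
  \<open>t\<close> costs nothing. \<kappa> is here the constant of
  \<open>decay_kernel_le_dyadic_max\<close>.\<close>

lemma (in div_curl_pair) hardy_max_le:
  fixes \<alpha> \<beta> \<theta> d :: real
  assumes \<alpha>: "1 \<le> \<alpha>" and \<beta>: "1 \<le> \<beta>" and \<theta>: "\<theta> = 1 / \<alpha> + 1 / \<beta> - 1" "0 \<le> \<theta>" "DIM('c) * \<theta> \<le> 1 / 2"
    and d: "0 < d"
  defines "C \<equiv> 3 * (DIM('c))\<^sup>2 * (2 * pi * fact (2 * DIM('c) + 3) * exp 2)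
     * (2 ^ (DIM('c) + 1) * (1 + 2 * (\<integral>w. mollifier 1 (w::'c) \<partial>lborel))) / (\<integral>w. mollifier 1 (w::'c) \<partial>lborel)"
    and "\<kappa> \<equiv> (4::real) ^ (DIM('c) + 1)"
  shows "hardy_max (\<lambda>y. F y \<bullet> G y) x \<le> ennreal (C * (\<kappa> powr (p / \<alpha>) + \<kappa> powr (q / \<beta>))) *
     (ennreal (d powr p) * epowr (dyadic_max (\<lambda>y. ennreal (norm (F y) powr \<alpha>)) x) (p / \<alpha>)
      + ennreal (d powr (- q)) * epowr (dyadic_max (\<lambda>y. ennreal (norm (G y) powr \<beta>)) x) (q / \<beta>))"
    (is "_ \<le> ennreal ?C * (_ * epowr ?a _ + _ * epowr ?b _)")
proof -
  have "0 < (\<integral>w. mollifier 1 (w::'c) \<partial>lborel)"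
    by (rule integral_mollifier_pos)
  then have C: "C > 0"
    by (auto simp: C_def intro!: divide_pos_pos mult_pos_pos add_pos_pos)
  have \<kappa>: "\<kappa> > 0" by (simp add: \<kappa>_def)
  then have C': "?C > 0"
    using C by (intro mult_pos_pos add_pos_pos) auto
  show ?thesis
  proof (cases "?a = \<infinity> \<or> ?b = \<infinity>")
    case True
    then have "epowr ?a (p / \<alpha>) = \<infinity> \<or> epowr ?b (q / \<beta>) = \<infinity>"
      by (auto simp: epowr_def)
    moreover have "ennreal ?C \<noteq> 0" "ennreal (d powr p) \<noteq> 0" "ennreal (d powr (- q)) \<noteq> 0"
      using C' d by auto
    ultimately have "ennreal ?C * (ennreal (d powr p) * epowr ?a (p / \<alpha>) + ennreal (d powr (- q)) * epowr ?b (q / \<beta>)) = \<infinity>"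
      by (auto simp: ennreal_mult_eq_top_iff)
    then show ?thesis by simp
  next
    case False
    then have "?a < top" "?b < top"
      by (simp_all add: less_top)
    then obtain a b where ab: "?a = ennreal a" "0 \<le> a" "?b = ennreal b" "0 \<le> b"
      using ennreal_enn2real[symmetric] enn2real_nonneg by meson
    \<comment> \<open>\<open>gauss_average_bound\<close> wants strictly positive \<open>A\<close>
      and \<open>B\<close>, but the maximal functions may vanish. They are raised by e > 0, and e
      tends to 0 afterwards.\<close>
    let ?R = "\<lambda>e. C * (d powr p * (\<kappa> * (a + e)) powr (p / \<alpha>) + d powr (- q) * (\<kappa> * (b + e)) powr (q / \<beta>))"
    have key: "\<bar>\<integral>y. gauss_kernel t (x - y) * (F y \<bullet> G y) \<partial>lborel\<bar> \<le> ?R e" if t: "0 < t" and e: "0 < e" for t e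
    proof -
      define A where "A = (\<kappa> * (a + e)) powr (1 / \<alpha>)"
      define B where "B = (\<kappa> * (b + e)) powr (1 / \<beta>)"
      have AB: "A > 0" "B > 0"
        using \<kappa> ab e by (auto simp: A_def B_def)
      have pow: "A powr \<alpha> = \<kappa> * (a + e)" "B powr \<beta> = \<kappa> * (b + e)"
        "A powr p = (\<kappa> * (a + e)) powr (p / \<alpha>)" "B powr q = (\<kappa> * (b + e)) powr (q / \<beta>)"
        using \<kappa> ab e \<alpha> \<beta> by (simp_all add: A_def B_def powr_powr)
      have "(\<integral>\<^sup>+y. ennreal (decay_kernel t (x - y)) * ennreal (norm (F y) powr \<alpha>) \<partial>lborel) \<le> ennreal \<kappa> * ?a"
        unfolding \<kappa>_def by (rule decay_kernel_le_dyadic_max) (use t in auto)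
      also have "\<dots> \<le> ennreal (A powr \<alpha>)"
        using \<kappa> ab e by (simp add: pow ennreal_leI flip: ennreal_mult)
      finally have hA: "(\<integral>\<^sup>+y. ennreal (decay_kernel t (x - y)) * ennreal (norm (F y) powr \<alpha>) \<partial>lborel) \<le> ennreal (A powr \<alpha>)" .
      have "(\<integral>\<^sup>+y. ennreal (decay_kernel t (x - y)) * ennreal (norm (G y) powr \<beta>) \<partial>lborel) \<le> ennreal \<kappa> * ?b"
        unfolding \<kappa>_def by (rule decay_kernel_le_dyadic_max) (use t in auto)
      also have "\<dots> \<le> ennreal (B powr \<beta>)"
        using \<kappa> ab e by (simp add: pow ennreal_leI flip: ennreal_mult)
      finally have hB: "(\<integral>\<^sup>+y. ennreal (decay_kernel t (x - y)) * ennreal (norm (G y) powr \<beta>) \<partial>lborel) \<le> ennreal (B powr \<beta>)" .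
      have "\<bar>\<integral>y. gauss_kernel t (x - y) * (F y \<bullet> G y) \<partial>lborel\<bar> \<le> C * (A * B)"
        unfolding C_def by (rule gauss_average_bound[OF \<alpha> \<beta> \<theta> t AB hA hB])
      also have "\<dots> \<le> C * (d powr p * A powr p + d powr (- q) * B powr q)"
        using C AB by (intro mult_left_mono scaled_mult_le_powr_add_powr[OF pq _ _ d]) auto
      finally show ?thesis
        by (simp only: pow)
    qed
    have exps: "0 < p / \<alpha>" "0 < q / \<beta>"
      using pq \<alpha> \<beta> by auto
    have key0: "\<bar>\<integral>y. gauss_kernel t (x - y) * (F y \<bullet> G y) \<partial>lborel\<bar> \<le> ?R 0" if t: "0 < t" for t
    proof (rule tendsto_lowerbound)
      have "((\<lambda>e. \<kappa> * (a + e)) \<longlongrightarrow> \<kappa> * (a + 0)) (at_right 0)" "((\<lambda>e. \<kappa> * (b + e)) \<longlongrightarrow> \<kappa> * (b + 0)) (at_right 0)"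
        by (intro tendsto_intros)+
      moreover have ev: "\<forall>\<^sub>F e in at_right 0. (0::real) < e"
        by (simp add: eventually_at_right_less)
      have "\<forall>\<^sub>F e in at_right 0. 0 \<le> \<kappa> * (a + e)" "\<forall>\<^sub>F e in at_right 0. 0 \<le> \<kappa> * (b + e)"
        using \<kappa> ab by (auto intro: eventually_mono[OF ev])
      ultimately have "((\<lambda>e. (\<kappa> * (a + e)) powr (p / \<alpha>)) \<longlongrightarrow> (\<kappa> * (a + 0)) powr (p / \<alpha>)) (at_right 0)"
        "((\<lambda>e. (\<kappa> * (b + e)) powr (q / \<beta>)) \<longlongrightarrow> (\<kappa> * (b + 0)) powr (q / \<beta>)) (at_right 0)"
        using exps by (auto intro!: tendsto_powr'[OF _ tendsto_const])
      then show "(?R \<longlongrightarrow> ?R 0) (at_right 0)"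
        by (intro tendsto_mult tendsto_add tendsto_const)
      show "\<forall>\<^sub>F e in at_right 0. \<bar>\<integral>y. gauss_kernel t (x - y) * (F y \<bullet> G y) \<partial>lborel\<bar> \<le> ?R e"
        by (rule eventually_mono[OF ev]) (rule key[OF t])
    qed simp
    have "?R 0 \<le> ?C * (d powr p * a powr (p / \<alpha>) + d powr (- q) * b powr (q / \<beta>))"
    proof -
      have "d powr p * (\<kappa> powr (p / \<alpha>) * a powr (p / \<alpha>)) + d powr (- q) * (\<kappa> powr (q / \<beta>) * b powr (q / \<beta>))
        \<le> (\<kappa> powr (p / \<alpha>) + \<kappa> powr (q / \<beta>)) * (d powr p * a powr (p / \<alpha>) + d powr (- q) * b powr (q / \<beta>))"
        by (simp add: algebra_simps)
      then have "C * (d powr p * (\<kappa> powr (p / \<alpha>) * a powr (p / \<alpha>)) + d powr (- q) * (\<kappa> powr (q / \<beta>) * b powr (q / \<beta>)))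
        \<le> C * ((\<kappa> powr (p / \<alpha>) + \<kappa> powr (q / \<beta>)) * (d powr p * a powr (p / \<alpha>) + d powr (- q) * b powr (q / \<beta>)))"
        using C by (intro mult_left_mono) auto
      then show ?thesis
        using \<kappa> ab by (simp add: powr_mult mult.assoc)
    qed
    then have "hardy_max (\<lambda>y. F y \<bullet> G y) x \<le> ennreal (?C * (d powr p * a powr (p / \<alpha>) + d powr (- q) * b powr (q / \<beta>)))"
      unfolding hardy_max_def using key0 by (intro SUP_least ennreal_leI) (auto intro: order_trans)
    also have "\<dots> = ennreal ?C * (ennreal (d powr p) * epowr ?a (p / \<alpha>) + ennreal (d powr (- q)) * epowr ?b (q / \<beta>))"
      unfolding ab(1,3) using C' ab by (simp add: epowr_def ennreal_mult ennreal_plus)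
    finally show ?thesis .
  qed
qed

text \<open>Strong maximal bounds applied to |F|^\<alpha> and |G|^\<beta> with exponents p/\<alpha>
  and q/\<beta>. The statement asks for no finiteness: with an infinite integral the right side is
  infinite. It can therefore be applied to every slice, also to those that fail to lie in L^p or
  L^q.\<close>

theorem div_curl_hardy_norm:
  fixes p q :: real
  assumes pq: "1 < p" "1 < q" "1 / p + 1 / q = 1"
  obtains C where "0 < C"
    "\<And>(F :: 'c::euclidean_space \<Rightarrow> 'c) G d. F \<in> borel_measurable borel \<Longrightarrow> G \<in> borel_measurable borel \<Longrightarrow>
      div_free F \<Longrightarrow> curl_free G \<Longrightarrow> 0 < d \<Longrightarrow>
      hardy_norm (\<lambda>y. F y \<bullet> G y) \<le> ennreal C * (ennreal (d powr p) * (\<integral>\<^sup>+y. ennreal (norm (F y) powr p) \<partial>lborel)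
        + ennreal (d powr (- q)) * (\<integral>\<^sup>+y. ennreal (norm (G y) powr q) \<partial>lborel))"
proof -
  \<comment> \<open>1/\<alpha> = 1/p + \<eta> and 1/\<beta> = 1/q + \<eta>. Of the three caps, 1/q
    and 1/p keep \<alpha> and \<beta> at least 1, and 1/(4 N) gives N \<theta> \<le> 1/2.\<close>
  define \<eta> where "\<eta> = min (1 / (4 * DIM('c))) (min (1 / p) (1 / q))"
  have \<eta>: "0 < \<eta>" "\<eta> \<le> 1 / p" "\<eta> \<le> 1 / q" "\<eta> \<le> 1 / (4 * DIM('c))"
    using pq by (auto simp: \<eta>_def)
  define \<alpha> where "\<alpha> = 1 / (1 / p + \<eta>)"
  define \<beta> where "\<beta> = 1 / (1 / q + \<eta>)"
  define \<theta> where "\<theta> = 2 * \<eta>"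
  have pos: "0 < 1 / p + \<eta>" "0 < 1 / q + \<eta>"
    using pq \<eta> by (auto intro: add_pos_pos)
  have \<alpha>: "1 \<le> \<alpha>" and \<beta>: "1 \<le> \<beta>"
    unfolding \<alpha>_def \<beta>_def using pos \<eta> pq by simp_all
  have \<theta>: "\<theta> = 1 / \<alpha> + 1 / \<beta> - 1" "0 \<le> \<theta>"
    using pq \<eta> by (simp_all add: \<theta>_def \<alpha>_def \<beta>_def)
  have "DIM('c) * \<theta> \<le> DIM('c) * (2 * (1 / (4 * DIM('c))))"
    unfolding \<theta>_def using \<eta> by (intro mult_left_mono) auto
  then have \<theta>': "DIM('c) * \<theta> \<le> 1 / 2"
    by simp
  \<comment> \<open>Since \<eta> > 0 both exponents exceed 1, as the strong type bound
    demands.\<close>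
  have "p / \<alpha> = 1 + p * \<eta>" "q / \<beta> = 1 + q * \<eta>"
    using pq by (simp_all add: \<alpha>_def \<beta>_def distrib_left)
  then have r: "1 < p / \<alpha>" "1 < q / \<beta>"
    using pq \<eta> by simp_all
  obtain C1 where C1: "0 < C1" "\<And>u::'c \<Rightarrow> real. u \<in> borel_measurable borel \<Longrightarrow> (\<And>y. 0 \<le> u y) \<Longrightarrow>
    (\<integral>\<^sup>+x. epowr (dyadic_max (\<lambda>y. ennreal (u y)) x) (p / \<alpha>) \<partial>lborel) \<le> ennreal C1 * (\<integral>\<^sup>+y. ennreal (u y powr (p / \<alpha>)) \<partial>lborel)"
    using strong_type_dyadic_max[OF r(1), where 'c='c] by blast
  obtain C2 where C2: "0 < C2" "\<And>u::'c \<Rightarrow> real. u \<in> borel_measurable borel \<Longrightarrow> (\<And>y. 0 \<le> u y) \<Longrightarrow>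
    (\<integral>\<^sup>+x. epowr (dyadic_max (\<lambda>y. ennreal (u y)) x) (q / \<beta>) \<partial>lborel) \<le> ennreal C2 * (\<integral>\<^sup>+y. ennreal (u y powr (q / \<beta>)) \<partial>lborel)"
    using strong_type_dyadic_max[OF r(2), where 'c='c] by blast
  define \<kappa> where "\<kappa> = (4::real) ^ (DIM('c) + 1)"
  define C0 where "C0 = 3 * (DIM('c))\<^sup>2 * (2 * pi * fact (2 * DIM('c) + 3) * exp 2)
     * (2 ^ (DIM('c) + 1) * (1 + 2 * (\<integral>w. mollifier 1 (w::'c) \<partial>lborel))) / (\<integral>w. mollifier 1 (w::'c) \<partial>lborel)"
  define C3 where "C3 = C0 * (\<kappa> powr (p / \<alpha>) + \<kappa> powr (q / \<beta>))"
  have "0 < C0"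
    using integral_mollifier_pos[where 'c='c]
    by (auto simp: C0_def intro!: divide_pos_pos mult_pos_pos add_pos_pos)
  then have C3: "0 < C3"
    unfolding C3_def \<kappa>_def by (intro mult_pos_pos add_pos_pos) auto
  show ?thesis
  proof (rule that[of "C3 * (C1 + C2)"])
    show "0 < C3 * (C1 + C2)"
      using C1 C2 C3 by simp
    fix F G :: "'c \<Rightarrow> 'c" and d :: real
    assume [measurable]: "F \<in> borel_measurable borel" "G \<in> borel_measurable borel"
      and dc: "div_free F" "curl_free G" and d: "0 < d"
    let ?IF = "\<integral>\<^sup>+y. ennreal (norm (F y) powr p) \<partial>lborel" and ?IG = "\<integral>\<^sup>+y. ennreal (norm (G y) powr q) \<partial>lborel"
    show "hardy_norm (\<lambda>y. F y \<bullet> G y) \<le> ennreal (C3 * (C1 + C2)) * (ennreal (d powr p) * ?IF + ennreal (d powr (- q)) * ?IG)"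
    proof (cases "?IF = \<infinity> \<or> ?IG = \<infinity>")
      case True
      moreover have "ennreal (C3 * (C1 + C2)) \<noteq> 0" "ennreal (d powr p) \<noteq> 0" "ennreal (d powr (- q)) \<noteq> 0"
        using C1 C2 C3 d by auto
      ultimately have "ennreal (C3 * (C1 + C2)) * (ennreal (d powr p) * ?IF + ennreal (d powr (- q)) * ?IG) = \<infinity>"
        by (auto simp: ennreal_mult_eq_top_iff)
      then show ?thesis by simp
    next
      case False
      then interpret div_curl_pair p q F G
        using pq dc by unfold_locales (auto simp: integrable_iff_bounded less_top[symmetric])
      let ?a = "\<lambda>x. epowr (dyadic_max (\<lambda>y. ennreal (norm (F y) powr \<alpha>)) x) (p / \<alpha>)"
      let ?b = "\<lambda>x. epowr (dyadic_max (\<lambda>y. ennreal (norm (G y) powr \<beta>)) x) (q / \<beta>)"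
      have [measurable]: "?a \<in> borel_measurable borel" "?b \<in> borel_measurable borel"
        by (intro measurable_epowr measurable_dyadic_max; measurable)+
      have a: "(\<integral>\<^sup>+x. ?a x \<partial>lborel) \<le> ennreal (C1 + C2) * ?IF"
      proof -
        have "(\<integral>\<^sup>+x. ?a x \<partial>lborel) \<le> ennreal C1 * (\<integral>\<^sup>+y. ennreal ((norm (F y) powr \<alpha>) powr (p / \<alpha>)) \<partial>lborel)"
          by (intro C1(2)) auto
        also have "(\<lambda>y. ennreal ((norm (F y) powr \<alpha>) powr (p / \<alpha>))) = (\<lambda>y. ennreal (norm (F y) powr p))"
          using \<alpha> by (simp add: powr_powr)
        also have "ennreal C1 * ?IF \<le> ennreal (C1 + C2) * ?IF"
          using C2 by (intro mult_right_mono ennreal_leI) auto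
        finally show ?thesis .
      qed
      have b: "(\<integral>\<^sup>+x. ?b x \<partial>lborel) \<le> ennreal (C1 + C2) * ?IG"
      proof -
        have "(\<integral>\<^sup>+x. ?b x \<partial>lborel) \<le> ennreal C2 * (\<integral>\<^sup>+y. ennreal ((norm (G y) powr \<beta>) powr (q / \<beta>)) \<partial>lborel)"
          by (intro C2(2)) auto
        also have "(\<lambda>y. ennreal ((norm (G y) powr \<beta>) powr (q / \<beta>))) = (\<lambda>y. ennreal (norm (G y) powr q))"
          using \<beta> by (simp add: powr_powr)
        also have "ennreal C2 * ?IG \<le> ennreal (C1 + C2) * ?IG"
          using C1 by (intro mult_right_mono ennreal_leI) auto
        finally show ?thesis .
      qed
      have "hardy_norm (\<lambda>y. F y \<bullet> G y) = (\<integral>\<^sup>+x. hardy_max (\<lambda>y. F y \<bullet> G y) x \<partial>lborel)"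
        by (simp add: hardy_norm_def integrable_inner)
      also have "\<dots> \<le> (\<integral>\<^sup>+x. ennreal C3 * (ennreal (d powr p) * ?a x + ennreal (d powr (- q)) * ?b x) \<partial>lborel)"
        unfolding C3_def C0_def \<kappa>_def by (intro nn_integral_mono hardy_max_le[OF \<alpha> \<beta> \<theta> \<theta>' d])
      also have "\<dots> = ennreal C3 * (ennreal (d powr p) * (\<integral>\<^sup>+x. ?a x \<partial>lborel) + ennreal (d powr (- q)) * (\<integral>\<^sup>+x. ?b x \<partial>lborel))"
        by (simp add: nn_integral_cmult nn_integral_add)
      also have "\<dots> \<le> ennreal C3 * (ennreal (d powr p) * (ennreal (C1 + C2) * ?IF) + ennreal (d powr (- q)) * (ennreal (C1 + C2) * ?IG))"
        by (intro mult_left_mono add_mono a b) auto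
      also have "\<dots> = ennreal (C3 * (C1 + C2)) * (ennreal (d powr p) * ?IF + ennreal (d powr (- q)) * ?IG)"
      proof -
        have "ennreal (C3 * (C1 + C2)) = ennreal C3 * ennreal (C1 + C2)"
          using C1 C2 C3 by (intro ennreal_mult) auto
        then show ?thesis
          by (simp only: distrib_left mult_ac)
      qed
      finally show ?thesis .
    qed
  qed
qed

text \<open>Turns the additive bound into a product by the best choice of \<open>d\<close>.
  \<open>P\<close> or \<open>Q\<close> may be 0, when no optimal \<open>d\<close> exists, so both
  are enlarged by e > 0 and e tends to 0.\<close>

lemma le_product_of_scaled_sums:
  fixes p q C P Q :: real and X :: ennreal
  assumes pq: "1 < p" "1 < q" "1 / p + 1 / q = 1" and C: "0 < C" and PQ: "0 \<le> P" "0 \<le> Q"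
    and le: "\<And>d. 0 < d \<Longrightarrow> X \<le> ennreal C * (ennreal (d powr p) * ennreal P + ennreal (d powr (- q)) * ennreal Q)"
  shows "X \<le> ennreal (2 * C * P powr (1 / p) * Q powr (1 / q))"
proof (rule tendsto_lowerbound)
  have bound: "X \<le> ennreal (2 * C * (P + e) powr (1 / p) * (Q + e) powr (1 / q))" if e: "0 < e" for e
  proof -
    let ?P = "P + e" and ?Q = "Q + e"
    have pos: "?P > 0" "?Q > 0" using PQ e by auto
    \<comment> \<open>This \<open>d\<close> makes the two summands equal, each being P^(1/p) Q^(1/q)
      for the enlarged values; hence the factor 2.\<close>
    define d where "d = (?Q / ?P) powr (1 / (p * q))"
    have d: "d > 0" using pos by (simp add: d_def)
    have conj: "1 - 1 / q = 1 / p" "1 - 1 / p = 1 / q"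
      using pq by linarith+
    have "?P / ?P powr (1 / q) = ?P powr (1 / p)" "?Q / ?Q powr (1 / p) = ?Q powr (1 / q)"
      using powr_diff[of ?P 1 "1 / q"] powr_diff[of ?Q 1 "1 / p"] pos unfolding conj by simp_all
    moreover have "d powr p = ?Q powr (1 / q) / ?P powr (1 / q)" "d powr (- q) = ?P powr (1 / p) / ?Q powr (1 / p)"
      using pos pq by (simp_all add: d_def powr_powr powr_divide powr_minus_divide)
    ultimately have dp: "d powr p * ?P = ?P powr (1 / p) * ?Q powr (1 / q)"
      and dq: "d powr (- q) * ?Q = ?P powr (1 / p) * ?Q powr (1 / q)"
      by (metis mult.commute times_divide_eq_left times_divide_eq_right)+
    have "X \<le> ennreal C * (ennreal (d powr p) * ennreal P + ennreal (d powr (- q)) * ennreal Q)"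
      by (rule le[OF d])
    also have "\<dots> = ennreal (C * (d powr p * P + d powr (- q) * Q))"
      using C PQ by (simp add: ennreal_mult ennreal_plus)
    also have "\<dots> \<le> ennreal (C * (d powr p * ?P + d powr (- q) * ?Q))"
      using C e by (intro ennreal_leI mult_left_mono add_mono) auto
    also have "C * (d powr p * ?P + d powr (- q) * ?Q) = 2 * C * ?P powr (1 / p) * ?Q powr (1 / q)"
      unfolding dp dq by simp
    finally show ?thesis .
  qed
  have ev: "\<forall>\<^sub>F e in at_right 0. (0::real) < e"
    by (simp add: eventually_at_right_less)
  show "\<forall>\<^sub>F e in at_right 0. X \<le> ennreal (2 * C * (P + e) powr (1 / p) * (Q + e) powr (1 / q))"
    by (rule eventually_mono[OF ev]) (rule bound)
  have "\<forall>\<^sub>F e in at_right 0. 0 \<le> P + e" "\<forall>\<^sub>F e in at_right 0. 0 \<le> Q + e"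
    using PQ by (auto intro: eventually_mono[OF ev])
  moreover have "((\<lambda>e. P + e) \<longlongrightarrow> P + 0) (at_right 0)" "((\<lambda>e. Q + e) \<longlongrightarrow> Q + 0) (at_right 0)"
    by (intro tendsto_intros)+
  ultimately have "((\<lambda>e. (P + e) powr (1 / p)) \<longlongrightarrow> (P + 0) powr (1 / p)) (at_right 0)"
    "((\<lambda>e. (Q + e) powr (1 / q)) \<longlongrightarrow> (Q + 0) powr (1 / q)) (at_right 0)"
    using pq by (auto intro!: tendsto_powr'[OF _ tendsto_const])
  then have "((\<lambda>e. ennreal (2 * C * (P + e) powr (1 / p) * (Q + e) powr (1 / q)))
      \<longlongrightarrow> ennreal (2 * C * (P + 0) powr (1 / p) * (Q + 0) powr (1 / q))) (at_right 0)"
    by (intro tendsto_ennrealI tendsto_mult tendsto_const)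
  then show "((\<lambda>e. ennreal (2 * C * (P + e) powr (1 / p) * (Q + e) powr (1 / q)))
      \<longlongrightarrow> ennreal (2 * C * P powr (1 / p) * Q powr (1 / q))) (at_right 0)"
    by simp
qed simp

text \<open>An additive bound is linear in the two slice integrals, so integrating in x is just
  Tonelli, together with the fact that the norm of the second component is at most the full
  norm.\<close>

lemma slices_hardy_norm_le:
  fixes p q :: real and E B :: "'a::euclidean_space \<times> 'b::euclidean_space \<Rightarrow> 'a \<times> 'b"
  assumes [measurable]: "E \<in> borel_measurable borel" "B \<in> borel_measurable borel"
    and pq: "0 \<le> p" "0 \<le> q"
    and le: "\<And>x. hardy_norm (\<lambda>y. snd (E (x, y)) \<bullet> snd (B (x, y))) \<le> ennreal C *
      (ennreal a * (\<integral>\<^sup>+y. ennreal (norm (snd (E (x, y))) powr p) \<partial>lborel)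
       + ennreal b * (\<integral>\<^sup>+y. ennreal (norm (snd (B (x, y))) powr q) \<partial>lborel))"
  shows "(\<integral>\<^sup>+x. hardy_norm (\<lambda>y. snd (E (x, y)) \<bullet> snd (B (x, y))) \<partial>lborel) \<le> ennreal C *
      (ennreal a * (\<integral>\<^sup>+z. ennreal (norm (E z) powr p) \<partial>lborel) + ennreal b * (\<integral>\<^sup>+z. ennreal (norm (B z) powr q) \<partial>lborel))"
proof -
  have slice: "(\<integral>\<^sup>+x. \<integral>\<^sup>+y. ennreal (norm (snd (H (x, y))) powr r) \<partial>lborel \<partial>lborel) \<le> (\<integral>\<^sup>+z. ennreal (norm (H z) powr r) \<partial>lborel)"
    and slice_meas: "(\<lambda>x. \<integral>\<^sup>+y. ennreal (norm (snd (H (x, y))) powr r) \<partial>lborel) \<in> borel_measurable lborel"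
    if H: "H \<in> borel_measurable borel" and r: "0 \<le> r" for H :: "'a \<times> 'b \<Rightarrow> 'a \<times> 'b" and r
  proof -
    have HM: "H \<in> borel_measurable (lborel \<Otimes>\<^sub>M lborel)"
      using H by (simp add: lborel_prod)
    have m: "(\<lambda>z. ennreal (norm (snd (H z)) powr r)) \<in> borel_measurable (lborel \<Otimes>\<^sub>M lborel)"
    proof -
      have "(snd :: 'a \<times> 'b \<Rightarrow> 'b) \<in> borel_measurable borel"
        by (intro borel_measurable_continuous_onI continuous_intros)
      from measurable_compose[OF HM this] have "(\<lambda>z. snd (H z)) \<in> borel_measurable (lborel \<Otimes>\<^sub>M lborel)" .
      moreover have "(\<lambda>w::'b. ennreal (norm w powr r)) \<in> borel_measurable borel"
        by measurable
      ultimately show ?thesis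
        by (rule measurable_compose)
    qed
    show "(\<lambda>x. \<integral>\<^sup>+y. ennreal (norm (snd (H (x, y))) powr r) \<partial>lborel) \<in> borel_measurable lborel"
      by (rule lborel.borel_measurable_nn_integral_fst[OF m])
    have "(\<integral>\<^sup>+x. \<integral>\<^sup>+y. ennreal (norm (snd (H (x, y))) powr r) \<partial>lborel \<partial>lborel) = (\<integral>\<^sup>+z. ennreal (norm (snd (H z)) powr r) \<partial>lborel)"
      unfolding lborel.nn_integral_fst[OF m] by (simp add: lborel_prod)
    also have "\<dots> \<le> (\<integral>\<^sup>+z. ennreal (norm (H z) powr r) \<partial>lborel)"
    proof (intro nn_integral_mono ennreal_leI powr_mono2 r norm_ge_zero)
      show "norm (snd (H z)) \<le> norm (H z)" for z
        using norm_snd_le[of "snd (H z)" "fst (H z)"] by simp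
    qed
    finally show "(\<integral>\<^sup>+x. \<integral>\<^sup>+y. ennreal (norm (snd (H (x, y))) powr r) \<partial>lborel \<partial>lborel) \<le> (\<integral>\<^sup>+z. ennreal (norm (H z) powr r) \<partial>lborel)" .
  qed
  note [measurable] = slice_meas[OF assms(1) pq(1)] slice_meas[OF assms(2) pq(2)]
  have "(\<integral>\<^sup>+x. hardy_norm (\<lambda>y. snd (E (x, y)) \<bullet> snd (B (x, y))) \<partial>lborel)
    \<le> (\<integral>\<^sup>+x. ennreal C * (ennreal a * (\<integral>\<^sup>+y. ennreal (norm (snd (E (x, y))) powr p) \<partial>lborel)
       + ennreal b * (\<integral>\<^sup>+y. ennreal (norm (snd (B (x, y))) powr q) \<partial>lborel)) \<partial>lborel)"
    by (intro nn_integral_mono le)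
  also have "\<dots> = ennreal C * (ennreal a * (\<integral>\<^sup>+x. \<integral>\<^sup>+y. ennreal (norm (snd (E (x, y))) powr p) \<partial>lborel \<partial>lborel)
       + ennreal b * (\<integral>\<^sup>+x. \<integral>\<^sup>+y. ennreal (norm (snd (B (x, y))) powr q) \<partial>lborel \<partial>lborel))"
    by (subst nn_integral_cmult, measurable, subst nn_integral_add, measurable, subst nn_integral_cmult, measurable,
        subst nn_integral_cmult, measurable)
  also have "\<dots> \<le> ennreal C *
      (ennreal a * (\<integral>\<^sup>+z. ennreal (norm (E z) powr p) \<partial>lborel) + ennreal b * (\<integral>\<^sup>+z. ennreal (norm (B z) powr q) \<partial>lborel))"
    by (intro mult_left_mono add_mono slice assms) auto
  finally show ?thesis .
qed

theorem theorem1p7: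
  fixes p q :: real
  assumes "1 < p" and "1 < q" and "1 / p + 1 / q = 1"
  shows "\<exists>C::real. \<forall>(E :: 'a::euclidean_space \<times> 'b::euclidean_space \<Rightarrow> 'a \<times> 'b)
                        (B :: 'a \<times> 'b \<Rightarrow> 'a \<times> 'b).
           in_Lp p E \<and> in_Lp q B \<and> div_free E \<and> curl_free B \<and>
           (\<forall>x. div_free (\<lambda>y. snd (E (x, y)))) \<and> (\<forall>x. curl_free (\<lambda>y. snd (B (x, y))))
           \<longrightarrow> hardy_norm (\<lambda>z. E z \<bullet> B z) \<le> ennreal (C * Lp_norm p E * Lp_norm q B)
             \<and> (\<integral>\<^sup>+x. hardy_norm (\<lambda>y. snd (E (x, y)) \<bullet> snd (B (x, y))) \<partial>lborel)
                 \<le> ennreal (C * Lp_norm p E * Lp_norm q B)"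
proof -
  obtain C1 where C1: "0 < C1" "\<And>(F :: 'a \<times> 'b \<Rightarrow> 'a \<times> 'b) G d. F \<in> borel_measurable borel \<Longrightarrow> G \<in> borel_measurable borel \<Longrightarrow>
      div_free F \<Longrightarrow> curl_free G \<Longrightarrow> 0 < d \<Longrightarrow>
      hardy_norm (\<lambda>y. F y \<bullet> G y) \<le> ennreal C1 * (ennreal (d powr p) * (\<integral>\<^sup>+y. ennreal (norm (F y) powr p) \<partial>lborel)
        + ennreal (d powr (- q)) * (\<integral>\<^sup>+y. ennreal (norm (G y) powr q) \<partial>lborel))"
    using div_curl_hardy_norm[OF assms] by blast
  obtain C2 where C2: "0 < C2" "\<And>(F :: 'b \<Rightarrow> 'b) G d. F \<in> borel_measurable borel \<Longrightarrow> G \<in> borel_measurable borel \<Longrightarrow>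
      div_free F \<Longrightarrow> curl_free G \<Longrightarrow> 0 < d \<Longrightarrow>
      hardy_norm (\<lambda>y. F y \<bullet> G y) \<le> ennreal C2 * (ennreal (d powr p) * (\<integral>\<^sup>+y. ennreal (norm (F y) powr p) \<partial>lborel)
        + ennreal (d powr (- q)) * (\<integral>\<^sup>+y. ennreal (norm (G y) powr q) \<partial>lborel))"
    using div_curl_hardy_norm[OF assms] by blast
  \<comment> \<open>\<open>C1\<close> belongs to the full product space, \<open>C2\<close> to the
    slices; the 2 comes from \<open>le_product_of_scaled_sums\<close>.\<close>
  define C where "C = 2 * (C1 + C2)"
  show ?thesis
  proof (intro exI[of _ C] allI impI)
    fix E B :: "'a \<times> 'b \<Rightarrow> 'a \<times> 'b"
    assume hyp: "in_Lp p E \<and> in_Lp q B \<and> div_free E \<and> curl_free B \<and>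
           (\<forall>x. div_free (\<lambda>y. snd (E (x, y)))) \<and> (\<forall>x. curl_free (\<lambda>y. snd (B (x, y))))"
    then have [measurable]: "E \<in> borel_measurable borel" "B \<in> borel_measurable borel"
      and int: "integrable lborel (\<lambda>z. norm (E z) powr p)" "integrable lborel (\<lambda>z. norm (B z) powr q)"
      by (simp_all add: in_Lp_def)
    define P where "P = (\<integral>z. norm (E z) powr p \<partial>lborel)"
    define Q where "Q = (\<integral>z. norm (B z) powr q \<partial>lborel)"
    have P: "(\<integral>\<^sup>+z. ennreal (norm (E z) powr p) \<partial>lborel) = ennreal P" "0 \<le> P"
      unfolding P_def by (rule nn_integral_eq_integral[OF int(1)]) auto
    have Q: "(\<integral>\<^sup>+z. ennreal (norm (B z) powr q) \<partial>lborel) = ennreal Q" "0 \<le> Q"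
      unfolding Q_def by (rule nn_integral_eq_integral[OF int(2)]) auto
    have bound: "X \<le> ennreal (C * Lp_norm p E * Lp_norm q B)"
      if D: "0 < D" "D \<le> C1 + C2" and le: "\<And>d. 0 < d \<Longrightarrow> X \<le> ennreal D * (ennreal (d powr p) * ennreal P + ennreal (d powr (- q)) * ennreal Q)" for X D
    proof -
      have "X \<le> ennreal (2 * D * P powr (1 / p) * Q powr (1 / q))"
        by (rule le_product_of_scaled_sums[OF assms D(1) P(2) Q(2) le])
      also have "\<dots> \<le> ennreal (C * Lp_norm p E * Lp_norm q B)"
        unfolding Lp_norm_def P_def[symmetric] Q_def[symmetric] C_def
        using D by (intro ennreal_leI mult_right_mono) auto
      finally show ?thesis .
    qed
    have "hardy_norm (\<lambda>z. E z \<bullet> B z) \<le> ennreal (C * Lp_norm p E * Lp_norm q B)"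
    proof (rule bound[of C1])
      show "hardy_norm (\<lambda>z. E z \<bullet> B z) \<le> ennreal C1 * (ennreal (d powr p) * ennreal P + ennreal (d powr (- q)) * ennreal Q)" if "0 < d" for d
        unfolding P(1)[symmetric] Q(1)[symmetric] using hyp by (intro C1(2) that) auto
    qed (use C1 C2 in auto)
    moreover have "(\<integral>\<^sup>+x. hardy_norm (\<lambda>y. snd (E (x, y)) \<bullet> snd (B (x, y))) \<partial>lborel) \<le> ennreal (C * Lp_norm p E * Lp_norm q B)"
    proof (rule bound[of C2])
      fix d :: real assume d: "0 < d"
      have slice: "(\<lambda>y. snd (H (x, y))) \<in> borel_measurable borel" if "H \<in> borel_measurable borel" for H :: "'a \<times> 'b \<Rightarrow> 'a \<times> 'b" and x
      proof -
        have "(\<lambda>y. (x, y)) \<in> borel_measurable borel"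
          by (intro borel_measurable_continuous_onI continuous_intros)
        from measurable_compose[OF measurable_compose[OF this that], of snd borel] show ?thesis
          by (simp add: borel_measurable_continuous_onI continuous_on_snd)
      qed
      show "(\<integral>\<^sup>+x. hardy_norm (\<lambda>y. snd (E (x, y)) \<bullet> snd (B (x, y))) \<partial>lborel)
        \<le> ennreal C2 * (ennreal (d powr p) * ennreal P + ennreal (d powr (- q)) * ennreal Q)"
        unfolding P(1)[symmetric] Q(1)[symmetric]
      proof (rule slices_hardy_norm_le)
        show "hardy_norm (\<lambda>y. snd (E (x, y)) \<bullet> snd (B (x, y))) \<le> ennreal C2 *
          (ennreal (d powr p) * (\<integral>\<^sup>+y. ennreal (norm (snd (E (x, y))) powr p) \<partial>lborel)
           + ennreal (d powr (- q)) * (\<integral>\<^sup>+y. ennreal (norm (snd (B (x, y))) powr q) \<partial>lborel))" for x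
          using hyp by (intro C2(2) slice d) auto
      qed (use assms in auto)
    qed (use C1 C2 in auto)
    ultimately show "hardy_norm (\<lambda>z. E z \<bullet> B z) \<le> ennreal (C * Lp_norm p E * Lp_norm q B)
             \<and> (\<integral>\<^sup>+x. hardy_norm (\<lambda>y. snd (E (x, y)) \<bullet> snd (B (x, y))) \<partial>lborel)
                 \<le> ennreal (C * Lp_norm p E * Lp_norm q B)"
      by simp
  qed
qed

end
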